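(* If a $d$-pre-Calabi-Yau morphism is a homotopy equivalence, then it is a quasi-isomorphism.
   Context: Conventions. $\Bbbk$ is a field of characteristic different from $2$ and $3$, $d\in\mathbb Z$, $\otimes=\otimes_\Bbbk$. Graded spaces are $\mathbb Z$-graded, $V[n]^i=V^{n+i}$, and $s_n:V\to V[n]$ (degree $-n$) is the identity on underlying sets. Maps may have any degree, $\mathcal Hom$ denotes the graded space of such maps, products are graded products, and the Koszul sign rule is used. For a graded space $V$, $V[t]$ is the space of polynomials in $t$ with coefficients in $V$. A graded quiver $\mathcal A$ with object set $\mathcal O_{\mathcal A}$ is a family of graded spaces ${}_x\mathcal A_y$. For a tuple of objects $\bar x=(x_1,\dots,x_p)$, $p\ge1$: $\mathrm{lg}(\bar x)=p$, $\mathrm{lt}(\bar x)=x_1$, $\mathrm{rt}(\bar x)=x_p$, $\mathcal A[1]^{\otimes\bar x}={}_{x_1}\mathcal A_{x_2}[1]\otimes\cdots\otimes{}_{x_{p-1}}\mathcal A_{x_p}[1]$ ($=\Bbbk$ if $p=1$). The spaces $\mathfrak h$. For $\Phi_0:\mathcal O_{\mathcal A}\to\mathcal O_{\mathcal B}$ consider families $F'=(F'^{\mathbf x})$, indexed by all types $\mathbf x=(\bar x^1,\dots,\bar x^n)$, $n\ge1$, with $\bar x^i$ nonempty tuples in $\mathcal O_{\mathcal A}$ (tuples of length $1$, i.e. blocks without inputs, are allowed), $F'^{\mathbf x}\in\mathcal Hom(\bigotimes_{i=1}^n\mathcal A[1]^{\otimes\bar x^i},O_1\otimes\cdots\otimes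 O_n)$, $O_i={}_{\Phi_0(\mathrm{lt}(\bar x^i))}\mathcal B_{\Phi_0(\mathrm{rt}(\bar x^{i+1}))}[-d]$ (indices mod $n$), which are cyclically invariant: $F'^{(\bar x^2,\dots,\bar x^n,\bar x^1)}$ is obtained from $F'^{\mathbf x}$ by rotating simultaneously the $n$ input blocks and the $n$ outputs with Koszul signs. They form a graded space; $\mathfrak h_{\Phi_0}(\mathcal A,\mathcal B)$ is its shift by $[d+1]$. Its elements are $F=s_{d+1}F'$, $|F|=|F'|-(d+1)$. Put $\mathfrak h(\mathcal A)=\mathfrak h_{\mathrm{id}}(\mathcal A,\mathcal A)$. Diagrams. A component of type $\mathbf x$ is drawn as a disc with cyclic boundary word $W(\mathbf x)=I_n\,o_{n-1}\,I_{n-1}\,o_{n-2}\cdots o_1\,I_1\,o_n$, where $I_i$ is the sequence of the $\mathrm{lg}(\bar x^i)-1$ incoming letters of the block $\bar x^i$ and $o_i$ is the $i$-th outgoing letter; the corners between letters carry the objects of $\mathbf x$. A diagram is a finite tree of discs (up to isomorphism), each edge joining an outgoing letter $p$ of one disc to an incoming letter $q$ of another; gluing replaces $q$ by $W$ if the cyclic word of the disc containing $p$ is $p\,W$ (corners being identified). A diagram has type $\mathbf x$ if, with a numbering of the remaining outgoing letters, its cyclic word is $W(\mathbf x)$. Corners of the diagram are labelled by objects of the source quiver; a disc filled with a structure or morphism starting from another quiver uses the images of these labels under the relevant object map. Each edge is the map $S=s_{d+1}:(-)[-d]\to(-)[1]$. A product of maps attached to discs and edges, written so that every map stands to the left of the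 maps whose outputs it receives, is evaluated from right to left, each factor acting on its own wires and as identity on the others, with Koszul signs (also for permutations of wires); external inputs are ordered by the blocks of $\mathbf x$ and external outputs by their numbering. A factor $SF'$ or $F'S$ has degree $|F|$. Pre-Calabi-Yau structures and morphisms. For $f,g\in\mathfrak h(\mathcal A)$, $f\circ_{nec}g=s_{d+1}\sum f'Sg'$, the sum over all diagrams (of each type) with two discs filled with $f,g$ and one edge from an output of $g$ to an input of $f$; $[f,g]_{nec}=f\circ_{nec}g-(-1)^{|f||g|}g\circ_{nec}f$. A $d$-pre-Calabi-Yau structure on $\mathcal A$ is $M\in\mathfrak h(\mathcal A)$ of degree $1$ with $[M,M]_{nec}=0$; a $d$-pre-Calabi-Yau category is a graded quiver with such a structure. A $d$-pre-Calabi-Yau morphism $(\Phi_0,F):(\mathcal A,M_{\mathcal A})\to(\mathcal B,M_{\mathcal B})$ is $F\in\mathfrak h_{\Phi_0}(\mathcal A,\mathcal B)$ of degree $0$ with $F\circ_{multinec}M_{\mathcal A}=M_{\mathcal B}\circ_{pre}F$, where $F\circ_{multinec}M_{\mathcal A}=s_{d+1}\sum\prod_v(F'_vS_v)\,M'_{\mathcal A}$ over diagrams with one disc filled with $M_{\mathcal A}$, each of whose outgoing letters is joined to an incoming letter of its own disc $v$ filled with $F$ (no other discs), and $M_{\mathcal B}\circ_{pre}F=s_{d+1}\sum M'_{\mathcal B}\prod_v(S_vF'_v)$ over diagrams with one disc filled with $M_{\mathcal B}$, each of whose incoming letters is joined to an outgoing letter of its own disc $v$ filled with $F$ (no other discs).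 Composition. For morphisms $F:\mathcal A\to\mathcal B$, $G:\mathcal B\to\mathcal C$, $G\circ F=s_{d+1}\sum X$ over all diagrams with discs filled with $F$ or $G$ in which every outgoing letter of a disc $F$ is joined to an incoming letter of a disc $G$ and every incoming letter of a disc $G$ is joined to an outgoing letter of a disc $F$. Here $X=G'_{v_0}\prod_w(G'_wS_{e_w})\prod_v(S_{e_v}F'_v)$, where $v_0$ is the disc carrying the last output, $w$ runs over the other discs $G$, $v$ over the discs $F$, and $e_u$ is the edge at the disc $u$ in the direction of $v_0$. The object map is the composite. The identity morphism has object map $\mathrm{id}$ and component $S^{-1}:{}_x\mathcal A_y[1]\to{}_x\mathcal A_y[-d]$ for the type $((x,y))$, all other components zero. Homotopy. $(\Phi_0,F),(\Phi_0,G):(\mathcal A,M_{\mathcal A})\to(\mathcal B,M_{\mathcal B})$ are homotopic if there are $a(t),b(t)\in\mathfrak h_{\Phi_0}(\mathcal A,\mathcal B)[t]$ with $|a(t)|=0$, $|b(t)|=-1$, $a(0)=F$, $a(1)=G$, $(\Phi_0,a(t))$ a $d$-pre-Calabi-Yau morphism $(\mathcal A,M_{\mathcal A})\to(\mathcal B,M_{\mathcal B})$ for all $t\in\Bbbk$, and, for all $t\in\Bbbk$ and in every type, $\frac{\partial a}{\partial t}=s_{d+1}\sum M'_{\mathcal B}(Sb')\prod(Sa')+s_{d+1}\sum(b'S)\prod(a'S)M'_{\mathcal A}$, the sums being over the diagrams of $\circ_{pre}$ resp. $\circ_{multinec}$ with exactly one of the discs $F$ filled with $b(t)$ and the others with $a(t)$.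 (In particular homotopic morphisms have the same object map.) A $d$-pre-Calabi-Yau morphism $(\Phi_0,F):(\mathcal A,M_{\mathcal A})\to(\mathcal B,M_{\mathcal B})$ is a homotopy equivalence if there is a $d$-pre-Calabi-Yau morphism $(\Psi_0,G):(\mathcal B,M_{\mathcal B})\to(\mathcal A,M_{\mathcal A})$ such that $(\Psi_0\circ\Phi_0,G\circ F)$ is homotopic to the identity of $\mathcal A$ and $(\Phi_0\circ\Psi_0,F\circ G)$ is homotopic to the identity of $\mathcal B$. For $x,y\in\mathcal O_{\mathcal A}$, $F^{x,y}=S\circ F'^{((x,y))}:{}_x\mathcal A_y[1]\to{}_{\Phi_0(x)}\mathcal B_{\Phi_0(y)}[1]$ is regarded as a chain map for the differentials $S\circ M_{\mathcal A}'^{((x,y))}$ and $S\circ M_{\mathcal B}'^{((\Phi_0(x),\Phi_0(y)))}$; $(\Phi_0,F)$ is a quasi-isomorphism if $F^{x,y}$ is a quasi-isomorphism of complexes for all $x,y\in\mathcal O_{\mathcal A}$.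
   Formalization: Structures and morphisms are assumed to vanish on types ((x)) (else the sums are infinite and F^{x,y} is no chain map); in characteristic p>0 homotopies must satisfy deg_t a < p and deg_t a + deg_t b < p, since otherwise a(t)=t^p id, b=0 makes the zero morphism an equivalence. *)

theory Defs
  imports Complex_Main "HOL-Library.Poly_Mapping"
begin

section \<open>Formal sums and tensor products\<close>

text \<open>
  All graded spaces of the development are families of subspaces of one ambient \<open>k\<close>-vector space,
  the type \<open>'v\<close> with scalar multiplication \<open>scale\<close>.  This is no restriction: any two (set-indexed)
  families of vector spaces embed into their common direct sum.  The subspaces in a family need not be
  independent; homogeneous vectors therefore carry their degree as a tag.

  An element of a tensor product of graded spaces is represented by a formal linear combination of
  lists of homogeneous vectors; two formal sums represent the same tensor iff their difference lies
  in the span of the multilinearity relations.  Since \<open>k\<close> is a field, tensor products of subspaces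
  embed into tensor products of the ambient space, so one relation serves all subspaces.
\<close>

type_synonym 'v hvec = "int \<times> 'v"

definition smul :: "'k::field \<Rightarrow> ('b \<Rightarrow>\<^sub>0 'k) \<Rightarrow> ('b \<Rightarrow>\<^sub>0 'k)" where
  "smul c p = Poly_Mapping.map ((*) c) p"

definition lin_ext :: "('b \<Rightarrow> ('c \<Rightarrow>\<^sub>0 'k)) \<Rightarrow> ('b \<Rightarrow>\<^sub>0 'k::field) \<Rightarrow> ('c \<Rightarrow>\<^sub>0 'k)" where
  "lin_ext f p = (\<Sum>w\<in>Poly_Mapping.keys p. smul (Poly_Mapping.lookup p w) (f w))"

definition tensor_rels :: "('k::field \<Rightarrow> 'v::ab_group_add \<Rightarrow> 'v) \<Rightarrow> ('v hvec list \<Rightarrow>\<^sub>0 'k) set" where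
  "tensor_rels scale =
     {Poly_Mapping.single (us @ (i, v + scale c v') # ws) 1
      - Poly_Mapping.single (us @ (i, v) # ws) 1
      - Poly_Mapping.single (us @ (i, v') # ws) c | us ws i v v' c. True}"

definition tensor_eq ::
  "('k::field \<Rightarrow> 'v::ab_group_add \<Rightarrow> 'v) \<Rightarrow> ('v hvec list \<Rightarrow>\<^sub>0 'k) \<Rightarrow> ('v hvec list \<Rightarrow>\<^sub>0 'k) \<Rightarrow> bool" where
  "tensor_eq scale p q \<longleftrightarrow> p - q \<in> module.span smul (tensor_rels scale)"

text \<open>The identification of \<open>V\<^sup>\<otimes>\<^sup>1\<close> with \<open>V\<close>.\<close>

definition tensor1_val :: "('k::field \<Rightarrow> 'v::ab_group_add \<Rightarrow> 'v) \<Rightarrow> ('v hvec list \<Rightarrow>\<^sub>0 'k) \<Rightarrow> 'v" where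
  "tensor1_val scale p = (\<Sum>w\<in>Poly_Mapping.keys p. scale (Poly_Mapping.lookup p w) (snd (hd w)))"

definition ksign :: "int \<Rightarrow> int \<Rightarrow> 'k::field" where
  "ksign i j = (if odd (i * j) then - 1 else 1)"

definition tdeg :: "'v hvec list \<Rightarrow> int" where
  "tdeg ws = sum_list (map fst ws)"


section \<open>Graded quivers and the spaces h\<close>

record ('o, 'v) quiver =
  Obj :: "'o set"
  Sp :: "'o \<Rightarrow> 'o \<Rightarrow> int \<Rightarrow> 'v set"

definition graded_quiver ::
  "('k::field \<Rightarrow> 'v::ab_group_add \<Rightarrow> 'v) \<Rightarrow> ('o, 'v) quiver \<Rightarrow> bool" where
  "graded_quiver scale A \<longleftrightarrow>
     (\<forall>x\<in>Obj A. \<forall>y\<in>Obj A. \<forall>i. module.subspace scale (Sp A x y i))"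

definition types :: "('o, 'v) quiver \<Rightarrow> 'o list list set" where
  "types A = {x. x \<noteq> [] \<and> (\<forall>b\<in>set x. b \<noteq> [] \<and> set b \<subseteq> Obj A)}"

text \<open>
  Tags of incoming wires are degrees in \<open>A[1]\<close>, tags of outgoing wires are degrees in \<open>B[-d]\<close>.
\<close>

definition inputs :: "('o, 'v) quiver \<Rightarrow> 'o list list \<Rightarrow> 'v hvec list set" where
  "inputs A x = {vs. list_all2 (\<lambda>(a, b) (i, v). v \<in> Sp A a b (i + 1))
     (concat (map (\<lambda>b. zip (butlast b) (tl b)) x)) vs}"

definition outputs ::
  "int \<Rightarrow> ('p, 'v) quiver \<Rightarrow> ('o \<Rightarrow> 'p) \<Rightarrow> 'o list list \<Rightarrow> 'v hvec list set" where
  "outputs d B \<Phi> x = {ws. list_all2 (\<lambda>(a, b) (i, v). v \<in> Sp B a b (i - d))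
     (map2 (\<lambda>b b'. (\<Phi> (hd b), \<Phi> (last b'))) x (rotate1 x)) ws}"

text \<open>
  A family \<open>F'\<close>: for a type \<open>x\<close> and a list of input vectors (all blocks concatenated), a
  representative of the value in the tensor product of the outputs.
\<close>

type_synonym ('o, 'v, 'k) family = "'o list list \<Rightarrow> 'v hvec list \<Rightarrow> ('v hvec list \<Rightarrow>\<^sub>0 'k)"

definition fam_eq ::
  "('k::field \<Rightarrow> 'v::ab_group_add \<Rightarrow> 'v) \<Rightarrow> ('o, 'v) quiver
    \<Rightarrow> ('o, 'v, 'k) family \<Rightarrow> ('o, 'v, 'k) family \<Rightarrow> bool" where
  "fam_eq scale A F G \<longleftrightarrow> (\<forall>x\<in>types A. \<forall>vs\<in>inputs A x. tensor_eq scale (F x vs) (G x vs))"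

definition rotate_outputs :: "('v hvec list \<Rightarrow>\<^sub>0 'k::field) \<Rightarrow> ('v hvec list \<Rightarrow>\<^sub>0 'k)" where
  "rotate_outputs = lin_ext (\<lambda>w. Poly_Mapping.single (rotate1 w) (ksign (fst (hd w)) (tdeg (tl w))))"

text \<open>
  \<open>h_elem scale d A B \<Phi> n F\<close>: the family \<open>F = F'\<close> represents an element \<open>s\<^bsub>d+1\<^esub> F'\<close> of degree \<open>n\<close>
  of \<open>\<hh>\<^bsub>\<Phi>\<^esub>(A, B)\<close>, i.e. \<open>F'\<close> has degree \<open>n + d + 1\<close>.  The four conjuncts on each type: values lie in the
  right tensor product, have the right degree, are multilinear, and are cyclically invariant.
  We always work with the unshifted families \<open>F'\<close>.
\<close>

definition h_elem ::
  "('k::field \<Rightarrow> 'v::ab_group_add \<Rightarrow> 'v) \<Rightarrow> int \<Rightarrow> ('o, 'v) quiver \<Rightarrow> ('p, 'v) quiver \<Rightarrow> ('o \<Rightarrow> 'p)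
    \<Rightarrow> int \<Rightarrow> ('o, 'v, 'k) family \<Rightarrow> bool" where
  "h_elem scale d A B \<Phi> n F \<longleftrightarrow>
     (\<forall>x\<in>types A. \<forall>vs\<in>inputs A x. \<forall>ws\<in>Poly_Mapping.keys (F x vs).
        ws \<in> outputs d B \<Phi> x \<and> tdeg ws = tdeg vs + (n + d + 1)) \<and>
     (\<forall>x\<in>types A. \<forall>us i v v' ws c.
        us @ (i, v) # ws \<in> inputs A x \<and> us @ (i, v') # ws \<in> inputs A x \<longrightarrow>
        tensor_eq scale (F x (us @ (i, v + scale c v') # ws))
          (F x (us @ (i, v) # ws) + smul c (F x (us @ (i, v') # ws)))) \<and>
     (\<forall>b x us vs. b # x \<in> types A \<and> us @ vs \<in> inputs A (b # x) \<and> length us = length b - 1 \<longrightarrow>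
        tensor_eq scale (F (x @ [b]) (vs @ us))
          (smul (ksign (tdeg us) (tdeg vs)) (rotate_outputs (F (b # x) (us @ vs)))))"

text \<open>
  Vanishing of the components of type \<open>((x))\<close> (no input, one output).
\<close>

definition uncurved ::
  "('k::field \<Rightarrow> 'v::ab_group_add \<Rightarrow> 'v) \<Rightarrow> ('o, 'v) quiver \<Rightarrow> ('o, 'v, 'k) family \<Rightarrow> bool" where
  "uncurved scale A F \<longleftrightarrow> (\<forall>x\<in>Obj A. tensor_eq scale (F [[x]] []) 0)"


section \<open>Diagrams\<close>

datatype pol = In | Out

fun opp :: "pol \<Rightarrow> pol" where
  "opp In = Out"
| "opp Out = In"

text \<open>
  Isomorphism classes of diagrams with numbered external outputs.  Such a diagram is rooted at the
  disc carrying the last external output, and rooting leaves no automorphisms: every disc then has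
  a distinguished root letter, namely the last external output for the root disc, and for any other disc
  its end of the edge in the direction of the root.  A disc is given by its filling and the word of
  its remaining letters, read cyclically starting after the root letter; each of these letters is
  either external (\<open>None\<close>) or joined to (the root letter, of opposite polarity, of) another disc.

  Letters and edges are named by paths: the \<open>i\<close>-th non-root letter of the disc with path \<open>\<pi>\<close> has the
  name \<open>\<pi> @ [i]\<close>, which is also the path, and the name of the root letter, of the disc joined to it.
\<close>

datatype 'l diagram = Disc (filling: 'l) (slots: "(pol \<times> 'l diagram option) list")

datatype ('l, 'o) letter =
  Letter (pol: pol) (name: "nat list") (mate: "'l option") (corner: 'o)

text \<open>
  The external letters of a diagram other than the last output, in the order of its boundary word.
  Gluing replaces a letter by the word of the attached disc that follows its root letter.
\<close>

function leaves :: "nat list \<Rightarrow> 'l diagram \<Rightarrow> (pol \<times> nat list) list" where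
  "leaves \<pi> (Disc l ss) = concat (map (\<lambda>i. case ss ! i of
       (p, None) \<Rightarrow> [(p, \<pi> @ [i])]
     | (p, Some D) \<Rightarrow> leaves (\<pi> @ [i]) D) [0..<length ss])"
  by pat_completeness auto
termination
proof (relation "measure (\<lambda>(\<pi>, D). size D)")
  fix \<pi> :: "nat list" and l :: 'l and ss :: "(pol \<times> 'l diagram option) list"
    and i p and y :: "'l diagram option" and D :: "'l diagram"
  assume "i \<in> set [0..<length ss]" "(p, y) = ss ! i" "y = Some D"
  then have "(p, Some D) \<in> set ss"
    by (metis atLeastLessThan_iff nth_mem set_upt)
  then have "size D < Suc (size_list (size_prod (\<lambda>_. 0) (size_option size)) ss)"
    by (induction ss) auto
  then show "((\<pi> @ [i], D), (\<pi>, Disc l ss)) \<in> measure (\<lambda>(\<pi>, D). size D)"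
    by simp
qed simp

text \<open>
  The discs of a diagram, each with its filling and its word, the root letter being put last.
  The arguments: the corners \<open>c\<close> of the diagram, in the order of its boundary word (no
  corner disappears under gluing); the number \<open>k\<close> of boundary letters read so far; the path, and
  polarity and mate of the root letter.  The \<open>mate\<close> of a letter is the filling of the
  disc it is joined to; its \<open>corner\<close> is the corner in front of it.
\<close>

function discs ::
  "(nat \<Rightarrow> 'o) \<Rightarrow> nat \<Rightarrow> nat list \<Rightarrow> pol \<Rightarrow> 'l option \<Rightarrow> 'l diagram
    \<Rightarrow> ('l \<times> ('l, 'o) letter list) list" where
  "discs c k \<pi> p m (Disc l ss) =
     (let pos = (\<lambda>i. k + length (leaves [] (Disc l (take i ss)))) in
      (l, map (\<lambda>i. Letter (fst (ss ! i)) (\<pi> @ [i]) (map_option filling (snd (ss ! i))) (c (pos i)))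
              [0..<length ss]
          @ [Letter p \<pi> m (c (pos (length ss)))])
      # concat (map (\<lambda>i. case ss ! i of
            (q, None) \<Rightarrow> []
          | (q, Some D) \<Rightarrow> discs c (pos i) (\<pi> @ [i]) (opp q) (Some l) D) [0..<length ss]))"
  by pat_completeness auto
termination
proof (relation "measure (\<lambda>(c, k, \<pi>, p, m, D). size D)")
  fix c :: "nat \<Rightarrow> 'o" and k k' :: nat and \<pi> :: "nat list" and r q :: pol and m :: "'l option"
    and l :: 'l and ss :: "(pol \<times> 'l diagram option) list"
    and i and y :: "'l diagram option" and D :: "'l diagram" and pos :: "nat \<Rightarrow> nat"
  assume "i \<in> set [0..<length ss]" "(q, y) = ss ! i" "y = Some D"
  then have "(q, Some D) \<in> set ss"
    by (metis atLeastLessThan_iff nth_mem set_upt)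
  then have "size D < Suc (size_list (size_prod (\<lambda>_. 0) (size_option size)) ss)"
    by (induction ss) auto
  then show "((c, pos i, \<pi> @ [i], opp q, Some l, D), (c, k, \<pi>, r, m, Disc l ss))
     \<in> measure (\<lambda>(c, k, \<pi>, p, m, D). size D)"
    by simp
qed simp

text \<open>
  A word \<open>I\<^sub>n o\<^bsub>n-1\<^esub> I\<^bsub>n-1\<^esub> \<dots> o\<^sub>1 I\<^sub>1 o\<^sub>n\<close> is cut behind its outgoing letters; the resulting segments are
  \<open>I\<^sub>i o\<^bsub>i-1\<^esub>\<close> for \<open>i = n, \<dots>, 1\<close>, and the corners in front of the letters of such a segment form the
  tuple \<open>x\<^sup>i\<close>.  \<open>normalize\<close> rotates a cyclic word so that it ends with an outgoing letter; by cyclic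
  invariance it does not matter which one.
\<close>

fun segments :: "('l, 'o) letter list \<Rightarrow> ('l, 'o) letter list list" where
  "segments [] = []"
| "segments (a # w) = (if pol a = Out then [a] # segments w
     else (case segments w of [] \<Rightarrow> [[a]] | s # ss \<Rightarrow> (a # s) # ss))"

definition normalize :: "('l, 'o) letter list \<Rightarrow> ('l, 'o) letter list" where
  "normalize w = rev (takeWhile (\<lambda>a. pol a = In) (rev w)) @ rev (dropWhile (\<lambda>a. pol a = In) (rev w))"

definition word_type :: "('l, 'o) letter list \<Rightarrow> 'o list list" where
  "word_type w = rev (map (map corner) (segments w))"

definition word_ins :: "('l, 'o) letter list \<Rightarrow> nat list list" where
  "word_ins w = map name (concat (rev (map butlast (segments w))))"

definition word_outs :: "('l, 'o) letter list \<Rightarrow> nat list list" where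
  "word_outs w = map name (rotate1 (rev (map last (segments w))))"

definition type_word :: "'o list list \<Rightarrow> pol list" where
  "type_word x = concat (map (\<lambda>b. replicate (length b - 1) In @ [Out]) (rev x))"

definition has_type :: "'o list list \<Rightarrow> 'l diagram \<Rightarrow> bool" where
  "has_type x D \<longleftrightarrow> map fst (leaves [] D) @ [Out] = type_word x"

definition boundary :: "'o list list \<Rightarrow> 'l diagram \<Rightarrow> ('l, 'o) letter list" where
  "boundary x D = map2 (\<lambda>(p, n) c. Letter p n None c) (leaves [] D @ [(Out, [])]) (concat (rev x))"

definition discs_of :: "'o list list \<Rightarrow> 'l diagram \<Rightarrow> ('l \<times> ('l, 'o) letter list) list" where
  "discs_of x D = discs (\<lambda>j. concat (rev x) ! j) 0 [] Out None D"

definition diagrams :: "'o list list \<Rightarrow> 'l diagram set" where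
  "diagrams x = {D. has_type x D \<and> (\<forall>(l, w)\<in>set (discs_of x D). \<exists>a\<in>set w. pol a = Out)}"


section \<open>Evaluation of diagrams\<close>

text \<open>
  A state is a tensor of named wires.  A factor acts by moving its own input wires, with Koszul
  signs, to the front, where no further sign arises.
\<close>

type_synonym ('v, 'k) state = "(nat list \<times> 'v hvec) list \<Rightarrow>\<^sub>0 'k"

definition pull :: "nat list \<Rightarrow> ('v, 'k::field) state \<Rightarrow> ('v, 'k) state" where
  "pull n = lin_ext (\<lambda>w.
     let u = takeWhile (\<lambda>z. fst z \<noteq> n) w; r = dropWhile (\<lambda>z. fst z \<noteq> n) w
     in Poly_Mapping.single (hd r # u @ tl r) (ksign (fst (snd (hd r))) (tdeg (map snd u))))"

definition bring :: "nat list list \<Rightarrow> ('v, 'k::field) state \<Rightarrow> ('v, 'k) state" where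
  "bring ns = foldr pull ns"

text \<open>The map \<open>S = s\<^bsub>d+1\<^esub> : (-)[-d] \<rightarrow> (-)[1]\<close>, of degree \<open>-(d+1)\<close> and the identity on vectors.\<close>

definition act_edge :: "int \<Rightarrow> nat list \<Rightarrow> ('v, 'k::field) state \<Rightarrow> ('v, 'k) state" where
  "act_edge d n p = lin_ext (\<lambda>w. case w of
       [] \<Rightarrow> 0
     | (n', (i, v)) # r \<Rightarrow> Poly_Mapping.single ((n', (i - (d + 1), v)) # r) 1) (bring [n] p)"

definition act_disc ::
  "('l \<Rightarrow> ('o, 'v, 'k) family) \<Rightarrow> 'l \<times> ('l, 'o) letter list \<Rightarrow> ('v, 'k::field) state \<Rightarrow> ('v, 'k) state" where
  "act_disc fill \<delta> p =
     (let w = normalize (snd \<delta>); ins = word_ins w; outs = word_outs w; m = length ins in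
      lin_ext (\<lambda>z. lin_ext (\<lambda>us. Poly_Mapping.single (zip outs us @ drop m z) 1)
          (fill (fst \<delta>) (word_type w) (map snd (take m z))))
        (bring ins p))"

text \<open>The value of a product of factors, listed in the order in which they are applied.\<close>

definition eval_diagram ::
  "'o list list \<Rightarrow> 'l diagram \<Rightarrow> (('v, 'k::field) state \<Rightarrow> ('v, 'k) state) list
    \<Rightarrow> 'v hvec list \<Rightarrow> ('v hvec list \<Rightarrow>\<^sub>0 'k)" where
  "eval_diagram x D factors vs =
     (let w = boundary x D in
      lin_ext (\<lambda>z. Poly_Mapping.single (map snd z) 1)
        (bring (word_outs w)
          (fold (\<lambda>f. f) factors (Poly_Mapping.single (zip (word_ins w) vs) 1))))"

definition discs_with :: "'l \<Rightarrow> 'o list list \<Rightarrow> 'l diagram \<Rightarrow> ('l \<times> ('l, 'o) letter list) list" where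
  "discs_with l x D = filter (\<lambda>\<delta>. fst \<delta> = l) (discs_of x D)"

text \<open>The first edge at a disc (used when there is only one), and its edge towards the root.\<close>

definition joint :: "'l \<times> ('l, 'o) letter list \<Rightarrow> nat list" where
  "joint \<delta> = name (hd (filter (\<lambda>a. mate a \<noteq> None) (snd \<delta>)))"

definition root_edge :: "'l \<times> ('l, 'o) letter list \<Rightarrow> nat list" where
  "root_edge \<delta> = name (last (snd \<delta>))"


section \<open>Necklace bracket and composition\<close>

datatype layer = Inner | Outer

definition nec_diagrams :: "'o list list \<Rightarrow> layer diagram set" where
  "nec_diagrams x = {D \<in> diagrams x.
     length (discs_with Inner x D) = 1 \<and> length (discs_with Outer x D) = 1 \<and>
     (\<forall>(l, w)\<in>set (discs_of x D). \<forall>a\<in>set w. mate a \<noteq> None \<longrightarrow>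
        pol a = (if l = Inner then Out else In))}"

definition circ_nec ::
  "int \<Rightarrow> ('o, 'v, 'k::field) family \<Rightarrow> ('o, 'v, 'k) family \<Rightarrow> ('o, 'v, 'k) family" where
  "circ_nec d f g = (\<lambda>x vs. \<Sum>D\<in>nec_diagrams x.
     let fill = (\<lambda>l. case l of Inner \<Rightarrow> g | Outer \<Rightarrow> f);
         \<gamma> = hd (discs_with Inner x D); \<phi> = hd (discs_with Outer x D)
     in eval_diagram x D [act_disc fill \<gamma>, act_edge d (joint \<gamma>), act_disc fill \<phi>] vs)"

definition nec_bracket ::
  "int \<Rightarrow> int \<Rightarrow> int \<Rightarrow> ('o, 'v, 'k::field) family \<Rightarrow> ('o, 'v, 'k) family \<Rightarrow> ('o, 'v, 'k) family" where
  "nec_bracket d m n f g = (\<lambda>x vs. circ_nec d f g x vs - smul (ksign m n) (circ_nec d g f x vs))"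

text \<open>
  Inner discs (filled with \<open>F\<close>) of type \<open>((x))\<close> are left out here and in the diagrams below:
  morphisms vanish on this type (see \<open>pcy_morphism\<close>), and with such discs there would be
  infinitely many diagrams of a given type; without them every sum over diagrams is finite.
\<close>

definition comp_diagrams :: "'o list list \<Rightarrow> layer diagram set" where
  "comp_diagrams x = {D \<in> diagrams x.
     (\<forall>(l, w)\<in>set (discs_of x D).
        (l = Inner \<longrightarrow> length w \<noteq> 1 \<and>
           (\<forall>a\<in>set w. mate a = (if pol a = Out then Some Outer else None))) \<and>
        (l = Outer \<longrightarrow>
           (\<forall>a\<in>set w. mate a = (if pol a = In then Some Inner else None))))}"

text \<open>The first disc listed by \<open>discs_of\<close> is the root disc \<open>v\<^sub>0\<close>, which here is an outer one.\<close>

definition fam_comp ::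
  "int \<Rightarrow> ('o \<Rightarrow> 'p) \<Rightarrow> ('p, 'v, 'k::field) family \<Rightarrow> ('o, 'v, 'k) family \<Rightarrow> ('o, 'v, 'k) family" where
  "fam_comp d \<Phi> G F = (\<lambda>x vs. \<Sum>D\<in>comp_diagrams x.
     let fill = (\<lambda>l. case l of Inner \<Rightarrow> F | Outer \<Rightarrow> (\<lambda>y. G (map (map \<Phi>) y)));
         inner = discs_with Inner x D; outer = discs_with Outer x D
     in eval_diagram x D
          (concat (map (\<lambda>\<delta>. [act_disc fill \<delta>, act_edge d (root_edge \<delta>)]) inner)
           @ concat (map (\<lambda>\<delta>. [act_edge d (root_edge \<delta>), act_disc fill \<delta>]) (tl outer))
           @ [act_disc fill (hd outer)]) vs)"

definition fam_id :: "int \<Rightarrow> ('o, 'v, 'k::field) family" where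
  "fam_id d = (\<lambda>x vs. case (x, vs) of
       ([[a, b]], [(i, v)]) \<Rightarrow> Poly_Mapping.single [(i + (d + 1), v)] 1
     | _ \<Rightarrow> 0)"


section \<open>Structures, morphisms and homotopies\<close>

datatype role = Str | Mor | Htp

text \<open>
  One disc filled with a structure whose letters of polarity \<open>p\<close> are each joined to a disc of its own,
  filled with a morphism except for \<open>h\<close> of them that are filled with a homotopy.
\<close>

definition star_diagrams :: "pol \<Rightarrow> nat \<Rightarrow> 'o list list \<Rightarrow> role diagram set" where
  "star_diagrams p h x = {D \<in> diagrams x.
     length (discs_with Str x D) = 1 \<and> length (discs_with Htp x D) = h \<and>
     (\<forall>(l, w)\<in>set (discs_of x D).
        (l = Str \<longrightarrow> (\<forall>a\<in>set w. mate a \<noteq> None \<longleftrightarrow> pol a = p)) \<and>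
        (l \<noteq> Str \<longrightarrow> (\<forall>a\<in>set w. mate a \<in> {None, Some Str})) \<and>
        (l = Mor \<longrightarrow> length w \<noteq> 1))}"

definition multinec_sum ::
  "int \<Rightarrow> nat \<Rightarrow> ('o, 'v, 'k::field) family \<Rightarrow> ('o, 'v, 'k) family \<Rightarrow> ('o, 'v, 'k) family
    \<Rightarrow> ('o, 'v, 'k) family" where
  "multinec_sum d h b a M = (\<lambda>x vs. \<Sum>D\<in>star_diagrams Out h x.
     let fill = (\<lambda>l. case l of Str \<Rightarrow> M | Mor \<Rightarrow> a | Htp \<Rightarrow> b) in
     eval_diagram x D
       (map (act_disc fill) (discs_with Str x D)
        @ concat (map (\<lambda>\<delta>. [act_edge d (joint \<delta>), act_disc fill \<delta>])
            (discs_with Mor x D @ discs_with Htp x D))) vs)"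

definition pre_sum ::
  "int \<Rightarrow> nat \<Rightarrow> ('o \<Rightarrow> 'p) \<Rightarrow> ('p, 'v, 'k::field) family \<Rightarrow> ('o, 'v, 'k) family \<Rightarrow> ('o, 'v, 'k) family
    \<Rightarrow> ('o, 'v, 'k) family" where
  "pre_sum d h \<Phi> M b a = (\<lambda>x vs. \<Sum>D\<in>star_diagrams In h x.
     let fill = (\<lambda>l. case l of Str \<Rightarrow> (\<lambda>y. M (map (map \<Phi>) y)) | Mor \<Rightarrow> a | Htp \<Rightarrow> b) in
     eval_diagram x D
       (concat (map (\<lambda>\<delta>. [act_disc fill \<delta>, act_edge d (joint \<delta>)])
            (discs_with Mor x D @ discs_with Htp x D))
        @ map (act_disc fill) (discs_with Str x D)) vs)"

definition circ_multinec ::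
  "int \<Rightarrow> ('o, 'v, 'k::field) family \<Rightarrow> ('o, 'v, 'k) family \<Rightarrow> ('o, 'v, 'k) family" where
  "circ_multinec d F M = multinec_sum d 0 (\<lambda>_ _. 0) F M"

definition circ_pre ::
  "int \<Rightarrow> ('o \<Rightarrow> 'p) \<Rightarrow> ('p, 'v, 'k::field) family \<Rightarrow> ('o, 'v, 'k) family \<Rightarrow> ('o, 'v, 'k) family" where
  "circ_pre d \<Phi> M F = pre_sum d 0 \<Phi> M (\<lambda>_ _. 0) F"

text \<open>
  Structures and morphisms are understood to be uncurved.  If \<open>F\<close> had components without inputs and with
  one output, the sums defining \<open>M \<circ>\<^bsub>pre\<^esub> F\<close> and \<open>G \<circ> F\<close> would be infinite, and without this
  condition on \<open>M\<close> and \<open>F\<close> the maps \<open>S \<circ> M'\<close> and \<open>S \<circ> F'\<close> on the spaces \<open>A(x, y)[1]\<close> would not be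
  differentials and chain maps.  No such condition is imposed on the family \<open>b(t)\<close> of a homotopy.
\<close>

definition pcy_structure ::
  "('k::field \<Rightarrow> 'v::ab_group_add \<Rightarrow> 'v) \<Rightarrow> int \<Rightarrow> ('o, 'v) quiver \<Rightarrow> ('o, 'v, 'k) family \<Rightarrow> bool" where
  "pcy_structure scale d A M \<longleftrightarrow>
     h_elem scale d A A id 1 M \<and> uncurved scale A M \<and>
     fam_eq scale A (nec_bracket d 1 1 M M) (\<lambda>_ _. 0)"

definition pcy_category ::
  "('k::field \<Rightarrow> 'v::ab_group_add \<Rightarrow> 'v) \<Rightarrow> int \<Rightarrow> ('o, 'v) quiver \<Rightarrow> ('o, 'v, 'k) family \<Rightarrow> bool" where
  "pcy_category scale d A M \<longleftrightarrow> graded_quiver scale A \<and> pcy_structure scale d A M"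

definition pcy_morphism ::
  "('k::field \<Rightarrow> 'v::ab_group_add \<Rightarrow> 'v) \<Rightarrow> int
    \<Rightarrow> ('o, 'v) quiver \<Rightarrow> ('o, 'v, 'k) family \<Rightarrow> ('p, 'v) quiver \<Rightarrow> ('p, 'v, 'k) family
    \<Rightarrow> ('o \<Rightarrow> 'p) \<Rightarrow> ('o, 'v, 'k) family \<Rightarrow> bool" where
  "pcy_morphism scale d A M\<^sub>A B M\<^sub>B \<Phi> F \<longleftrightarrow>
     \<Phi> ` Obj A \<subseteq> Obj B \<and> h_elem scale d A B \<Phi> 0 F \<and> uncurved scale A F \<and>
     fam_eq scale A (circ_multinec d F M\<^sub>A) (circ_pre d \<Phi> M\<^sub>B F)"

text \<open>Polynomials in \<open>t\<close> with coefficients in \<open>\<hh>\<close> are lists of coefficients.\<close>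

definition fam_poly :: "('o, 'v, 'k::field) family list \<Rightarrow> 'k \<Rightarrow> ('o, 'v, 'k) family" where
  "fam_poly a t = (\<lambda>x vs. \<Sum>i<length a. smul (t ^ i) ((a ! i) x vs))"

definition fam_poly_deriv :: "('o, 'v, 'k::field) family list \<Rightarrow> 'k \<Rightarrow> ('o, 'v, 'k) family" where
  "fam_poly_deriv a t = (\<lambda>x vs. \<Sum>i<length a. smul (of_nat i * t ^ (i - 1)) ((a ! i) x vs))"

text \<open>
  The last conjunct is void in characteristic \<open>0\<close>.  In characteristic \<open>p > 0\<close> it bounds the degrees in
  \<open>t\<close>: those of \<open>a\<close>, and of \<open>a\<close> and \<open>b\<close> together, are less than \<open>p\<close>.  Without a bound homotopy is
  meaningless there: for zero structures any two morphisms \<open>F, G\<close> with the same object map would be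
  homotopic via \<open>a(t) = F + t\<^sup>p (G - F)\<close> and \<open>b = 0\<close>.
\<close>

definition homotopic ::
  "('k::field \<Rightarrow> 'v::ab_group_add \<Rightarrow> 'v) \<Rightarrow> int
    \<Rightarrow> ('o, 'v) quiver \<Rightarrow> ('o, 'v, 'k) family \<Rightarrow> ('p, 'v) quiver \<Rightarrow> ('p, 'v, 'k) family
    \<Rightarrow> ('o \<Rightarrow> 'p) \<Rightarrow> ('o, 'v, 'k) family \<Rightarrow> ('o \<Rightarrow> 'p) \<Rightarrow> ('o, 'v, 'k) family \<Rightarrow> bool" where
  "homotopic scale d A M\<^sub>A B M\<^sub>B \<Phi> F \<Psi> G \<longleftrightarrow>
     (\<forall>x\<in>Obj A. \<Phi> x = \<Psi> x) \<and>
     (\<exists>a b. (\<forall>f\<in>set a. h_elem scale d A B \<Phi> 0 f) \<and> (\<forall>f\<in>set b. h_elem scale d A B \<Phi> (- 1) f) \<and>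
        fam_eq scale A (fam_poly a 0) F \<and> fam_eq scale A (fam_poly a 1) G \<and>
        (\<forall>t. pcy_morphism scale d A M\<^sub>A B M\<^sub>B \<Phi> (fam_poly a t)) \<and>
        (\<forall>t. fam_eq scale A (fam_poly_deriv a t)
           (\<lambda>x vs. pre_sum d 1 \<Phi> M\<^sub>B (fam_poly b t) (fam_poly a t) x vs
                 + multinec_sum d 1 (fam_poly b t) (fam_poly a t) M\<^sub>A x vs)) \<and>
        (CHAR('k) = 0 \<or> length a \<le> CHAR('k) \<and> length a + length b \<le> CHAR('k) + 1))"

definition homotopy_equivalence ::
  "('k::field \<Rightarrow> 'v::ab_group_add \<Rightarrow> 'v) \<Rightarrow> int
    \<Rightarrow> ('o, 'v) quiver \<Rightarrow> ('o, 'v, 'k) family \<Rightarrow> ('p, 'v) quiver \<Rightarrow> ('p, 'v, 'k) family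
    \<Rightarrow> ('o \<Rightarrow> 'p) \<Rightarrow> ('o, 'v, 'k) family \<Rightarrow> bool" where
  "homotopy_equivalence scale d A M\<^sub>A B M\<^sub>B \<Phi> F \<longleftrightarrow>
     pcy_morphism scale d A M\<^sub>A B M\<^sub>B \<Phi> F \<and>
     (\<exists>\<Psi> G. pcy_morphism scale d B M\<^sub>B A M\<^sub>A \<Psi> G \<and>
        homotopic scale d A M\<^sub>A A M\<^sub>A (\<Psi> \<circ> \<Phi>) (fam_comp d \<Phi> G F) id (fam_id d) \<and>
        homotopic scale d B M\<^sub>B B M\<^sub>B (\<Phi> \<circ> \<Psi>) (fam_comp d \<Psi> F G) id (fam_id d))"


section \<open>Quasi-isomorphisms\<close>

definition graded_linear ::
  "('k \<Rightarrow> 'v::ab_group_add \<Rightarrow> 'v) \<Rightarrow> (int \<Rightarrow> 'v set) \<Rightarrow> (int \<Rightarrow> 'v set) \<Rightarrow> int \<Rightarrow> (int \<Rightarrow> 'v \<Rightarrow> 'v) \<Rightarrow> bool" where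
  "graded_linear scale V W n f \<longleftrightarrow>
     (\<forall>i. \<forall>v\<in>V i. f i v \<in> W (i + n) \<and> (\<forall>v'\<in>V i. \<forall>c. f i (v + scale c v') = f i v + scale c (f i v')))"

definition cochain_complex ::
  "('k \<Rightarrow> 'v::ab_group_add \<Rightarrow> 'v) \<Rightarrow> (int \<Rightarrow> 'v set) \<Rightarrow> (int \<Rightarrow> 'v \<Rightarrow> 'v) \<Rightarrow> bool" where
  "cochain_complex scale V \<delta> \<longleftrightarrow>
     graded_linear scale V V 1 \<delta> \<and> (\<forall>i. \<forall>v\<in>V i. \<delta> (i + 1) (\<delta> i v) = 0)"

definition chain_map ::
  "('k \<Rightarrow> 'v::ab_group_add \<Rightarrow> 'v) \<Rightarrow> (int \<Rightarrow> 'v set) \<Rightarrow> (int \<Rightarrow> 'v \<Rightarrow> 'v)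
    \<Rightarrow> (int \<Rightarrow> 'v set) \<Rightarrow> (int \<Rightarrow> 'v \<Rightarrow> 'v) \<Rightarrow> (int \<Rightarrow> 'v \<Rightarrow> 'v) \<Rightarrow> bool" where
  "chain_map scale V \<delta> W \<epsilon> f \<longleftrightarrow>
     graded_linear scale V W 0 f \<and> (\<forall>i. \<forall>v\<in>V i. f (i + 1) (\<delta> i v) = \<epsilon> i (f i v))"

text \<open>The relation of being cohomologous cocycles, and cohomology as its quotient.\<close>

definition cohomologous ::
  "(int \<Rightarrow> 'v::ab_group_add set) \<Rightarrow> (int \<Rightarrow> 'v \<Rightarrow> 'v) \<Rightarrow> int \<Rightarrow> ('v \<times> 'v) set" where
  "cohomologous V \<delta> i =
     {(u, v). u \<in> V i \<and> \<delta> i u = 0 \<and> v \<in> V i \<and> \<delta> i v = 0 \<and> u - v \<in> \<delta> (i - 1) ` V (i - 1)}"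

definition cohomology ::
  "(int \<Rightarrow> 'v::ab_group_add set) \<Rightarrow> (int \<Rightarrow> 'v \<Rightarrow> 'v) \<Rightarrow> int \<Rightarrow> 'v set set" where
  "cohomology V \<delta> i = {v \<in> V i. \<delta> i v = 0} // cohomologous V \<delta> i"

definition quasi_iso_complexes ::
  "('k \<Rightarrow> 'v::ab_group_add \<Rightarrow> 'v) \<Rightarrow> (int \<Rightarrow> 'v set) \<Rightarrow> (int \<Rightarrow> 'v \<Rightarrow> 'v)
    \<Rightarrow> (int \<Rightarrow> 'v set) \<Rightarrow> (int \<Rightarrow> 'v \<Rightarrow> 'v) \<Rightarrow> (int \<Rightarrow> 'v \<Rightarrow> 'v) \<Rightarrow> bool" where
  "quasi_iso_complexes scale V \<delta> W \<epsilon> f \<longleftrightarrow>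
     cochain_complex scale V \<delta> \<and> cochain_complex scale W \<epsilon> \<and> chain_map scale V \<delta> W \<epsilon> f \<and>
     (\<forall>i. bij_betw (\<lambda>C. cohomologous W \<epsilon> i `` (f i ` C)) (cohomology V \<delta> i) (cohomology W \<epsilon> i))"

text \<open>
  \<open>S \<circ> F'\<^bsup>((x,y))\<^esup>\<close>; the first argument of the resulting map is the degree in \<open>A(x, y)[1]\<close>, and \<open>S\<close> is the
  identity on vectors.
\<close>

definition linear_part ::
  "('k::field \<Rightarrow> 'v::ab_group_add \<Rightarrow> 'v) \<Rightarrow> ('o, 'v, 'k) family \<Rightarrow> 'o \<Rightarrow> 'o \<Rightarrow> int \<Rightarrow> 'v \<Rightarrow> 'v" where
  "linear_part scale F x y i v = tensor1_val scale (F [[x, y]] [(i, v)])"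

definition quasi_isomorphism ::
  "('k::field \<Rightarrow> 'v::ab_group_add \<Rightarrow> 'v)
    \<Rightarrow> ('o, 'v) quiver \<Rightarrow> ('o, 'v, 'k) family \<Rightarrow> ('p, 'v) quiver \<Rightarrow> ('p, 'v, 'k) family
    \<Rightarrow> ('o \<Rightarrow> 'p) \<Rightarrow> ('o, 'v, 'k) family \<Rightarrow> bool" where
  "quasi_isomorphism scale A M\<^sub>A B M\<^sub>B \<Phi> F \<longleftrightarrow>
     (\<forall>x\<in>Obj A. \<forall>y\<in>Obj A.
        quasi_iso_complexes scale
          (\<lambda>i. Sp A x y (i + 1)) (linear_part scale M\<^sub>A x y)
          (\<lambda>i. Sp B (\<Phi> x) (\<Phi> y) (i + 1)) (linear_part scale M\<^sub>B (\<Phi> x) (\<Phi> y))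
          (linear_part scale F x y))"

end

theory Submission
  imports Defs "HOL-Computational_Algebra.Formal_Power_Series" "HOL-Computational_Algebra.Polynomial"
begin

text \<open>
  Only diagrams with a single external output and at most two inputs matter.  On cohomology the linear part
  of \<open>G \<circ> F\<close> is the composite of the linear parts, so it is enough that the linear part \<open>a(t)\<close> of a homotopy
  \<open>G \<circ> F \<sim> id\<close> of endomorphisms has invertible \<open>a(0)\<close> on cohomology.  Since the homotopy may have components
  \<open>b\<^sub>0(t)\<close> without inputs, \<open>a\<close> need not be constant there; it satisfies \<open>a' = D a\<close>, where \<open>D(t)\<close> is given by
  multiplication with the cocycles \<open>b\<^sub>0(t)\<close>, and \<open>a(1) = id\<close>.  As \<open>a\<close> and \<open>D\<close> are polynomial, put \<open>P\<^sub>0 = 1\<close>,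
  \<open>P\<^bsub>k+1\<^esub> = P\<^sub>k' + P\<^sub>k D\<close>; then \<open>a\<^bsup>(k)\<^esup> = P\<^sub>k a\<close>, and the Taylor formula
  \<open>1 = a(1) = \<Sum>\<^sub>k (1 - t)\<^sup>k a\<^bsup>(k)\<^esup>(t) / k! = (\<Sum>\<^sub>k (1 - t)\<^sup>k P\<^sub>k(t) / k!) a(t)\<close>
  exhibits a polynomial inverse of \<open>a\<close>, also in infinite dimension.
\<close>

section \<open>Polynomial flows\<close>

unbundle fps_syntax

text \<open>The Taylor argument meets three obstacles. The flow equation holds only modulo
  coboundaries, so it lives on the quotient of cocycles Z by coboundaries B. An idempotent
  \<open>e\<close> whose image is a complement of B in Z realises this quotient inside the ambient
  space, and \<open>e a(t) e + (1 - e)\<close> is a flow on the whole space. Next, the equation is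
  given for each value of t only. Counting roots turns it into equations between coefficients; since
  \<open>D a\<close> has degree at most \<open>length a + length b - 2\<close>, the characteristic
  bound in \<open>homotopic\<close> suffices for this. Finally, additive maps cannot be divided by
  k!, so the Taylor formula is multiplied by n! with n = \<open>length a - 1\<close>, and n! is
  cancelled at the end because n is below any positive characteristic. The formula alone gives a
  one-sided inverse; around t = 1 the flow has constant term 1, hence a two-sided inverse power
  series, which the formula shows to be polynomial. Characteristic 2 is excluded because [M, M] is
  twice the necklace product of M with itself, whose vanishing gives the differential and the
  Leibniz rule.\<close>

lemma fps_deriv_funpow_nth:
  fixes f :: "'e::ring_1 fps"
  shows "(fps_deriv ^^ k) f $ m = of_nat (fact (m + k) div fact m) * f $ (m + k)"
proof (induction k arbitrary: m)
  case (Suc k)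
  have "fact (Suc m) dvd (fact (Suc m + k) :: nat)"
    by (rule fact_dvd) simp
  then obtain q where q: "(fact (Suc m + k) :: nat) = fact (Suc m) * q"
    by (elim dvdE)
  then have "(fact (m + Suc k) :: nat) = fact m * ((m + 1) * q)"
    by (simp only: add_Suc add_Suc_right fact_Suc) (simp add: algebra_simps)
  then have "(m + 1) * (fact (Suc m + k) div fact (Suc m)) = fact (m + Suc k) div fact m"
    using q by (metis fact_nonzero nonzero_mult_div_cancel_left)
  then show ?case
    using Suc[of "Suc m"] by (simp add: mult.assoc[symmetric] del: of_nat_add of_nat_Suc flip: of_nat_mult)
qed simp

text \<open>Taylor's formula around X, evaluated at X - X = 0 and multiplied by n! so that all
  coefficients are integers and the ring may be arbitrary. The coefficient at X^m contains the
  alternating sum of the binomials (m choose k), which vanishes unless m = 0.\<close>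

lemma fps_taylor_at_zero:
  fixes \<alpha> :: "'e::ring_1 fps"
  assumes "\<And>k. n < k \<Longrightarrow> \<alpha> $ k = 0"
  shows "(\<Sum>k\<le>n. of_int ((- 1) ^ k * int (fact n div fact k)) * (fps_X ^ k * (fps_deriv ^^ k) \<alpha>))
    = of_nat (fact n) * fps_const (\<alpha> $ 0)"
proof (rule fps_ext)
  fix m
  have nth: "(of_int c * (fps_X ^ k * (fps_deriv ^^ k) \<alpha>)) $ m =
      of_int (c * int (fact m div fact (m - k))) * \<alpha> $ m" if "k \<le> m" for c k
  proof -
    have "(of_int c * f) $ m = of_int c * f $ m" for f :: "'e fps"
      using fps_const_mult_left[of "of_int c" f] by (simp flip: fps_of_int)
    then show ?thesis
      using that by (simp add: fps_X_power_mult_nth fps_deriv_funpow_nth mult.assoc)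
  qed
  have nth0: "(of_int c * (fps_X ^ k * (fps_deriv ^^ k) \<alpha>)) $ m = 0" if "m < k" for c k
  proof -
    have "(of_int c * f) $ m = of_int c * f $ m" for f :: "'e fps"
      using fps_const_mult_left[of "of_int c" f] by (simp flip: fps_of_int)
    then show ?thesis
      using that by (simp add: fps_X_power_mult_nth)
  qed
  have R: "(of_nat (fact n) * fps_const (\<alpha> $ 0)) $ m = (if m = 0 then of_nat (fact n) * \<alpha> $ 0 else 0)"
    by (simp add: fps_of_nat[symmetric])
  show "(\<Sum>k\<le>n. of_int ((- 1) ^ k * int (fact n div fact k)) * (fps_X ^ k * (fps_deriv ^^ k) \<alpha>)) $ m
    = (of_nat (fact n) * fps_const (\<alpha> $ 0)) $ m"
  proof (cases "m \<le> n")
    case True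
    \<comment> \<open>All divisions of natural numbers are exact here, because k \<le> m \<le>
      n.\<close>
    have coef: "(- 1) ^ k * int (fact n div fact k) * int (fact m div fact (m - k))
        = int (fact n) * ((- 1) ^ k * int (m choose k))" if "k \<le> m" for k
    proof -
      have "fact k dvd (fact n :: nat)"
        using that True by (intro fact_dvd) simp
      then obtain q where q: "(fact n :: nat) = fact k * q"
        by (elim dvdE)
      have "(fact m :: nat) = fact (m - k) * (fact k * (m choose k))"
        using binomial_fact_lemma[OF that] by (simp add: ac_simps)
      then have "(fact m div fact (m - k) :: nat) = fact k * (m choose k)"
        by (metis fact_nonzero nonzero_mult_div_cancel_left)
      moreover have "(fact n div fact k :: nat) = q"
        using q by (metis fact_nonzero nonzero_mult_div_cancel_left)
      ultimately have "(fact n div fact k) * (fact m div fact (m - k)) = fact n * (m choose k)"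
        using q by (simp only: ac_simps)
      then have "int (fact n div fact k) * int (fact m div fact (m - k)) = int (fact n) * int (m choose k)"
        by (simp only: flip: of_nat_mult)
      then show ?thesis
        by (simp only: mult.assoc mult.left_commute)
    qed
    have "(\<Sum>k\<le>n. of_int ((- 1) ^ k * int (fact n div fact k)) * (fps_X ^ k * (fps_deriv ^^ k) \<alpha>)) $ m
       = (\<Sum>k\<le>m. (of_int ((- 1) ^ k * int (fact n div fact k)) * (fps_X ^ k * (fps_deriv ^^ k) \<alpha>)) $ m)"
      unfolding fps_sum_nth
    proof (rule sum.mono_neutral_right)
      show "\<forall>k\<in>{..n} - {..m}.
          (of_int ((- 1) ^ k * int (fact n div fact k)) * (fps_X ^ k * (fps_deriv ^^ k) \<alpha>)) $ m = 0"
        by (intro ballI nth0) auto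
    qed (use True in auto)
    also have "\<dots> = (\<Sum>k\<le>m. of_int (int (fact n) * ((- 1) ^ k * int (m choose k))) * \<alpha> $ m)"
      by (intro sum.cong refl) (metis atMost_iff coef nth)
    also have "\<dots> = of_int (int (fact n) * (\<Sum>k\<le>m. (- 1) ^ k * int (m choose k))) * \<alpha> $ m"
      by (simp add: sum_distrib_left sum_distrib_right del: of_int_mult)
    also have "(\<Sum>k\<le>m. (- 1) ^ k * int (m choose k)) = (if m = 0 then 1 else 0)"
      using choose_alternating_sum[of m, where ?'a = int] by auto
    finally show ?thesis
      by (simp add: R del: of_nat_fact)
  next
    case False
    have "(of_int ((- 1) ^ k * int (fact n div fact k)) * (fps_X ^ k * (fps_deriv ^^ k) \<alpha>)) $ m = 0" for k
      using nth[of k] nth0[of k] assms[of m] False by (cases "k \<le> m") (simp_all only: not_le mult_zero_right)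
    then show ?thesis
      using False by (simp add: R fps_sum_nth)
  qed
qed

text \<open>Polynomials are treated as special power series because the coefficients will be
  noncommuting additive maps and the inverse of a flow is available first as a power series.\<close>

definition fps_polynomial :: "'e::zero fps \<Rightarrow> bool" where
  "fps_polynomial f \<longleftrightarrow> (\<exists>N. \<forall>k\<ge>N. f $ k = 0)"

lemma fps_polynomial_add:
  fixes f g :: "'e::ring_1 fps"
  shows "fps_polynomial f \<Longrightarrow> fps_polynomial g \<Longrightarrow> fps_polynomial (f + g)"
  unfolding fps_polynomial_def by (metis add.right_neutral fps_add_nth le_trans nat_le_linear)

lemma fps_polynomial_mult:
  fixes f g :: "'e::ring_1 fps"
  assumes "fps_polynomial f" "fps_polynomial g"
  shows "fps_polynomial (f * g)"
proof -
  obtain N M where N: "\<And>k. k \<ge> N \<Longrightarrow> f $ k = 0" and M: "\<And>k. k \<ge> M \<Longrightarrow> g $ k = 0"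
    using assms by (auto simp: fps_polynomial_def)
  have "(f * g) $ k = 0" if "k \<ge> N + M" for k
    unfolding fps_mult_nth
  proof (intro sum.neutral ballI)
    fix i assume "i \<in> {0..k}"
    then have "i \<ge> N \<or> k - i \<ge> M"
      using that by auto
    then show "f $ i * g $ (k - i) = 0"
      using N M by auto
  qed
  then show ?thesis
    unfolding fps_polynomial_def by blast
qed

lemma fps_polynomial_deriv:
  fixes f :: "'e::ring_1 fps"
  shows "fps_polynomial f \<Longrightarrow> fps_polynomial (fps_deriv f)"
  unfolding fps_polynomial_def by (metis fps_deriv_nth mult_zero_right trans_le_add1)

lemma fps_polynomial_sum:
  fixes f :: "'i \<Rightarrow> 'e::ring_1 fps"
  assumes "\<And>i. i \<in> I \<Longrightarrow> fps_polynomial (f i)"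
  shows "fps_polynomial (sum f I)"
  using assms
  by (induction I rule: infinite_finite_induct)
     (auto intro: fps_polynomial_add simp: fps_polynomial_def[of 0])

lemma fps_polynomial_const: "fps_polynomial (fps_const c)"
  unfolding fps_polynomial_def by (intro exI[of _ 1]) auto

lemma fps_polynomial_X_power: "fps_polynomial (fps_X ^ k :: 'e::ring_1 fps)"
  unfolding fps_polynomial_def by (intro exI[of _ "Suc k"]) auto

text \<open>Constant term 1 gives a two-sided inverse series \<beta>, while Taylor's formula gives a
  polynomial \<open>q\<close> with \<open>q * \<alpha> = n!\<close>. Comparing the two, n! \<beta>
  is a polynomial, and n! can be cancelled.\<close>

lemma fps_flow_inverse:
  fixes \<alpha> \<Delta> :: "'e::ring_1 fps"
  assumes ode: "fps_deriv \<alpha> = \<Delta> * \<alpha>" and one: "\<alpha> $ 0 = 1"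
    and \<alpha>: "\<And>k. n < k \<Longrightarrow> \<alpha> $ k = 0" and \<Delta>: "fps_polynomial \<Delta>"
    and fact: "\<And>x :: 'e. of_nat (fact n) * x = 0 \<Longrightarrow> x = 0"
  obtains \<beta> where "\<alpha> * \<beta> = 1" "\<beta> * \<alpha> = 1" "fps_polynomial \<beta>"
proof -
  define P where "P = rec_nat 1 (\<lambda>_ p. fps_deriv p + p * \<Delta>)"
  have P_Suc: "P (Suc k) = fps_deriv (P k) + P k * \<Delta>" for k
    by (simp add: P_def)
  have P: "(fps_deriv ^^ k) \<alpha> = P k * \<alpha>" for k
  proof (induction k)
    case 0
    then show ?case by (simp add: P_def)
  next
    case (Suc k)
    then show ?case
      by (simp add: P_Suc ode algebra_simps)
  qed
  have poly_P: "fps_polynomial (P k)" for k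
  proof (induction k)
    case 0
    then show ?case
      using fps_polynomial_const[of "1::'e"] by (simp add: P_def)
  next
    case (Suc k)
    then show ?case
      by (simp add: P_Suc fps_polynomial_add fps_polynomial_deriv fps_polynomial_mult \<Delta>)
  qed
  \<comment> \<open>Every derivative of \<alpha> ends in the factor \<alpha>, so Taylor's formula
    splits as \<open>q * \<alpha>\<close>.\<close>
  define q where "q = (\<Sum>k\<le>n. fps_const (of_int ((- 1) ^ k * int (fact n div fact k))) * (fps_X ^ k * P k))"
  have "fps_polynomial q"
    unfolding q_def
    by (intro fps_polynomial_sum fps_polynomial_mult fps_polynomial_const fps_polynomial_X_power poly_P)
  have q: "q * \<alpha> = of_nat (fact n)"
    using fps_taylor_at_zero[of n \<alpha>, OF \<alpha>]
    by (simp only: q_def P one sum_distrib_right mult.assoc fps_of_int fps_const_1_eq_1 mult.right_neutral)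
  define \<beta> where "\<beta> = fps_right_inverse \<alpha> 1"
  have r: "\<alpha> * \<beta> = 1"
    unfolding \<beta>_def by (rule fps_right_inverse) (simp add: one)
  have "\<beta> * \<alpha> = 1"
    unfolding \<beta>_def by (rule fps_left_inverse'[of 1]) (simp_all add: one)
  \<comment> \<open>Multiply \<open>q * \<alpha> = n!\<close> by \<beta> from the right. The
    factorial then acts on each coefficient of \<beta> and is cancelled by
    \<open>fact\<close>.\<close>
  moreover have "q = of_nat (fact n) * \<beta>"
    using q r by (metis mult.assoc mult.right_neutral)
  then have "q $ k = of_nat (fact n) * \<beta> $ k" for k
    by (simp add: fps_of_nat[symmetric])
  then have "fps_polynomial \<beta>"
    using \<open>fps_polynomial q\<close> fact unfolding fps_polynomial_def by metis
  ultimately show ?thesis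
    using r that by blast
qed

text \<open>Evaluation at an element \<open>c\<close> that commutes with the coefficients is
  multiplicative. It serves twice: with \<open>c = 1\<close> for values at 1, and with constants as
  coefficients and \<open>c = 1 - fps_X\<close> for the substitution of 1 - X.\<close>

lemma fps_eval_mult:
  fixes f g :: "'e::ring_1 fps" and h :: "'e \<Rightarrow> 'r::ring_1"
  assumes f: "\<And>k. N \<le> k \<Longrightarrow> f $ k = 0" and g: "\<And>k. M \<le> k \<Longrightarrow> g $ k = 0"
    and h: "\<And>x y. h (x + y) = h x + h y" "\<And>x y. h (x * y) = h x * h y"
    and c: "\<And>x. h x * c = c * h x"
  shows "(\<Sum>k<N + M. h ((f * g) $ k) * c ^ k) = (\<Sum>i<N. h (f $ i) * c ^ i) * (\<Sum>j<M. h (g $ j) * c ^ j)"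
proof -
  have h0: "h 0 = 0"
    using h(1)[of 0 0] by simp
  have h_sum: "h (sum u I) = (\<Sum>i\<in>I. h (u i))" for u :: "nat \<Rightarrow> 'e" and I
    by (induction I rule: infinite_finite_induct) (simp_all add: h0 h(1))
  have c_pow: "h x * c ^ i = c ^ i * h x" for x i
    by (induction i) (simp_all add: c mult.assoc[symmetric], simp add: mult.assoc c)
  let ?t = "\<lambda>i j. h (f $ i) * h (g $ j) * c ^ (i + j)"
  have "(\<Sum>k<N + M. h ((f * g) $ k) * c ^ k) = (\<Sum>k<N + M. \<Sum>i<N. if i \<le> k then ?t i (k - i) else 0)"
  proof (intro sum.cong refl)
    fix k
    have "(f * g) $ k = (\<Sum>i\<in>{0..k} \<inter> {..<N}. f $ i * g $ (k - i))"
      unfolding fps_mult_nth by (intro sum.mono_neutral_right) (auto simp: f not_less)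
    also have "{0..k} \<inter> {..<N} = {..<N} \<inter> {i. i \<le> k}"
      by auto
    finally have "h ((f * g) $ k) * c ^ k = (\<Sum>i\<in>{..<N} \<inter> {i. i \<le> k}. ?t i (k - i))"
      by (simp add: h_sum h(2) sum_distrib_right)
    then show "h ((f * g) $ k) * c ^ k = (\<Sum>i<N. if i \<le> k then ?t i (k - i) else 0)"
      by (auto simp: sum.inter_restrict intro!: sum.cong)
  qed
  also have "\<dots> = (\<Sum>i<N. \<Sum>k<N + M. if i \<le> k then ?t i (k - i) else 0)"
    by (rule sum.swap)
  also have "\<dots> = (\<Sum>i<N. h (f $ i) * c ^ i * (\<Sum>j<M. h (g $ j) * c ^ j))"
  proof (intro sum.cong refl)
    fix i assume i: "i \<in> {..<N}"
    have "(\<Sum>k<N + M. if i \<le> k then ?t i (k - i) else 0) = (\<Sum>k\<in>{i..<i + M}. ?t i (k - i))"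
    proof (rule sum.mono_neutral_cong_right)
      show "\<forall>k\<in>{..<N + M} - {i..<i + M}. (if i \<le> k then ?t i (k - i) else 0) = 0"
        using g h0 by (auto simp: not_less le_diff_conv2)
    qed (use i in auto)
    also have "\<dots> = (\<Sum>j<M. ?t i j)"
      by (rule sum.reindex_bij_witness[of _ "\<lambda>j. j + i" "\<lambda>k. k - i"]) auto
    also have "\<dots> = (\<Sum>j<M. h (f $ i) * c ^ i * (h (g $ j) * c ^ j))"
      by (intro sum.cong refl) (metis (no_types) c_pow mult.assoc power_add)
    finally show "(\<Sum>k<N + M. if i \<le> k then ?t i (k - i) else 0) = h (f $ i) * c ^ i * (\<Sum>j<M. h (g $ j) * c ^ j)"
      by (simp add: sum_distrib_left)
  qed
  finally show ?thesis
    by (simp add: sum_distrib_right)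
qed

text \<open>These powers re-expand a polynomial around 1. A sum of coefficients is a value at 1,
  where 1 - X vanishes, whence the last claim.\<close>

lemma fps_one_minus_X_power:
  fixes j :: nat
  defines "c \<equiv> 1 - fps_X :: 'e::ring_1 fps"
  shows "fps_deriv (c ^ j) = - of_nat j * c ^ (j - 1)"
    and "j < k \<Longrightarrow> (c ^ j) $ k = 0"
    and "0 < j \<Longrightarrow> j < M \<Longrightarrow> (\<Sum>k<M. (c ^ j) $ k) = 0"
proof -
  show deriv: "fps_deriv (c ^ j) = - of_nat j * c ^ (j - 1)"
  proof (induction j)
    case (Suc j)
    have dc: "fps_deriv c = - 1"
      by (simp add: c_def)
    have "c * (of_nat j * c ^ (j - 1)) = of_nat j * c ^ j"
      by (cases j) (simp_all add: mult.assoc[symmetric] mult_of_nat_commute[of _ c] del: of_nat_Suc)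
    then show ?case
      by (simp add: Suc dc algebra_simps)
  qed simp
  show vanish: "(c ^ j) $ k = 0" if "j < k" for j k
    using that
  proof (induction j arbitrary: k)
    case (Suc j)
    then show ?case
      by (simp add: c_def left_diff_distrib)
  qed simp
  show "(\<Sum>k<M. (c ^ j) $ k) = 0" if jM: "0 < j" "j < M"
  proof -
    obtain i where i: "j = Suc i"
      using jM by (cases j) auto
    obtain K where K: "M = Suc K"
      using jM by (cases M) auto
    \<comment> \<open>Telescoping: the coefficients of (1 - X) f are the consecutive differences of
      those of f.\<close>
    have "(\<Sum>k<Suc K. (c * f) $ k) = f $ K" for f :: "'e fps"
      by (induction K) (simp_all add: c_def left_diff_distrib)
    then show ?thesis
      using vanish[of i K] jM unfolding i K power_Suc by simp
  qed
qed

text \<open>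
  If a polynomial flow \<open>A(t)\<close> with polynomial generator is the identity at \<open>t = 1\<close>, then its value at
  \<open>t = 0\<close> is invertible: expand around \<open>1\<close>.
\<close>

lemma fps_flow_invertible:
  fixes A \<Delta> :: "'e::ring_1 fps"
  assumes ode: "fps_deriv A = \<Delta> * A" and one: "(\<Sum>k<n. A $ k) = 1" and n: "0 < n"
    and A: "\<And>k. n \<le> k \<Longrightarrow> A $ k = 0" and \<Delta>: "\<And>k. m \<le> k \<Longrightarrow> \<Delta> $ k = 0"
    and fact: "\<And>x :: 'e. of_nat (fact (n - 1)) * x = 0 \<Longrightarrow> x = 0"
  obtains b where "A $ 0 * b = 1" "b * A $ 0 = 1"
proof -
  define c :: "'e fps" where "c = 1 - fps_X"
  have c_comm: "f * c = c * f" for f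
    using fps_mult_fps_X_power_commute[of 1 f] by (simp add: c_def algebra_simps)
  have c0: "c $ 0 = 1"
    by (simp add: c_def)
  then have c0_pow: "(c ^ j) $ 0 = 1" for j
    by (induction j) simp_all
  \<comment> \<open>\<alpha> is A(1 - X), so \<alpha>(0) = A(1) = 1. The chain rule forces the
    generator \<open>D\<close> = - \<Delta>(1 - X).\<close>
  define \<alpha> where "\<alpha> = (\<Sum>j<n. fps_const (A $ j) * c ^ j)"
  define D where "D = - (\<Sum>j<m. fps_const (\<Delta> $ j) * c ^ j)"
  have \<alpha>_nth: "\<alpha> $ k = (\<Sum>j<n. A $ j * (c ^ j) $ k)" for k
    by (simp add: \<alpha>_def fps_sum_nth)
  have \<alpha>: "\<alpha> $ k = 0" if "n - 1 < k" for k
    unfolding \<alpha>_nth by (rule sum.neutral) (use that in \<open>auto simp: c_def fps_one_minus_X_power(2)\<close>)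
  have "fps_polynomial (c ^ j)" for j
    unfolding fps_polynomial_def c_def using fps_one_minus_X_power(2)[where ?'e = 'e, of j]
    by (intro exI[of _ "Suc j"]) auto
  then have "fps_polynomial (\<Sum>j<m. fps_const (\<Delta> $ j) * c ^ j)"
    by (intro fps_polynomial_sum fps_polynomial_mult fps_polynomial_const)
  then have D: "fps_polynomial D"
    unfolding D_def fps_polynomial_def by simp
  have "fps_deriv \<alpha> = - (\<Sum>j<n. fps_const (A $ j) * (of_nat j * c ^ (j - 1)))"
    by (simp add: \<alpha>_def fps_deriv_sum c_def fps_one_minus_X_power(1) sum_negf[symmetric])
  \<comment> \<open>The range is enlarged by zero terms so that, after dropping j = 0 and shifting,
    \<open>m + n\<close> coefficients of the derivative remain, as \<open>fps_eval_mult\<close>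
    expects.\<close>
  also have "(\<Sum>j<n. fps_const (A $ j) * (of_nat j * c ^ (j - 1))) = (\<Sum>j<Suc (m + n). fps_const (A $ j) * (of_nat j * c ^ (j - 1)))"
    by (rule sum.mono_neutral_left) (auto simp: A)
  also have "\<dots> = (\<Sum>k<m + n. fps_const (fps_deriv A $ k) * c ^ k)"
    by (subst sum.lessThan_Suc_shift)
       (simp add: fps_of_nat[symmetric] mult.assoc[symmetric] mult_of_nat_commute del: of_nat_Suc)
  also have "\<dots> = (\<Sum>i<m. fps_const (\<Delta> $ i) * c ^ i) * \<alpha>"
    unfolding ode \<alpha>_def by (rule fps_eval_mult) (simp_all add: A \<Delta> c_comm)
  finally have ode': "fps_deriv \<alpha> = D * \<alpha>"
    by (simp add: D_def)
  have "\<alpha> $ 0 = 1"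
    by (simp add: \<alpha>_nth c0_pow one)
  then obtain \<beta> where \<beta>: "\<alpha> * \<beta> = 1" "\<beta> * \<alpha> = 1" "fps_polynomial \<beta>"
    using fps_flow_inverse[OF ode' _ \<alpha> D fact] by blast
  then obtain K where K: "\<And>k. K \<le> k \<Longrightarrow> \<beta> $ k = 0"
    by (auto simp: fps_polynomial_def)
  have \<alpha>': "\<alpha> $ k = 0" if "n \<le> k" for k
    using \<alpha> that n by simp
  have sum1: "(\<Sum>k<j. (1 :: 'e fps) $ k) = 1" if "0 < j" for j
    using that by (induction j) (auto simp: fps_one_nth)
  have "(\<Sum>k<n. \<alpha> $ k) = (\<Sum>j<n. A $ j * (\<Sum>k<n. (c ^ j) $ k))"
    unfolding \<alpha>_nth by (subst sum.swap) (simp add: sum_distrib_left)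
  also have "\<dots> = (\<Sum>j<n. if j = 0 then A $ 0 else 0)"
    by (intro sum.cong refl) (auto simp: c_def fps_one_minus_X_power(3) sum1 n)
  finally have \<alpha>_sum: "(\<Sum>k<n. \<alpha> $ k) = A $ 0"
    using n by simp
  \<comment> \<open>\<open>b\<close> is \<beta>(1). Evaluating \<alpha> \<beta> = \<beta> \<alpha> =
    1 at 1 makes it the inverse of \<alpha>(1) = A(0).\<close>
  define b where "b = (\<Sum>k<K. \<beta> $ k)"
  have "A $ 0 * b = 1"
    using fps_eval_mult[of n \<alpha> K \<beta> id 1, OF \<alpha>' K] n by (simp add: b_def \<alpha>_sum \<beta> sum1)
  moreover have "b * A $ 0 = 1"
    using fps_eval_mult[of K \<beta> n \<alpha> id 1, OF K \<alpha>'] n by (simp add: b_def \<alpha>_sum \<beta> sum1)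
  ultimately show ?thesis
    using that by blast
qed


section \<open>Coefficients of vector-valued polynomials, subquotients, and flows on them\<close>

lemma of_nat_inj_on_CHAR:
  assumes "CHAR('k::ring_1) = 0 \<or> n \<le> CHAR('k)"
  shows "inj_on (of_nat :: nat \<Rightarrow> 'k) {..<n}"
proof -
  have "i = j" if "i \<le> j" "j < n" "of_nat i = (of_nat j :: 'k)" for i j
  proof -
    have "of_nat (j - i) = (0 :: 'k)"
      using that by (simp add: of_nat_diff)
    then have "CHAR('k) dvd j - i"
      by (simp add: of_nat_eq_0_iff_char_dvd)
    then show ?thesis
      using assms that dvd_imp_le[of "CHAR('k)" "j - i"] by fastforce
  qed
  then show ?thesis
    unfolding inj_on_def by (metis lessThan_iff nat_le_linear)
qed

text \<open>Each coordinate in a basis is a scalar polynomial of degree less than n that vanishes at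
  the n distinct images of 0, ..., n - 1. The bound is sharp over a prime field with p elements,
  where t^p - t vanishes everywhere.\<close>

lemma (in vector_space) polynomial_coeffs_zero:
  fixes v :: "nat \<Rightarrow> 'b"
  assumes char: "CHAR('a) = 0 \<or> n \<le> CHAR('a)"
    and zero: "\<And>t :: 'a. (\<Sum>j<n. scale (t ^ j) (v j)) = 0" and "j < n"
  shows "v j = 0"
proof -
  define X where "X = extend_basis {}"
  have X: "independent X" "span X = UNIV"
    by (simp_all add: X_def independent_extend_basis independent_empty)
  have "representation X (v j) b = 0" for b
  proof -
    define c where "c i = representation X (v i) b" for i
    define p where "p = (\<Sum>i<n. monom (c i) i)"
    have "poly p t = 0" for t
    proof -
      have "poly p t = (\<Sum>i<n. representation X (scale (t ^ i) (v i)) b)"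
        by (simp add: p_def c_def poly_sum poly_monom representation_scale X mult.commute)
      also have "\<dots> = representation X (\<Sum>i<n. scale (t ^ i) (v i)) b"
        by (subst representation_sum) (simp_all add: X)
      finally show ?thesis
        by (simp add: zero representation_zero)
    qed
    have "p = 0"
    proof (rule ccontr)
      assume "p \<noteq> 0"
      have "n \<le> card {t. poly p t = 0}"
        using card_image[OF of_nat_inj_on_CHAR[OF char]] card_mono[OF poly_roots_finite[OF \<open>p \<noteq> 0\<close>]]
          \<open>\<And>t. poly p t = 0\<close>
        by (metis (mono_tags, lifting) card_lessThan mem_Collect_eq subsetI)
      also have "\<dots> \<le> degree p"
        by (rule card_poly_roots_bound[OF \<open>p \<noteq> 0\<close>])
      also have "\<dots> \<le> n - 1"
        unfolding p_def by (intro degree_sum_le) (auto intro: order.trans[OF degree_monom_le])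
      finally show False
        using \<open>j < n\<close> by simp
    qed
    moreover have "coeff p j = c j"
      using \<open>j < n\<close> by (simp add: p_def coeff_sum if_distrib cong: if_cong)
    ultimately show ?thesis
      by (simp add: c_def)
  qed
  then show ?thesis
    using sum_nonzero_representation_eq[OF X(1), of "v j"] X(2) by simp
qed

text \<open>Extend a basis P of B to a basis Q of Z and then to the whole space, and project onto
  the span of Q - P. The image of \<open>e\<close> is a copy of Z/B, on which congruence modulo B
  becomes equality of vectors.\<close>

lemma (in vector_space) subquotient_projection:
  assumes B: "subspace B" and Z: "subspace Z" and "B \<subseteq> Z"
  obtains e where "Vector_Spaces.linear scale scale e" "\<And>v. e v \<in> Z"
    "\<And>v. v \<in> Z \<Longrightarrow> e v - v \<in> B" "\<And>v. v \<in> B \<Longrightarrow> e v = 0" "\<And>v. e (e v) = e v"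
proof -
  interpret vector_space_pair scale scale ..
  obtain P where P: "P \<subseteq> B" "independent P" "B \<subseteq> span P"
    using maximal_independent_subset_extend[of "{}" B] by (auto simp: independent_empty)
  obtain Q where Q: "P \<subseteq> Q" "Q \<subseteq> Z" "independent Q" "Z \<subseteq> span Q"
    using maximal_independent_subset_extend[of P Z] P \<open>B \<subseteq> Z\<close> by blast
  have X: "Q \<subseteq> extend_basis Q" "independent (extend_basis Q)" "span (extend_basis Q) = UNIV"
    using Q by (simp_all add: extend_basis_superset independent_extend_basis)
  obtain e where e: "Vector_Spaces.linear scale scale e"
    and e_eq: "\<And>v. v \<in> extend_basis Q \<Longrightarrow> e v = (if v \<in> Q - P then v else 0)"
    using linear_independent_extend[OF X(2), of "\<lambda>v. if v \<in> Q - P then v else 0"] by blast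
  interpret e: Vector_Spaces.linear scale scale e
    by (rule e)
  show thesis
  proof (rule that[OF e])
    show "e v \<in> Z" for v
    proof -
      have "v \<in> span (extend_basis Q)"
        by (simp add: X)
      then show ?thesis
      proof (induction rule: span_induct_alt)
        case base
        then show ?case by (simp add: subspace_0[OF Z])
      next
        case (step c x y)
        then show ?case
          using Q by (auto simp: e.add e.scale e_eq intro!: subspace_add[OF Z] subspace_scale[OF Z] subspace_0[OF Z])
      qed
    qed
    show "e (e v) = e v" for v
    proof -
      have "v \<in> span (extend_basis Q)"
        by (simp add: X)
      then show ?thesis
        by (induction rule: span_induct_alt) (simp_all add: e.add e.scale e_eq)
    qed
    show "e v = 0" if "v \<in> B" for v
    proof -
      have "v \<in> span P"
        using that P by auto
      then show ?thesis
      proof (induction rule: span_induct_alt)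
        case base
        then show ?case by simp
      next
        case (step c x y)
        then show ?case
          using Q X by (auto simp: e.add e.scale e_eq subset_iff)
      qed
    qed
    show "e v - v \<in> B" if "v \<in> Z" for v
    proof -
      have "v \<in> span Q"
        using that Q by auto
      then show ?thesis
      proof (induction rule: span_induct_alt)
        case base
        then show ?case by (simp add: subspace_0[OF B])
      next
        case (step c x y)
        have "e x - x \<in> B"
          using step(1) P X e_eq[of x] by (auto simp: subset_iff subspace_0[OF B] intro: subspace_neg[OF B])
        moreover have "e (scale c x + y) - (scale c x + y) = scale c (e x - x) + (e y - y)"
          by (simp add: e.add e.scale scale_right_diff_distrib)
        ultimately show ?case
          using step(2) by (simp only: subspace_add[OF B] subspace_scale[OF B])
      qed
    qed
  qed
qed

text \<open>
  The ring of additive maps.  The factor \<open>\<int>\<close> only serves to satisfy \<open>0 \<noteq> 1\<close>, which the class \<open>ring_1\<close>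
  demands, for the trivial group.
\<close>

typedef (overloaded) 'v additive_map = "{(f :: 'v::ab_group_add \<Rightarrow> 'v, k :: int). \<forall>x y. f (x + y) = f x + f y}"
  by (rule exI[of _ "(id, 0)"]) simp

setup_lifting type_definition_additive_map

instantiation additive_map :: (ab_group_add) ring_1
begin

lift_definition zero_additive_map :: "'a additive_map" is "(\<lambda>_. 0, 0)"
  by simp

lift_definition one_additive_map :: "'a additive_map" is "(\<lambda>x. x, 1)"
  by simp

lift_definition plus_additive_map :: "'a additive_map \<Rightarrow> 'a additive_map \<Rightarrow> 'a additive_map"
  is "\<lambda>(f, k) (g, l). (\<lambda>x. f x + g x, k + l)"
  by (auto simp: algebra_simps)

lift_definition minus_additive_map :: "'a additive_map \<Rightarrow> 'a additive_map \<Rightarrow> 'a additive_map"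
  is "\<lambda>(f, k) (g, l). (\<lambda>x. f x - g x, k - l)"
  by (auto simp: algebra_simps)

lift_definition uminus_additive_map :: "'a additive_map \<Rightarrow> 'a additive_map"
  is "\<lambda>(f, k). (\<lambda>x. - f x, - k)"
  by auto

lift_definition times_additive_map :: "'a additive_map \<Rightarrow> 'a additive_map \<Rightarrow> 'a additive_map"
  is "\<lambda>(f, k) (g, l). (\<lambda>x. f (g x), k * l)"
  by auto

instance
proof
  fix a b c :: "'a additive_map"
  show "a * b * c = a * (b * c)" "1 * a = a" "a * 1 = a" "a + b + c = a + (b + c)" "a + b = b + a"
    "0 + a = a" "- a + a = 0" "a - b = a + - b" "(a + b) * c = a * c + b * c" "a * (b + c) = a * b + a * c"
    by (transfer, auto simp: algebra_simps)+
  show "(0 :: 'a additive_map) \<noteq> 1"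
    by transfer simp
qed

end

lift_definition amap_apply :: "'v::ab_group_add additive_map \<Rightarrow> 'v \<Rightarrow> 'v" is fst .

lift_definition amap_scalar :: "'v::ab_group_add additive_map \<Rightarrow> int" is snd .

lemma amap_simps [simp]:
  "amap_apply 0 x = 0" "amap_apply 1 x = x" "amap_apply (f + g) x = amap_apply f x + amap_apply g x"
  "amap_apply (f * g) x = amap_apply f (amap_apply g x)"
  "amap_scalar 0 = 0" "amap_scalar 1 = 1" "amap_scalar (f + g) = amap_scalar f + amap_scalar g"
  "amap_scalar (f * g) = amap_scalar f * amap_scalar g"
  by (transfer, auto)+

lemma amap_eqI:
  assumes "\<And>x. amap_apply f x = amap_apply g x" and "amap_scalar f = amap_scalar g"
  shows "f = g"
  using assms by transfer auto

lemma amap_sum: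
  "amap_apply (sum f I) x = (\<Sum>i\<in>I. amap_apply (f i) x)" "amap_scalar (sum f I) = (\<Sum>i\<in>I. amap_scalar (f i))"
  by (induction I rule: infinite_finite_induct) simp_all

lemma amap_of_nat:
  assumes "vector_space (scale :: 'k::field \<Rightarrow> 'v::ab_group_add \<Rightarrow> 'v)"
  shows "amap_apply (of_nat n) x = scale (of_nat n) x" "amap_scalar (of_nat n :: 'v additive_map) = int n"
proof -
  interpret vector_space scale by fact
  show "amap_apply (of_nat n) x = scale (of_nat n) x"
    by (induction n) (simp_all add: scale_left_distrib)
  show "amap_scalar (of_nat n :: 'v additive_map) = int n"
    by (induction n) simp_all
qed

lemma amap_exists:
  assumes "\<And>x y. f (x + y) = f x + f y"
  shows "\<exists>g. (\<forall>x. amap_apply g x = f x) \<and> amap_scalar g = k"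
  using assms
  by (intro exI[of _ "Abs_additive_map (f, k)"])
     (simp add: amap_apply.rep_eq amap_scalar.rep_eq Abs_additive_map_inverse)

text \<open>Linearity relative to a set, because components of families are linear only on the
  graded pieces of a quiver.\<close>

definition linear_on :: "('k \<Rightarrow> 'v::ab_group_add \<Rightarrow> 'v) \<Rightarrow> 'v set \<Rightarrow> ('v \<Rightarrow> 'v) \<Rightarrow> bool" where
  "linear_on scale V f \<longleftrightarrow> (\<forall>x\<in>V. \<forall>y\<in>V. \<forall>c. f (x + scale c y) = f x + scale c (f y))"

text \<open>On vectors the factorial acts as a scalar, nonzero because a prime divides n! only if it
  is at most n. On the integer component it is a nonzero integer.\<close>

lemma fact_cancel:
  assumes vs: "vector_space (scale :: 'k::field \<Rightarrow> 'v::ab_group_add \<Rightarrow> 'v)"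
    and char: "CHAR('k) = 0 \<or> n < CHAR('k)" and zero: "of_nat (fact n) * f = (0 :: 'v additive_map)"
  shows "f = 0"
proof -
  interpret vector_space scale by (rule vs)
  have "CHAR('k) dvd fact n \<Longrightarrow> False"
  proof -
    assume dvd: "CHAR('k) dvd fact n"
    show False
    proof (cases "CHAR('k) = 0")
      case False
      then have "prime CHAR('k)"
        by (intro prime_CHAR_semidom) simp
      then show False
        using dvd char False by (auto simp: prime_dvd_fact_iff)
    qed (use dvd in simp)
  qed
  then have "(of_nat (fact n) :: 'k) \<noteq> 0"
    using of_nat_eq_0_iff_char_dvd by blast
  moreover have "scale (of_nat (fact n)) (amap_apply f x) = 0" for x
    using arg_cong[OF zero, of "\<lambda>g. amap_apply g x"] amap_of_nat(1)[OF vs] by simp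
  ultimately have "amap_apply f x = 0" for x
    by (metis scale_eq_0_iff)
  moreover have "amap_scalar f = 0"
    using arg_cong[OF zero, of amap_scalar] amap_of_nat(2)[OF vs, of "fact n"] by simp
  ultimately show ?thesis
    by (intro amap_eqI) simp_all
qed

text \<open>Compressing by the projection \<open>e\<close> onto Z/B turns the data into additive
  maps of the ambient space. The summand 1 - e in the constant coefficient makes the flow at time 1
  the identity of the whole space, as \<open>fps_flow_invertible\<close> demands. The two
  conclusions are injectivity and surjectivity of \<open>a 0\<close> on Z/B.\<close>

lemma flow_on_subquotient:
  fixes scale :: "'k::field \<Rightarrow> 'v::ab_group_add \<Rightarrow> 'v" and a D :: "nat \<Rightarrow> 'v \<Rightarrow> 'v"
  assumes vs: "vector_space scale"
    and B: "module.subspace scale B" and Z: "module.subspace scale Z" and BZ: "B \<subseteq> Z"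
    and a: "\<And>j. j < n \<Longrightarrow> linear_on scale Z (a j)"
      "\<And>j z. j < n \<Longrightarrow> z \<in> Z \<Longrightarrow> a j z \<in> Z" "\<And>j z. j < n \<Longrightarrow> z \<in> B \<Longrightarrow> a j z \<in> B"
    and D: "\<And>j. j < m \<Longrightarrow> linear_on scale Z (D j)"
      "\<And>j z. j < m \<Longrightarrow> z \<in> Z \<Longrightarrow> D j z \<in> Z" "\<And>j z. j < m \<Longrightarrow> z \<in> B \<Longrightarrow> D j z \<in> B"
    and ode: "\<And>t z. z \<in> Z \<Longrightarrow> (\<Sum>j<n. scale (of_nat j * t ^ (j - 1)) (a j z))
        - (\<Sum>i<m. \<Sum>j<n. scale (t ^ (i + j)) (D i (a j z))) \<in> B"
    and end_id: "\<And>z. z \<in> Z \<Longrightarrow> (\<Sum>j<n. a j z) - z \<in> B"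
    and n: "0 < n" and char: "CHAR('k) = 0 \<or> n \<le> CHAR('k) \<and> n + m \<le> CHAR('k) + 1"
  shows "z \<in> Z \<Longrightarrow> a 0 z \<in> B \<Longrightarrow> z \<in> B"
    and "z \<in> Z \<Longrightarrow> \<exists>z'\<in>Z. a 0 z' - z \<in> B"
proof -
  interpret vector_space scale by (rule vs)
  obtain e where e: "Vector_Spaces.linear scale scale e" and eZ: "\<And>v. e v \<in> Z"
    and e_cong: "\<And>v. v \<in> Z \<Longrightarrow> e v - v \<in> B" and eB: "\<And>v. v \<in> B \<Longrightarrow> e v = 0"
    and ee: "\<And>v. e (e v) = e v"
    using subquotient_projection[OF B Z BZ] by blast
  interpret e: Vector_Spaces.linear scale scale e by (rule e)
  have e_iff: "e v = 0 \<longleftrightarrow> v \<in> B" if "v \<in> Z" for v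
    using eB e_cong[OF that] subspace_neg[OF B, of "- v"] by auto
  have add_on: "f (x + y) = f x + f y" if "linear_on scale Z f" "x \<in> Z" "y \<in> Z" for f x y
    using that unfolding linear_on_def by (metis scale_one)
  have diff_on: "f (x - y) = f x - f y" if "linear_on scale Z f" "x \<in> Z" "y \<in> Z" for f x y
    using add_on[OF that(1) subspace_diff[OF Z that(2,3)] that(3)] by (simp add: algebra_simps)
  \<comment> \<open>A map preserving B descends to Z/B, so it may be fed with the representative
    \<open>e v\<close> instead of \<open>v\<close>.\<close>
  have e_on: "e (f (e v)) = e (f v)" if "linear_on scale Z f" "\<And>v. v \<in> B \<Longrightarrow> f v \<in> B" "v \<in> Z" for f v
  proof -
    have "f (e v) - f v \<in> B"
      using that e_cong[of v] diff_on[OF that(1) eZ that(3)] by metis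
    then show ?thesis
      using eB e.diff by (metis eq_iff_diff_eq_0)
  qed
  \<comment> \<open>The integer components are chosen as the constant polynomial 1 for
    \<open>A\<close>, and as 0 for \<Delta> below, so that they also satisfy the flow equation and
    the condition at time 1.\<close>
  have "\<exists>g. (\<forall>x. amap_apply g x = (if j < n then e (a j (e x)) else 0) + (if j = 0 then x - e x else 0))
      \<and> amap_scalar g = (if j = 0 then 1 else 0)" for j
    by (rule amap_exists)
       (use a(1)[of j] add_on[OF a(1)[of j] eZ eZ] in \<open>auto simp: e.add\<close>)
  then obtain A where A: "\<And>j x. amap_apply (A j) x = (if j < n then e (a j (e x)) else 0) + (if j = 0 then x - e x else 0)"
    and A_s: "\<And>j. amap_scalar (A j) = (if j = 0 then 1 else 0)"
    by metis
  have "\<exists>g. (\<forall>x. amap_apply g x = (if j < m then e (D j (e x)) else 0)) \<and> amap_scalar g = 0" for j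
    by (rule amap_exists)
       (use add_on[OF D(1)[of j] eZ eZ] in \<open>auto simp: e.add\<close>)
  then obtain \<Delta> where \<Delta>: "\<And>j x. amap_apply (\<Delta> j) x = (if j < m then e (D j (e x)) else 0)"
    and \<Delta>_s: "\<And>j. amap_scalar (\<Delta> j) = 0"
    by metis
  \<comment> \<open>The summand 1 - e of \<open>A 0\<close> disappears, since \<Delta> starts with
    \<open>e\<close> and e (1 - e) = 0.\<close>
  have \<Delta>A: "amap_apply (\<Delta> i) (amap_apply (A j) x) = (if i < m \<and> j < n then e (D i (a j (e x))) else 0)" for i j x
  proof (cases "i < m \<and> j < n")
    case True
    have "e (amap_apply (A j) x) = e (a j (e x))"
      using True by (simp add: A e.add e.diff ee)
    then show ?thesis
      using True by (simp add: \<Delta> e_on[OF D(1,3) a(2)[OF _ eZ]])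
  next
    case False
    have "e (amap_apply (A j) x) = 0" if "\<not> j < n"
      using that n by (simp add: A)
    then show ?thesis
      using False add_on[OF D(1)[of i], of 0 0] subspace_0[OF Z] by (auto simp: \<Delta>)
  qed
  \<comment> \<open>The flow equation by coefficients, now an equality of vectors because
    \<open>e\<close> kills B. Both sides vanish from k = n + m - 1 on; below that index the root
    count applies.\<close>
  have coeff: "scale (of_nat (k + 1)) (amap_apply (A (k + 1)) x)
      = (\<Sum>i\<le>k. amap_apply (\<Delta> i) (amap_apply (A (k - i)) x))" for k x
  proof (cases "k < n + m - 1")
    case True
    let ?w = "\<lambda>k. scale (of_nat (k + 1)) (amap_apply (A (k + 1)) x)
        - (\<Sum>i\<le>k. amap_apply (\<Delta> i) (amap_apply (A (k - i)) x))"
    have zero: "(\<Sum>k<n + m - 1. scale (t ^ k) (?w k)) = 0" for t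
    proof -
      have "(\<Sum>k<n + m - 1. scale (t ^ k) (scale (of_nat (k + 1)) (amap_apply (A (k + 1)) x)))
          = e (\<Sum>j<n. scale (of_nat j * t ^ (j - 1)) (a j (e x)))"
      proof -
        have "(\<Sum>k<n + m - 1. scale (t ^ k) (scale (of_nat (k + 1)) (amap_apply (A (k + 1)) x)))
            = (\<Sum>k<n - 1. scale (of_nat (k + 1) * t ^ k) (e (a (k + 1) (e x))))"
          by (rule sum.mono_neutral_cong_right) (auto simp: A mult.commute)
        also have "\<dots> = (\<Sum>j<Suc (n - 1). scale (of_nat j * t ^ (j - 1)) (e (a j (e x))))"
          by (subst sum.lessThan_Suc_shift) simp
        finally show ?thesis
          using n by (simp add: e.sum e.scale)
      qed
      moreover have "(\<Sum>k<n + m - 1. scale (t ^ k) (\<Sum>i\<le>k. amap_apply (\<Delta> i) (amap_apply (A (k - i)) x)))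
          = e (\<Sum>i<m. \<Sum>j<n. scale (t ^ (i + j)) (D i (a j (e x))))"
      proof -
        let ?g = "\<lambda>i j. scale (t ^ (i + j)) (amap_apply (\<Delta> i) (amap_apply (A j) x))"
        have "(\<Sum>k<n + m - 1. scale (t ^ k) (\<Sum>i\<le>k. amap_apply (\<Delta> i) (amap_apply (A (k - i)) x)))
            = (\<Sum>k<n + m - 1. \<Sum>i\<le>k. ?g i (k - i))"
          by (simp add: scale_sum_right)
        \<comment> \<open>The triangle contains the rectangle i < m, j < n, and outside the
          rectangle the terms are zero.\<close>
        also have "\<dots> = (\<Sum>(i, j)\<in>{(i, j). i + j < n + m - 1}. ?g i j)"
          by (rule sum.triangle_reindex[symmetric])
        also have "\<dots> = (\<Sum>(i, j)\<in>{..<m} \<times> {..<n}. e (scale (t ^ (i + j)) (D i (a j (e x)))))"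
        proof (rule sum.mono_neutral_cong_right)
          show "finite {(i, j). i + j < n + m - 1}"
            by (rule finite_subset[of _ "{..<n + m} \<times> {..<n + m}"]) auto
        qed (auto simp: \<Delta>A e.scale split: if_splits)
        finally show ?thesis
          by (simp add: sum.cartesian_product[symmetric] e.sum)
      qed
      moreover have "e (\<Sum>j<n. scale (of_nat j * t ^ (j - 1)) (a j (e x)))
          = e (\<Sum>i<m. \<Sum>j<n. scale (t ^ (i + j)) (D i (a j (e x))))"
        using eB[OF ode[OF eZ[of x], of t]] by (simp add: e.diff)
      ultimately show ?thesis
        by (simp only: scale_right_diff_distrib sum_subtractf) simp
    qed
    \<comment> \<open>The number of coefficients to be compared is n + m - 1, which explains the
      constant in the hypothesis on the characteristic.\<close>
    have "CHAR('k) = 0 \<or> n + m - 1 \<le> CHAR('k)"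
      using char by linarith
    from polynomial_coeffs_zero[OF this zero True] have "?w k = 0" .
    then show ?thesis
      by simp
  next
    case False
    then have "amap_apply (\<Delta> i) (amap_apply (A (k - i)) x) = 0" if "i \<le> k" for i
      using that by (auto simp: \<Delta>A)
    moreover have "\<not> k + 1 < n"
      using False by simp
    then have "amap_apply (A (k + 1)) x = 0"
      by (simp add: A)
    ultimately show ?thesis
      by simp
  qed
  have ode': "fps_deriv (Abs_fps A) = Abs_fps \<Delta> * Abs_fps A"
  proof (rule fps_ext, rule amap_eqI)
    fix k x
    show "amap_apply (fps_deriv (Abs_fps A) $ k) x = amap_apply ((Abs_fps \<Delta> * Abs_fps A) $ k) x"
      using coeff[of k x] by (simp add: fps_mult_nth amap_sum amap_of_nat[OF vs] atLeast0AtMost del: of_nat_Suc of_nat_add)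
    show "amap_scalar (fps_deriv (Abs_fps A) $ k) = amap_scalar ((Abs_fps \<Delta> * Abs_fps A) $ k)"
      by (simp add: fps_mult_nth amap_sum A_s \<Delta>_s)
  qed
  have one: "(\<Sum>k<n. Abs_fps A $ k) = 1"
  proof (rule amap_eqI)
    fix x
    have "(\<Sum>k<n. amap_apply (A k) x) = e (\<Sum>k<n. a k (e x)) + (x - e x)"
      using n by (simp add: A sum.distrib e.sum)
    also have "e (\<Sum>k<n. a k (e x)) = e x"
      using eB[OF end_id[OF eZ[of x]]] by (simp add: e.diff ee)
    finally show "amap_apply (\<Sum>k<n. Abs_fps A $ k) x = amap_apply 1 x"
      by (simp add: amap_sum)
    show "amap_scalar (\<Sum>k<n. Abs_fps A $ k) = amap_scalar 1"
      using n by (simp add: amap_sum A_s)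
  qed
  have A_top: "Abs_fps A $ k = 0" if "n \<le> k" for k
    using that n by (intro amap_eqI) (simp_all add: A A_s)
  have \<Delta>_top: "Abs_fps \<Delta> $ k = 0" if "m \<le> k" for k
    using that by (intro amap_eqI) (simp_all add: \<Delta> \<Delta>_s)
  obtain b where b: "A 0 * b = 1" "b * A 0 = 1"
  proof (rule fps_flow_invertible[OF ode' one n A_top \<Delta>_top])
    show "f = 0" if "of_nat (fact (n - 1)) * f = 0" for f :: "'v additive_map"
      using fact_cancel[OF vs _ that] n char by fastforce
  qed (simp_all add: that)
  have A0: "amap_apply (A 0) x = e (a 0 (e x)) + (x - e x)" for x
    using n by (simp add: A)
  show "z \<in> B" if "z \<in> Z" "a 0 z \<in> B"
  proof -
    \<comment> \<open>On \<open>e z\<close> the summand 1 - e of \<open>A 0\<close> vanishes as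
      well, so the invertible map \<open>A 0\<close> sends \<open>e z\<close> to 0.\<close>
    have "e (a 0 (e z)) = 0"
      using e_on[OF a(1,3), of 0 z] that n eB by simp
    then have "amap_apply (A 0) (e z) = 0"
      by (simp add: A0 ee)
    moreover have "amap_apply b (amap_apply (A 0) (e z)) = e z"
      using arg_cong[OF b(2), of "\<lambda>f. amap_apply f (e z)"] by simp
    moreover have "amap_apply b 0 = 0"
      by (metis amap_simps(1,4) mult_zero_right)
    ultimately show ?thesis
      using e_iff[OF that(1)] by simp
  qed
  show "\<exists>z'\<in>Z. a 0 z' - z \<in> B" if "z \<in> Z"
  proof -
    \<comment> \<open>The preimage in Z will be \<open>e y\<close>: applying \<open>e\<close> to
      \<open>A 0 y = z\<close> removes the summand 1 - e.\<close>
    define y where "y = amap_apply b z"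
    have "e (a 0 (e y)) + (y - e y) = z"
      using arg_cong[OF b(1), of "\<lambda>f. amap_apply f z"] by (simp add: A0 y_def)
    then have "e (a 0 (e y)) = e z"
      by (metis ee e.add e.diff add.right_neutral diff_self)
    then have "e (a 0 (e y) - z) = 0"
      by (simp add: e.diff)
    then have "a 0 (e y) - z \<in> B"
      using e_iff that subspace_diff[OF Z a(2)[OF n eZ] that] by blast
    then show ?thesis
      using eZ by blast
  qed
qed

section \<open>Linear functionals on formal sums\<close>

lemma linear_onD: "linear_on scale V f \<Longrightarrow> x \<in> V \<Longrightarrow> y \<in> V \<Longrightarrow> f (x + scale c y) = f x + scale c (f y)"
  by (simp add: linear_on_def)

lemma lookup_smul [simp]: "Poly_Mapping.lookup (smul c p) k = c * Poly_Mapping.lookup p k"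
  by (simp add: smul_def Poly_Mapping.map.rep_eq when_def)

lemma vector_space_smul: "vector_space (smul :: 'k::field \<Rightarrow> ('b \<Rightarrow>\<^sub>0 'k) \<Rightarrow> _)"
proof
  fix a b :: 'k and x y :: "'b \<Rightarrow>\<^sub>0 'k"
  show "smul a (x + y) = smul a x + smul a y" "smul (a + b) x = smul a x + smul b x"
    "smul a (smul b x) = smul (a * b) x" "smul 1 x = x"
    by (rule poly_mapping_eqI, simp add: lookup_add algebra_simps)+
qed

lemma keys_smul: "Poly_Mapping.keys (smul c p) \<subseteq> Poly_Mapping.keys p"
  by (auto simp: in_keys_iff)

lemma smul_single [simp]: "smul c (Poly_Mapping.single w a) = Poly_Mapping.single w (c * a)"
  by (auto intro!: poly_mapping_eqI simp: lookup_single when_def)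

definition weighted_sum :: "('k::field \<Rightarrow> 'v::ab_group_add \<Rightarrow> 'v) \<Rightarrow> ('b \<Rightarrow> 'v) \<Rightarrow> ('b \<Rightarrow>\<^sub>0 'k) \<Rightarrow> 'v" where
  "weighted_sum scale f p = (\<Sum>w\<in>Poly_Mapping.keys p. scale (Poly_Mapping.lookup p w) (f w))"

lemma lin_ext_eq_weighted_sum: "lin_ext f = weighted_sum smul f"
  by (simp add: fun_eq_iff lin_ext_def weighted_sum_def)

text \<open>
  \<open>tensor1_val\<close> is not compatible with the relations on words of length \<open>\<ge> 2\<close>; this variant is.
\<close>

definition tensor1 :: "('k::field \<Rightarrow> 'v::ab_group_add \<Rightarrow> 'v) \<Rightarrow> ('v hvec list \<Rightarrow>\<^sub>0 'k) \<Rightarrow> 'v" where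
  "tensor1 scale = weighted_sum scale (\<lambda>w. if length w = 1 then snd (hd w) else 0)"

context vector_space
begin

lemma weighted_sum_superset:
  assumes "finite S" "Poly_Mapping.keys p \<subseteq> S"
  shows "weighted_sum scale f p = (\<Sum>w\<in>S. scale (Poly_Mapping.lookup p w) (f w))"
  unfolding weighted_sum_def using assms
  by (intro sum.mono_neutral_left) (auto simp: in_keys_iff)

lemma linear_weighted_sum: "Vector_Spaces.linear smul scale (weighted_sum scale f)"
proof -
  have "weighted_sum scale f (p + q) = weighted_sum scale f p + weighted_sum scale f q"
    "weighted_sum scale f (smul c p) = scale c (weighted_sum scale f p)" for p q c
  proof -
    have "weighted_sum scale f r = (\<Sum>w\<in>Poly_Mapping.keys p \<union> Poly_Mapping.keys q. scale (Poly_Mapping.lookup r w) (f w))"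
      if "Poly_Mapping.keys r \<subseteq> Poly_Mapping.keys p \<union> Poly_Mapping.keys q" for r
      using that by (intro weighted_sum_superset) auto
    from this[of p] this[of q] this[of "p + q"]
    show "weighted_sum scale f (p + q) = weighted_sum scale f p + weighted_sum scale f q"
      using Poly_Mapping.keys_add[of p q] by (simp add: lookup_add scale_left_distrib sum.distrib)
    show "weighted_sum scale f (smul c p) = scale c (weighted_sum scale f p)"
      using weighted_sum_superset[of "Poly_Mapping.keys p" "smul c p" f] keys_smul[of c p]
      by (simp add: weighted_sum_def scale_sum_right)
  qed
  then show ?thesis
    by (auto simp: Vector_Spaces.linear_iff vector_space_smul vector_space_axioms)
qed

lemma weighted_sum_single [simp]: "weighted_sum scale f (Poly_Mapping.single w c) = scale c (f w)"
  by (cases "c = 0") (simp_all add: weighted_sum_def)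

lemma linear_apply_smul: "Vector_Spaces.linear smul scale \<phi> \<Longrightarrow> \<phi> (smul c p) = scale c (\<phi> p)"
  by (simp add: Vector_Spaces.linear_iff)

lemma linear_apply_lin_ext:
  assumes "Vector_Spaces.linear smul scale \<phi>"
  shows "\<phi> (lin_ext g p) = weighted_sum scale (\<lambda>w. \<phi> (g w)) p"
proof -
  interpret Vector_Spaces.linear smul scale \<phi> by fact
  show ?thesis
    by (simp add: lin_ext_def weighted_sum_def sum scale)
qed

lemma linear_on_weighted_sum:
  assumes V: "subspace V" and h: "linear_on scale V h"
    and f: "\<And>w. w \<in> Poly_Mapping.keys p \<Longrightarrow> f w \<in> V"
  shows "weighted_sum scale f p \<in> V" and "h (weighted_sum scale f p) = weighted_sum scale (\<lambda>w. h (f w)) p"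
proof -
  have h0: "h 0 = 0"
    using linear_onD[OF h subspace_0[OF V] subspace_0[OF V], of 1] by simp
  have "(\<Sum>w\<in>S. scale (g w) (f w)) \<in> V \<and> h (\<Sum>w\<in>S. scale (g w) (f w)) = (\<Sum>w\<in>S. scale (g w) (h (f w)))"
    if "finite S" "S \<subseteq> Poly_Mapping.keys p" for S g
    using that
  proof (induction S)
    case empty
    then show ?case by (simp add: h0 subspace_0[OF V])
  next
    case (insert w S)
    then show ?case
      using linear_onD[OF h, of "\<Sum>w\<in>S. scale (g w) (f w)" "f w" "g w"] f
      by (simp add: add.commute subspace_add[OF V] subspace_scale[OF V])
  qed
  from this[of "Poly_Mapping.keys p"]
  show "weighted_sum scale f p \<in> V" "h (weighted_sum scale f p) = weighted_sum scale (\<lambda>w. h (f w)) p"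
    by (simp_all add: weighted_sum_def)
qed

lemma linear_tensor1: "Vector_Spaces.linear smul scale (tensor1 scale)"
  unfolding tensor1_def by (rule linear_weighted_sum)

lemma tensor1_simps:
  "tensor1 scale 0 = 0" "tensor1 scale (p + q) = tensor1 scale p + tensor1 scale q"
  "tensor1 scale (p - q) = tensor1 scale p - tensor1 scale q"
  "tensor1 scale (smul c p) = scale c (tensor1 scale p)"
  "tensor1 scale (sum f I) = (\<Sum>i\<in>I. tensor1 scale (f i))"
proof -
  interpret Vector_Spaces.linear smul scale "tensor1 scale" by (rule linear_tensor1)
  show "tensor1 scale 0 = 0" "tensor1 scale (p + q) = tensor1 scale p + tensor1 scale q"
    "tensor1 scale (p - q) = tensor1 scale p - tensor1 scale q"
    "tensor1 scale (smul c p) = scale c (tensor1 scale p)"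
    "tensor1 scale (sum f I) = (\<Sum>i\<in>I. tensor1 scale (f i))"
    by (simp_all add: add diff scale sum)
qed

lemma tensor1_single [simp]: "tensor1 scale (Poly_Mapping.single [(i, v)] c) = scale c v"
  by (simp add: tensor1_def)

text \<open>The three words of a multilinearity relation have the same length. In length 1 the
  relation is linearity in one vector, and on all other words \<open>tensor1\<close> is
  zero.\<close>

lemma tensor1_cong:
  assumes "tensor_eq scale p q"
  shows "tensor1 scale p = tensor1 scale q"
proof -
  interpret Vector_Spaces.linear smul scale "tensor1 scale" by (rule linear_tensor1)
  have "tensor1 scale r = 0" if r_in: "r \<in> tensor_rels scale" for r
  proof -
    obtain us ws i v v' c where r: "r = Poly_Mapping.single (us @ (i, v + scale c v') # ws) 1
      - Poly_Mapping.single (us @ (i, v) # ws) 1 - Poly_Mapping.single (us @ (i, v') # ws) c"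
      using r_in unfolding tensor_rels_def by blast
    show ?thesis
      by (cases "us = [] \<and> ws = []") (auto simp: r tensor1_simps, auto simp: tensor1_def)
  qed
  then have "tensor1 scale (p - q) = 0"
    using assms unfolding tensor_eq_def by (rule eq_0_on_span)
  then show ?thesis
    by (simp add: tensor1_simps)
qed

lemma tensor1_val_eq:
  assumes "\<And>w. w \<in> Poly_Mapping.keys p \<Longrightarrow> length w = 1"
  shows "tensor1_val scale p = tensor1 scale p"
  unfolding tensor1_val_def tensor1_def weighted_sum_def using assms by simp

end

lemma lin_ext_single [simp]: "lin_ext f (Poly_Mapping.single w c) = smul c (f w)"
  unfolding lin_ext_eq_weighted_sum by (rule vector_space.weighted_sum_single[OF vector_space_smul])

lemma linear_lin_ext: "Vector_Spaces.linear smul smul (lin_ext f)"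
  unfolding lin_ext_eq_weighted_sum by (rule vector_space.linear_weighted_sum[OF vector_space_smul])


section \<open>Families with a single output\<close>

definition block_inputs :: "('o \<Rightarrow> 'o \<Rightarrow> int \<Rightarrow> 'v set) \<Rightarrow> 'o list \<Rightarrow> 'v hvec list \<Rightarrow> bool" where
  "block_inputs V b vs \<longleftrightarrow> list_all2 (\<lambda>(x, y) (i, v). v \<in> V x y (i + 1)) (zip (butlast b) (tl b)) vs"

text \<open>The shadow of \<open>h_elem\<close> on types with one block, where outputs are
  one-letter words. It takes bare families of subspaces instead of quivers, so that spaces pulled
  back along an object map are covered. The tag of an output is its degree in B[-d], which exceeds
  the degree in A[1] by d + 1.\<close>

definition block_family ::
  "('k::field \<Rightarrow> 'v::ab_group_add \<Rightarrow> 'v) \<Rightarrow> int \<Rightarrow> 'o set \<Rightarrow> ('o \<Rightarrow> 'o \<Rightarrow> int \<Rightarrow> 'v set)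
    \<Rightarrow> ('o \<Rightarrow> 'o \<Rightarrow> int \<Rightarrow> 'v set) \<Rightarrow> int \<Rightarrow> ('o, 'v, 'k) family \<Rightarrow> bool" where
  "block_family scale d X V W n F \<longleftrightarrow> (\<forall>b. b \<noteq> [] \<and> set b \<subseteq> X \<longrightarrow>
     (\<forall>vs. block_inputs V b vs \<longrightarrow> (\<forall>ws\<in>Poly_Mapping.keys (F [b] vs).
        \<exists>u\<in>W (hd b) (last b) (tdeg vs + n + 1). ws = [(tdeg vs + n + (d + 1), u)])) \<and>
     (\<forall>us i v v' ws c. block_inputs V b (us @ (i, v) # ws) \<and> block_inputs V b (us @ (i, v') # ws) \<longrightarrow>
        tensor1 scale (F [b] (us @ (i, v + scale c v') # ws))
        = tensor1 scale (F [b] (us @ (i, v) # ws)) + scale c (tensor1 scale (F [b] (us @ (i, v') # ws)))))"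

definition graded_subspaces ::
  "('k::field \<Rightarrow> 'v::ab_group_add \<Rightarrow> 'v) \<Rightarrow> 'o set \<Rightarrow> ('o \<Rightarrow> 'o \<Rightarrow> int \<Rightarrow> 'v set) \<Rightarrow> bool" where
  "graded_subspaces scale X V \<longleftrightarrow> (\<forall>x\<in>X. \<forall>y\<in>X. \<forall>i. module.subspace scale (V x y i))"

definition component ::
  "('k::field \<Rightarrow> 'v::ab_group_add \<Rightarrow> 'v) \<Rightarrow> ('o, 'v, 'k) family \<Rightarrow> 'o list \<Rightarrow> 'v hvec list \<Rightarrow> 'v" where
  "component scale F b vs = tensor1 scale (F [b] vs)"

lemma inputs_single_block: "inputs A [b] = {vs. block_inputs (Sp A) b vs}"
  by (simp add: inputs_def block_inputs_def)

lemma outputs_single_block: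
  "outputs d B \<Phi> [b] = {[(i, u)] | i u. u \<in> Sp B (\<Phi> (hd b)) (\<Phi> (last b)) (i - d)}"
  by (auto simp: outputs_def list_all2_Cons1)

lemma types_single_block: "[b] \<in> types A \<longleftrightarrow> b \<noteq> [] \<and> set b \<subseteq> Obj A"
  by (auto simp: types_def)

lemma tdeg_simps [simp]: "tdeg [] = 0" "tdeg (w # ws) = fst w + tdeg ws" "tdeg (us @ ws) = tdeg us + tdeg ws"
  by (simp_all add: tdeg_def)

lemma block_inputs_map:
  assumes "b \<noteq> []"
  shows "block_inputs V (map \<Phi> b) vs \<longleftrightarrow> block_inputs (\<lambda>x y. V (\<Phi> x) (\<Phi> y)) b vs"
proof -
  have "zip (butlast (map \<Phi> b)) (tl (map \<Phi> b)) = map (\<lambda>(x, y). (\<Phi> x, \<Phi> y)) (zip (butlast b) (tl b))"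
    by (simp add: map_butlast[symmetric] map_tl[symmetric] zip_map_map)
  then show ?thesis
    by (simp add: block_inputs_def list_all2_map1 case_prod_unfold)
qed

context vector_space
begin

lemma h_elem_block_family:
  assumes "h_elem scale d A B \<Phi> n F"
  shows "block_family scale d (Obj A) (Sp A) (\<lambda>x y. Sp B (\<Phi> x) (\<Phi> y)) n F"
  unfolding block_family_def
proof (intro allI impI conjI ballI)
  fix b assume "b \<noteq> [] \<and> set b \<subseteq> Obj A"
  then have b: "[b] \<in> types A"
    by (simp add: types_single_block)
  show "\<exists>u\<in>Sp B (\<Phi> (hd b)) (\<Phi> (last b)) (tdeg vs + n + 1). ws = [(tdeg vs + n + (d + 1), u)]"
    if "block_inputs (Sp A) b vs" "ws \<in> Poly_Mapping.keys (F [b] vs)" for vs ws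
  proof -
    have "ws \<in> outputs d B \<Phi> [b] \<and> tdeg ws = tdeg vs + (n + d + 1)"
      using assms b that by (auto simp: h_elem_def inputs_single_block)
    then show ?thesis
      by (auto simp: outputs_single_block algebra_simps)
  qed
  show "tensor1 scale (F [b] (us @ (i, v + scale c v') # ws))
      = tensor1 scale (F [b] (us @ (i, v) # ws)) + scale c (tensor1 scale (F [b] (us @ (i, v') # ws)))"
    if "block_inputs (Sp A) b (us @ (i, v) # ws) \<and> block_inputs (Sp A) b (us @ (i, v') # ws)" for us i v v' ws c
  proof -
    have "tensor_eq scale (F [b] (us @ (i, v + scale c v') # ws))
          (F [b] (us @ (i, v) # ws) + smul c (F [b] (us @ (i, v') # ws)))"
      using assms b that by (auto simp: h_elem_def inputs_single_block)
    from tensor1_cong[OF this] show ?thesis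
      by (simp add: tensor1_simps)
  qed
qed

text \<open>A structure or morphism that starts from another quiver becomes a family on the source
  objects; then all discs of a diagram share one object set.\<close>

lemma block_family_pullback:
  assumes F: "block_family scale d Y V W n F" and "\<Phi> ` X \<subseteq> Y"
  shows "block_family scale d X (\<lambda>x y. V (\<Phi> x) (\<Phi> y)) (\<lambda>x y. W (\<Phi> x) (\<Phi> y)) n (\<lambda>y. F (map (map \<Phi>) y))"
  unfolding block_family_def
proof (intro allI impI)
  fix b assume b: "b \<noteq> [] \<and> set b \<subseteq> X"
  then have "map \<Phi> b \<noteq> [] \<and> set (map \<Phi> b) \<subseteq> Y"
    using assms(2) by auto
  with F have "(\<forall>vs. block_inputs V (map \<Phi> b) vs \<longrightarrow> (\<forall>ws\<in>Poly_Mapping.keys (F [map \<Phi> b] vs).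
        \<exists>u\<in>W (hd (map \<Phi> b)) (last (map \<Phi> b)) (tdeg vs + n + 1). ws = [(tdeg vs + n + (d + 1), u)])) \<and>
     (\<forall>us i v v' ws c. block_inputs V (map \<Phi> b) (us @ (i, v) # ws) \<and> block_inputs V (map \<Phi> b) (us @ (i, v') # ws) \<longrightarrow>
        tensor1 scale (F [map \<Phi> b] (us @ (i, v + scale c v') # ws))
        = tensor1 scale (F [map \<Phi> b] (us @ (i, v) # ws)) + scale c (tensor1 scale (F [map \<Phi> b] (us @ (i, v') # ws))))"
    unfolding block_family_def by (elim allE[of _ "map \<Phi> b"] impE)
  then show "(\<forall>vs. block_inputs (\<lambda>x y. V (\<Phi> x) (\<Phi> y)) b vs \<longrightarrow> (\<forall>ws\<in>Poly_Mapping.keys (F (map (map \<Phi>) [b]) vs).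
        \<exists>u\<in>W (\<Phi> (hd b)) (\<Phi> (last b)) (tdeg vs + n + 1). ws = [(tdeg vs + n + (d + 1), u)])) \<and>
     (\<forall>us i v v' ws c. block_inputs (\<lambda>x y. V (\<Phi> x) (\<Phi> y)) b (us @ (i, v) # ws)
        \<and> block_inputs (\<lambda>x y. V (\<Phi> x) (\<Phi> y)) b (us @ (i, v') # ws) \<longrightarrow>
        tensor1 scale (F (map (map \<Phi>) [b]) (us @ (i, v + scale c v') # ws))
        = tensor1 scale (F (map (map \<Phi>) [b]) (us @ (i, v) # ws))
          + scale c (tensor1 scale (F (map (map \<Phi>) [b]) (us @ (i, v') # ws))))"
    using b by (simp add: block_inputs_map hd_map last_map)
qed

lemma block_family_keys:
  assumes "block_family scale d X V W n F" "b \<noteq> []" "set b \<subseteq> X" "block_inputs V b vs"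
    "ws \<in> Poly_Mapping.keys (F [b] vs)"
  obtains u where "u \<in> W (hd b) (last b) (tdeg vs + n + 1)" "ws = [(tdeg vs + n + (d + 1), u)]"
proof -
  have "\<exists>u\<in>W (hd b) (last b) (tdeg vs + n + 1). ws = [(tdeg vs + n + (d + 1), u)]"
    using assms(1)[unfolded block_family_def, THEN spec[of _ b], THEN mp, THEN conjunct1,
        THEN spec[of _ vs], THEN mp, THEN bspec, of ws] assms(2-5) by simp
  then show thesis
    using that by blast
qed

lemma block_family_linear_on:
  assumes "block_family scale d X V W n F" "b \<noteq> []" "set b \<subseteq> X"
    and "\<And>u. u \<in> U \<Longrightarrow> block_inputs V b (us @ (i, u) # ws)"
  shows "linear_on scale U (\<lambda>u. component scale F b (us @ (i, u) # ws))"
  using assms(1)[unfolded block_family_def, THEN spec[of _ b], THEN mp, THEN conjunct2, rule_format]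
    assms(2-4) by (simp add: linear_on_def component_def)

lemma component_eq_weighted_sum:
  assumes "block_family scale d X V W n F" "b \<noteq> []" "set b \<subseteq> X" "block_inputs V b vs"
  shows "component scale F b vs = weighted_sum scale (\<lambda>w. snd (hd w)) (F [b] vs)"
  unfolding component_def tensor1_def weighted_sum_def
  by (intro sum.cong refl) (erule block_family_keys[OF assms], simp)

lemma hd_last_in:
  assumes "b \<noteq> []" "set b \<subseteq> X"
  shows "hd b \<in> X" "last b \<in> X"
  using assms hd_in_set[of b] last_in_set[of b] by auto

lemma component_mem:
  assumes F: "block_family scale d X V W n F" and b: "b \<noteq> []" "set b \<subseteq> X" and vs: "block_inputs V b vs"
    and W: "graded_subspaces scale X W"
  shows "component scale F b vs \<in> W (hd b) (last b) (tdeg vs + n + 1)"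
proof -
  have sub: "subspace (W (hd b) (last b) (tdeg vs + n + 1))"
    using W hd_last_in[OF b] unfolding graded_subspaces_def by blast
  show ?thesis
    unfolding component_eq_weighted_sum[OF F b vs]
    by (rule linear_on_weighted_sum(1)[OF sub, where h = "\<lambda>x. x"])
       (simp add: linear_on_def, erule block_family_keys[OF F b vs], simp)
qed

text \<open>Diagrams are evaluated on representatives, that is, on formal sums. If the rest of an
  evaluation is linear in the single output vector, it depends only on the vector that the formal
  sum represents.\<close>

lemma linear_weighted_component:
  assumes F: "block_family scale d X V W n F" and b: "b \<noteq> []" "set b \<subseteq> X" and vs: "block_inputs V b vs"
    and W: "graded_subspaces scale X W"
    and h: "linear_on scale (W (hd b) (last b) (tdeg vs + n + 1)) h"
    and \<psi>: "\<And>u. u \<in> W (hd b) (last b) (tdeg vs + n + 1) \<Longrightarrow> \<psi> [(tdeg vs + n + (d + 1), u)] = h u"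
  shows "weighted_sum scale \<psi> (F [b] vs) = h (component scale F b vs)"
proof -
  have sub: "subspace (W (hd b) (last b) (tdeg vs + n + 1))"
    using W hd_last_in[OF b] unfolding graded_subspaces_def by blast
  have "h (component scale F b vs) = weighted_sum scale (\<lambda>w. h (snd (hd w))) (F [b] vs)"
    unfolding component_eq_weighted_sum[OF F b vs]
    by (rule linear_on_weighted_sum(2)[OF sub h]) (erule block_family_keys[OF F b vs], simp)
  also have "\<dots> = weighted_sum scale \<psi> (F [b] vs)"
    unfolding weighted_sum_def by (intro sum.cong refl) (erule block_family_keys[OF F b vs], simp add: \<psi>)
  finally show ?thesis ..
qed

end

section \<open>Evaluation of diagrams with a single output\<close>

lemma linear_compose_smul:
  assumes "Vector_Spaces.linear smul scale \<phi>" "Vector_Spaces.linear smul smul g"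
  shows "Vector_Spaces.linear smul scale (\<lambda>p. \<phi> (g p))"
  using Vector_Spaces.linear_compose[OF assms(2,1)] by (simp add: o_def)

lemma linear_bring: "Vector_Spaces.linear smul smul (bring ns)"
proof (induction ns)
  case Nil
  interpret vector_space smul by (rule vector_space_smul)
  show ?case
    using linear_id by (simp add: bring_def id_def)
next
  case (Cons n ns)
  have "Vector_Spaces.linear smul smul (pull n)"
    unfolding pull_def by (rule linear_lin_ext)
  from linear_compose_smul[OF this Cons] show ?case
    by (simp add: bring_def)
qed

lemma linear_act_edge: "Vector_Spaces.linear smul smul (act_edge d n)"
  unfolding act_edge_def by (rule linear_compose_smul[OF linear_lin_ext linear_bring])

lemma linear_act_disc: "Vector_Spaces.linear smul smul (act_disc fill \<delta>)"
  unfolding act_disc_def Let_def by (rule linear_compose_smul[OF linear_lin_ext linear_bring])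

lemma ksign_0 [simp]: "ksign i 0 = 1" "ksign 0 i = 1"
  by (simp_all add: ksign_def)

lemma ksign_nonzero [simp]: "ksign i j \<noteq> 0"
  by (simp add: ksign_def)

lemma pull_single: "pull n (Poly_Mapping.single w c) = (
     let u = takeWhile (\<lambda>z. fst z \<noteq> n) w; r = dropWhile (\<lambda>z. fst z \<noteq> n) w
     in Poly_Mapping.single (hd r # u @ tl r) (c * ksign (fst (snd (hd r))) (tdeg (map snd u))))"
  by (simp add: pull_def Let_def)

lemma act_edge_single:
  "act_edge d n (Poly_Mapping.single ((n, (i, v)) # r) c) = Poly_Mapping.single ((n, (i - (d + 1), v)) # r) c"
  by (simp add: act_edge_def bring_def pull_single)

text \<open>The last stage of \<open>eval_diagram\<close> for one external output; its wire is the
  root letter, whose name is the empty path.\<close>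

definition root_value :: "('k::field \<Rightarrow> 'v::ab_group_add \<Rightarrow> 'v) \<Rightarrow> ('v, 'k) state \<Rightarrow> 'v" where
  "root_value scale p = tensor1 scale (lin_ext (\<lambda>z. Poly_Mapping.single (map snd z) 1) (bring [[]] p))"

context vector_space
begin

lemma linear_root_value: "Vector_Spaces.linear smul scale (root_value scale)"
  unfolding root_value_def
  by (rule linear_compose_smul[OF linear_tensor1 linear_compose_smul[OF linear_lin_ext linear_bring]])

lemma root_value_single: "root_value scale (Poly_Mapping.single [([], (i, u))] 1) = u"
  by (simp add: root_value_def bring_def pull_single)

lemma tensor1_eval_diagram:
  assumes "word_outs (boundary x D) = [[]]"
  shows "tensor1 scale (eval_diagram x D fs vs)
    = root_value scale (fold (\<lambda>f. f) fs (Poly_Mapping.single (zip (word_ins (boundary x D)) vs) 1))"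
  by (simp add: eval_diagram_def root_value_def assms)

text \<open>Evaluation in continuation style: \<phi> stands for all factors applied after this disc,
  and \<open>h\<close> is its effect as a function of the output vector of the disc. Diagrams are
  thus computed from the last factor back to the first.\<close>

lemma act_disc_step:
  assumes \<phi>: "Vector_Spaces.linear smul scale \<phi>"
    and ins: "word_ins (normalize (snd \<delta>)) = ns" and bring: "bring ns (Poly_Mapping.single z 1) = Poly_Mapping.single z' s"
    and "length ns = m" and outs: "word_outs (normalize (snd \<delta>)) = [o']" and ty: "word_type (normalize (snd \<delta>)) = [b]"
    and G: "fill (fst \<delta>) = G" and F: "block_family scale d X V W n G" and b: "b \<noteq> []" "set b \<subseteq> X"
    and vs: "map snd (take m z') = vs" "block_inputs V b vs" and W: "graded_subspaces scale X W"
    and h: "linear_on scale (W (hd b) (last b) (tdeg vs + n + 1)) h"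
    and \<phi>h: "\<And>u. u \<in> W (hd b) (last b) (tdeg vs + n + 1) \<Longrightarrow>
      \<phi> (Poly_Mapping.single ((o', (tdeg vs + n + (d + 1), u)) # drop m z') 1) = h u"
  shows "\<phi> (act_disc fill \<delta> (Poly_Mapping.single z 1)) = scale s (h (component scale G b vs))"
proof -
  have 1: "act_disc fill \<delta> (Poly_Mapping.single z 1)
      = smul s (lin_ext (\<lambda>us. Poly_Mapping.single (zip [o'] us @ drop m z') 1) (G [b] vs))"
    unfolding act_disc_def Let_def ins outs ty bring lin_ext_single G vs(1) \<open>length ns = m\<close> ..
  have "\<phi> (act_disc fill \<delta> (Poly_Mapping.single z 1))
      = scale s (weighted_sum scale (\<lambda>us. \<phi> (Poly_Mapping.single (zip [o'] us @ drop m z') 1)) (G [b] vs))"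
    unfolding 1 linear_apply_smul[OF \<phi>] linear_apply_lin_ext[OF \<phi>] ..
  also have "weighted_sum scale (\<lambda>us. \<phi> (Poly_Mapping.single (zip [o'] us @ drop m z') 1)) (G [b] vs)
      = h (component scale G b vs)"
    by (rule linear_weighted_component[OF F b vs(2) W h]) (simp add: \<phi>h)
  finally show ?thesis .
qed

lemma act_root_step:
  assumes "word_ins (normalize (snd \<delta>)) = ns" "bring ns (Poly_Mapping.single z 1) = Poly_Mapping.single z' s"
    and "length ns = length z'" "word_outs (normalize (snd \<delta>)) = [[]]" "word_type (normalize (snd \<delta>)) = [b]"
    and G: "fill (fst \<delta>) = G" and F: "block_family scale d X V W n G" and b: "b \<noteq> []" "set b \<subseteq> X"
    and vs: "map snd z' = vs" "block_inputs V b vs" and W: "graded_subspaces scale X W"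
  shows "root_value scale (act_disc fill \<delta> (Poly_Mapping.single z 1)) = scale s (component scale G b vs)"
proof -
  have vs': "map snd (take (length z') z') = vs"
    by (simp add: vs(1))
  show ?thesis
    by (rule act_disc_step[where fill = fill and \<delta> = \<delta> and h = "\<lambda>u. u", OF linear_root_value assms(1-5) G F b vs' vs(2) W])
       (simp_all add: root_value_single linear_on_def)
qed

text \<open>Composing with S changes only the tag, from \<open>tdeg vs + n + (d + 1)\<close> to
  \<open>tdeg vs + n\<close>, the degree that the next disc reads.\<close>

lemma act_disc_edge_step:
  assumes \<phi>: "Vector_Spaces.linear smul scale \<phi>"
    and "word_ins (normalize (snd \<delta>)) = ns" "bring ns (Poly_Mapping.single z 1) = Poly_Mapping.single z' s"
    and "length ns = m" and outs: "word_outs (normalize (snd \<delta>)) = [o']" and ty: "word_type (normalize (snd \<delta>)) = [b]"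
    and G: "fill (fst \<delta>) = G" and F: "block_family scale d X V W n G" and b: "b \<noteq> []" "set b \<subseteq> X"
    and vs: "map snd (take m z') = vs" "block_inputs V b vs" and W: "graded_subspaces scale X W"
    and h: "linear_on scale (W (hd b) (last b) (tdeg vs + n + 1)) h"
    and \<phi>h: "\<And>u. u \<in> W (hd b) (last b) (tdeg vs + n + 1) \<Longrightarrow>
      \<phi> (Poly_Mapping.single ((o', (tdeg vs + n, u)) # drop m z') 1) = h u"
  shows "\<phi> (act_edge d o' (act_disc fill \<delta> (Poly_Mapping.single z 1))) = scale s (h (component scale G b vs))"
  by (rule act_disc_step[where \<phi> = "\<lambda>p. \<phi> (act_edge d o' p)" and fill = fill and \<delta> = \<delta>,
        OF linear_compose_smul[OF \<phi> linear_act_edge] assms(2-14)])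
     (simp add: act_edge_single \<phi>h)

end

section \<open>Classification of diagrams\<close>

lemma size_slot_less:
  assumes "(q, Some D) \<in> set ss"
  shows "size D < Suc (size_list (size_prod (\<lambda>_. 0) (size_option size)) ss)"
  using assms by (induction ss) auto

text \<open>The conditions that define the sets of diagrams see only fillings, polarities and mates.
  This is \<open>discs\<close> without names and corners, which makes the classification independent
  of positions.\<close>

function nodes :: "pol \<Rightarrow> 'l option \<Rightarrow> 'l diagram \<Rightarrow> ('l \<times> (pol \<times> 'l option) list) list" where
  "nodes p m (Disc l ss) = (l, map (\<lambda>(q, y). (q, map_option filling y)) ss @ [(p, m)])
     # concat (map (\<lambda>(q, y). case y of None \<Rightarrow> [] | Some D \<Rightarrow> nodes (opp q) (Some l) D) ss)"
  by pat_completeness auto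
termination
  by (relation "measure (\<lambda>(p, m, D). size D)") (auto simp: size_slot_less)

function leaf_pols :: "'l diagram \<Rightarrow> pol list" where
  "leaf_pols (Disc l ss) = concat (map (\<lambda>(q, y). case y of None \<Rightarrow> [q] | Some D \<Rightarrow> leaf_pols D) ss)"
  by pat_completeness auto
termination
  by (relation "measure size") (auto simp: size_slot_less)

definition child_nodes :: "'l \<Rightarrow> (pol \<times> 'l diagram option) list \<Rightarrow> ('l \<times> (pol \<times> 'l option) list) list" where
  "child_nodes l ss = concat (map (\<lambda>(q, y). case y of None \<Rightarrow> [] | Some D \<Rightarrow> nodes (opp q) (Some l) D) ss)"

lemma nodes_Disc:
  "nodes p m (Disc l ss) = (l, map (\<lambda>(q, y). (q, map_option filling y)) ss @ [(p, m)]) # child_nodes l ss"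
  by (simp add: child_nodes_def)

declare nodes.simps [simp del]

lemma child_nodes_simps [simp]:
  "child_nodes l [] = []" "child_nodes l ((q, None) # ss) = child_nodes l ss"
  "child_nodes l ((q, Some D) # ss) = nodes (opp q) (Some l) D @ child_nodes l ss"
  "child_nodes l (xs @ ys) = child_nodes l xs @ child_nodes l ys"
  by (simp_all add: child_nodes_def)

lemma child_nodes_replicate [simp]: "child_nodes l (replicate k (q, None)) = []"
  by (induction k) simp_all

lemma concat_map_nth: "concat (map (\<lambda>i. f (xs ! i)) [0..<length xs]) = concat (map f xs)"
proof -
  have "map (\<lambda>i. f (xs ! i)) [0..<length xs] = map f xs"
    by (rule nth_equalityI) simp_all
  then show ?thesis
    by simp
qed

lemma map_fst_leaves: "map fst (leaves \<pi> D) = leaf_pols D"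
proof (induction \<pi> D rule: leaves.induct)
  case (1 \<pi> l ss)
  have "map fst (leaves \<pi> (Disc l ss)) = concat (map (\<lambda>i. case ss ! i of (q, y) \<Rightarrow>
      (case y of None \<Rightarrow> [q] | Some D \<Rightarrow> leaf_pols D)) [0..<length ss])"
    using 1 by (auto simp: map_concat intro!: arg_cong[where f = concat] split: prod.split option.split)
  also have "\<dots> = leaf_pols (Disc l ss)"
    by (simp add: concat_map_nth[of "\<lambda>(q, y). case y of None \<Rightarrow> [q] | Some D \<Rightarrow> leaf_pols D" ss])
  finally show ?case .
qed

definition node_of :: "'l \<times> ('l, 'o) letter list \<Rightarrow> 'l \<times> (pol \<times> 'l option) list" where
  "node_of \<delta> = (fst \<delta>, map (\<lambda>a. (pol a, mate a)) (snd \<delta>))"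

lemma node_of_pair: "node_of (l, w) = (l, map (\<lambda>a. (pol a, mate a)) w)"
  by (simp add: node_of_def)

lemma map_node_of_discs: "map node_of (discs c k \<pi> p m D) = nodes p m D"
proof (induction c k \<pi> p m D rule: discs.induct)
  case (1 c k \<pi> p m l ss)
  let ?pos = "\<lambda>i. k + length (leaves [] (Disc l (take i ss)))"
  let ?g = "\<lambda>(q, y). case y of None \<Rightarrow> [] | Some D \<Rightarrow> nodes (opp q) (Some l) D"
  have "map node_of (concat (map (\<lambda>i. case ss ! i of
            (q, None) \<Rightarrow> []
          | (q, Some D) \<Rightarrow> discs c (?pos i) (\<pi> @ [i]) (opp q) (Some l) D) [0..<length ss]))
      = concat (map (\<lambda>i. ?g (ss ! i)) [0..<length ss])"
    using 1[OF refl] by (auto simp: map_concat intro!: arg_cong[where f = concat] split: prod.split option.split)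
  also have "\<dots> = child_nodes l ss"
    by (simp add: concat_map_nth child_nodes_def)
  moreover have "map (\<lambda>i. (fst (ss ! i), map_option filling (snd (ss ! i)))) [0..<length ss]
      = map (\<lambda>(q, y). (q, map_option filling y)) ss"
    by (rule nth_equalityI) (auto simp: case_prod_unfold)
  ultimately show ?case
    by (simp add: nodes_Disc Let_def node_of_pair comp_def del: leaves.simps)
qed

lemma ball_discs_of:
  "(\<forall>(l, w)\<in>set (discs_of x D). P l (map (\<lambda>a. (pol a, mate a)) w)) \<longleftrightarrow> (\<forall>(l, w)\<in>set (nodes Out None D). P l w)"
  unfolding discs_of_def map_node_of_discs[symmetric, of _ _ _ "\<lambda>j. concat (rev x) ! j" 0 "[]"]
  by (auto simp: node_of_def case_prod_unfold)

lemma length_discs_with: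
  "length (discs_with l x D) = length (filter (\<lambda>\<nu>. fst \<nu> = l) (nodes Out None D))"
  unfolding discs_with_def discs_of_def map_node_of_discs[symmetric, of _ _ _ "\<lambda>j. concat (rev x) ! j" 0 "[]"]
  by (simp add: filter_map comp_def node_of_def)

text \<open>For one block the root is the only external outgoing letter, so all leaves are incoming.
  This forces nearly everything in the classification below.\<close>

lemma diagrams_single_block:
  assumes "b \<noteq> []"
  shows "D \<in> diagrams [b] \<longleftrightarrow> leaf_pols D = replicate (length b - 1) In \<and>
    (\<forall>(l, w)\<in>set (nodes Out None D). (\<exists>a\<in>set w. fst a = Out))"
  using ball_discs_of[of "[b]" D "\<lambda>l w. (\<exists>a\<in>set w. fst a = Out)"]
  by (simp add: diagrams_def has_type_def type_word_def map_fst_leaves)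

lemma star_diagrams_single_block:
  assumes "b \<noteq> []"
  shows "D \<in> star_diagrams p h [b] \<longleftrightarrow> leaf_pols D = replicate (length b - 1) In \<and>
    length (filter (\<lambda>\<nu>. fst \<nu> = Str) (nodes Out None D)) = 1 \<and>
    length (filter (\<lambda>\<nu>. fst \<nu> = Htp) (nodes Out None D)) = h \<and>
    (\<forall>(l, w)\<in>set (nodes Out None D). (\<exists>a\<in>set w. fst a = Out) \<and>
      (l = Str \<longrightarrow> (\<forall>a\<in>set w. snd a \<noteq> None \<longleftrightarrow> fst a = p)) \<and>
      (l \<noteq> Str \<longrightarrow> (\<forall>a\<in>set w. snd a \<in> {None, Some Str})) \<and> (l = Mor \<longrightarrow> length w \<noteq> 1))"
proof -
  have eq: "(\<forall>(l, w)\<in>set (discs_of [b] D). (l = Str \<longrightarrow> (\<forall>a\<in>set w. mate a \<noteq> None \<longleftrightarrow> pol a = p)) \<and>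
      (l \<noteq> Str \<longrightarrow> (\<forall>a\<in>set w. mate a \<in> {None, Some Str})) \<and> (l = Mor \<longrightarrow> length w \<noteq> 1)) \<longleftrightarrow>
    (\<forall>(l, w)\<in>set (nodes Out None D). (l = Str \<longrightarrow> (\<forall>a\<in>set w. snd a \<noteq> None \<longleftrightarrow> fst a = p)) \<and>
      (l \<noteq> Str \<longrightarrow> (\<forall>a\<in>set w. snd a \<in> {None, Some Str})) \<and> (l = Mor \<longrightarrow> length w \<noteq> 1))"
    using ball_discs_of[of "[b]" D "\<lambda>l w. (l = Str \<longrightarrow> (\<forall>a\<in>set w. snd a \<noteq> None \<longleftrightarrow> fst a = p)) \<and>
      (l \<noteq> Str \<longrightarrow> (\<forall>a\<in>set w. snd a \<in> {None, Some Str})) \<and> (l = Mor \<longrightarrow> length w \<noteq> 1)"] by simp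
  show ?thesis
    unfolding star_diagrams_def mem_Collect_eq diagrams_single_block[OF assms] length_discs_with eq
    by (simp only: case_prod_unfold ball_conj_distrib conj_ac)
qed

lemma nec_diagrams_single_block:
  assumes "b \<noteq> []"
  shows "D \<in> nec_diagrams [b] \<longleftrightarrow> leaf_pols D = replicate (length b - 1) In \<and>
    length (filter (\<lambda>\<nu>. fst \<nu> = Inner) (nodes Out None D)) = 1 \<and>
    length (filter (\<lambda>\<nu>. fst \<nu> = Outer) (nodes Out None D)) = 1 \<and>
    (\<forall>(l, w)\<in>set (nodes Out None D). (\<exists>a\<in>set w. fst a = Out) \<and>
      (\<forall>a\<in>set w. snd a \<noteq> None \<longrightarrow> fst a = (if l = Inner then Out else In)))"
proof -
  have eq: "(\<forall>(l, w)\<in>set (discs_of [b] D). \<forall>a\<in>set w. mate a \<noteq> None \<longrightarrow> pol a = (if l = Inner then Out else In)) \<longleftrightarrow>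
    (\<forall>(l, w)\<in>set (nodes Out None D). \<forall>a\<in>set w. snd a \<noteq> None \<longrightarrow> fst a = (if l = Inner then Out else In))"
    using ball_discs_of[of "[b]" D "\<lambda>l w. \<forall>a\<in>set w. snd a \<noteq> None \<longrightarrow> fst a = (if l = Inner then Out else In)"] by simp
  show ?thesis
    unfolding nec_diagrams_def mem_Collect_eq diagrams_single_block[OF assms] length_discs_with eq
    by (simp only: case_prod_unfold ball_conj_distrib conj_ac)
qed

lemma comp_diagrams_single_block:
  assumes "b \<noteq> []"
  shows "D \<in> comp_diagrams [b] \<longleftrightarrow> leaf_pols D = replicate (length b - 1) In \<and>
    (\<forall>(l, w)\<in>set (nodes Out None D). (\<exists>a\<in>set w. fst a = Out) \<and>
      (l = Inner \<longrightarrow> length w \<noteq> 1 \<and> (\<forall>a\<in>set w. snd a = (if fst a = Out then Some Outer else None))) \<and>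
      (l = Outer \<longrightarrow> (\<forall>a\<in>set w. snd a = (if fst a = In then Some Inner else None))))"
proof -
  have eq: "(\<forall>(l, w)\<in>set (discs_of [b] D). (l = Inner \<longrightarrow> length w \<noteq> 1 \<and> (\<forall>a\<in>set w. mate a = (if pol a = Out then Some Outer else None))) \<and>
      (l = Outer \<longrightarrow> (\<forall>a\<in>set w. mate a = (if pol a = In then Some Inner else None)))) \<longleftrightarrow>
    (\<forall>(l, w)\<in>set (nodes Out None D). (l = Inner \<longrightarrow> length w \<noteq> 1 \<and> (\<forall>a\<in>set w. snd a = (if fst a = Out then Some Outer else None))) \<and>
      (l = Outer \<longrightarrow> (\<forall>a\<in>set w. snd a = (if fst a = In then Some Inner else None))))"
    using ball_discs_of[of "[b]" D "\<lambda>l w. (l = Inner \<longrightarrow> length w \<noteq> 1 \<and> (\<forall>a\<in>set w. snd a = (if fst a = Out then Some Outer else None))) \<and>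
      (l = Outer \<longrightarrow> (\<forall>a\<in>set w. snd a = (if fst a = In then Some Inner else None)))"] by simp
  show ?thesis
    unfolding comp_diagrams_def mem_Collect_eq diagrams_single_block[OF assms] eq
    by (simp only: case_prod_unfold ball_conj_distrib conj_ac)
qed

lemma leaf_pols_slotD:
  assumes "set (leaf_pols (Disc l ss)) \<subseteq> {In}"
  shows "(q, None) \<in> set ss \<Longrightarrow> q = In" and "(q, Some D) \<in> set ss \<Longrightarrow> set (leaf_pols D) \<subseteq> {In}"
  using assms by (force split: option.splits)+

lemma nodes_slot_subset:
  "(q, Some D) \<in> set ss \<Longrightarrow> set (nodes (opp q) (Some l) D) \<subseteq> set (child_nodes l ss)"
  by (force simp: child_nodes_def)

lemma child_nodes_nonempty:
  "\<nu> \<in> set (child_nodes l ss) \<Longrightarrow> \<exists>q D. (q, Some D) \<in> set ss \<and> \<nu> \<in> set (nodes (opp q) (Some l) D)"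
  by (auto simp: child_nodes_def split: option.splits)

lemma root_node_mem: "\<exists>w. (filling D, w) \<in> set (nodes p m D)"
  by (cases D) (auto simp: nodes_Disc)

lemma slots_In_None:
  assumes "\<forall>s\<in>set ss. s = (In, None)"
  shows "ss = replicate (length ss) (In, None)"
  using assms by (simp add: replicate_length_same)

section \<open>Shapes of diagrams with a single external output\<close>

definition corolla :: "'l \<Rightarrow> nat \<Rightarrow> 'l diagram" where
  "corolla l k = Disc l (replicate k (In, None))"

text \<open>The partial composition of two corollas, as in a nonsymmetric operad: \<open>i\<close>
  and \<open>k\<close> count the free inputs on either side of the inner disc. With one external
  output this is the shape of all diagrams of \<open>circ_nec\<close> and
  \<open>multinec_sum\<close>.\<close>

definition grafted :: "'l \<Rightarrow> 'l \<Rightarrow> nat \<Rightarrow> nat \<Rightarrow> nat \<Rightarrow> 'l diagram" where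
  "grafted l l' i j k = Disc l (replicate i (In, None) @ (In, Some (corolla l' j)) # replicate k (In, None))"

text \<open>The shape of the diagrams of \<open>pre_sum\<close> and \<open>fam_comp\<close> with one
  external output. The number of inputs of a child may be 0, as needed for the homotopy.\<close>

definition bush :: "'l \<Rightarrow> ('l \<times> nat) list \<Rightarrow> 'l diagram" where
  "bush l ks = Disc l (map (\<lambda>(l', k). (In, Some (corolla l' k))) ks)"

lemma filling_corolla [simp]: "filling (corolla l k) = l"
  by (simp add: corolla_def)

lemma nodes_corolla [simp]: "nodes p m (corolla l k) = [(l, replicate k (In, None) @ [(p, m)])]"
  by (simp add: corolla_def nodes_Disc)

lemma nodes_grafted: "nodes p m (grafted l l' i j k) =
    [(l, replicate i (In, None) @ (In, Some l') # replicate k (In, None) @ [(p, m)]),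
     (l', replicate j (In, None) @ [(Out, Some l)])]"
  by (simp add: grafted_def nodes_Disc)

lemma nodes_bush: "nodes p m (bush l ks) =
    (l, map (\<lambda>(l', k). (In, Some l')) ks @ [(p, m)])
    # map (\<lambda>(l', k). (l', replicate k (In, None) @ [(Out, Some l)])) ks"
  by (simp add: bush_def nodes_Disc child_nodes_def case_prod_unfold comp_def)

lemma leaf_pols_corolla [simp]: "leaf_pols (corolla l k) = replicate k In"
  by (induction k) (simp_all add: corolla_def)

lemma concat_map_replicate: "concat (map (\<lambda>x. replicate (f x) a) xs) = replicate (sum_list (map f xs)) a"
  by (induction xs) (simp_all add: replicate_add)

lemma leaf_pols_grafted [simp]: "leaf_pols (grafted l l' i j k) = replicate (i + j + k) In"
proof -
  have "concat (replicate n [In]) = replicate n In" for n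
    by (induction n) simp_all
  then show ?thesis
    by (simp add: grafted_def replicate_add)
qed

lemma leaf_pols_bush [simp]: "leaf_pols (bush l ks) = replicate (sum_list (map snd ks)) In"
  using concat_map_replicate[of snd In ks]
  by (simp add: bush_def case_prod_unfold comp_def)

lemma corolla_if_no_child:
  assumes "set (leaf_pols D) \<subseteq> {In}" and "D = Disc l ss" and "child_nodes l ss = []"
  shows "D = corolla l (length ss)"
proof -
  have "s = (In, None)" if "s \<in> set ss" for s
  proof (cases s)
    case (Pair q y)
    show ?thesis
    proof (cases y)
      case None
      then show ?thesis
        using leaf_pols_slotD(1)[of l ss q] assms that Pair by simp
    next
      case (Some D')
      then show ?thesis
        using nodes_slot_subset[of q D' ss l] root_node_mem[of D' "opp q" "Some l"] assms that Pair by auto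
    qed
  qed
  then show ?thesis
    using slots_In_None[of ss] assms by (auto simp: corolla_def)
qed

text \<open>
  A disc whose only possible neighbour is its parent, to which it is not joined by an outgoing letter,
  would have an external outgoing letter besides the root.
\<close>

lemma no_free_output:
  assumes leaves: "set (leaf_pols (Disc l ss)) \<subseteq> {In}"
    and out: "\<exists>a\<in>set (map (\<lambda>(q, y). (q, map_option filling y)) ss @ [(p, m)]). fst a = Out" and "p = In"
  obtains D where "(Out, Some D) \<in> set ss"
    "(Out, Some (filling D)) \<in> set (map (\<lambda>(q, y). (q, map_option filling y)) ss @ [(p, m)])"
proof -
  obtain y where y: "(Out, y) \<in> set ss"
    using out \<open>p = In\<close> by auto
  then obtain D where "y = Some D"
    using leaf_pols_slotD(1)[OF leaves, of Out] by (cases y) auto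
  then show thesis
    using that y by force
qed

text \<open>There are exactly two discs. The one that receives the edge keeps its own outgoing
  letter free, and with one external output it must be the root.\<close>

lemma nec_diagrams_eq:
  assumes "b \<noteq> []"
  shows "nec_diagrams [b] = (\<lambda>(i, j, k). grafted Outer Inner i j k) ` {(i, j, k). i + j + k = length b - 1}"
proof (intro set_eqI iffI)
  fix D assume "D \<in> nec_diagrams [b]"
  note D = this[unfolded nec_diagrams_single_block[OF assms]]
  then have leaves: "set (leaf_pols D) \<subseteq> {In}"
    by auto
  obtain l ss where l: "D = Disc l ss"
    by (cases D)
  let ?w = "map (\<lambda>(q, y). (q, map_option filling y)) ss @ [(Out, None)]"
  have N: "nodes Out None D = (l, ?w) # child_nodes l ss"
    by (simp add: l nodes_Disc)
  have cond: "(\<exists>a\<in>set w. fst a = Out)" "a \<in> set w \<Longrightarrow> snd a \<noteq> None \<Longrightarrow> fst a = (if l' = Inner then Out else In)"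
    if "(l', w) \<in> set (nodes Out None D)" for l' w a
    using D that by blast+
  \<comment> \<open>Each of the two fillings occurs exactly once, so the root has one descendant in
    total.\<close>
  have len: "length (child_nodes l ss) = 1"
  proof -
    have "length (nodes Out None D) = length (filter (\<lambda>\<nu>. fst \<nu> = Inner) (nodes Out None D))
        + length (filter (\<lambda>\<nu>. fst \<nu> \<noteq> Inner) (nodes Out None D))"
      by (metis sum_length_filter_compl)
    also have "(\<lambda>\<nu> :: layer \<times> (pol \<times> layer option) list. fst \<nu> \<noteq> Inner) = (\<lambda>\<nu>. fst \<nu> = Outer)"
      by (metis layer.exhaust layer.distinct(1))
    finally show ?thesis
      using D N by simp
  qed
  then obtain \<nu> where \<nu>: "child_nodes l ss = [\<nu>]"
    by (metis One_nat_def length_0_conv length_Suc_conv)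
  then obtain q D' where qD': "(q, Some D') \<in> set ss"
    using child_nodes_nonempty[of \<nu> l ss] by auto
  obtain xs ys where ss: "ss = xs @ (q, Some D') # ys"
    using qD' by (meson split_list)
  obtain l' ss' where l': "D' = Disc l' ss'"
    by (cases D')
  let ?w' = "map (\<lambda>(q, y). (q, map_option filling y)) ss' @ [(opp q, Some l)]"
  have empty: "child_nodes l xs = []" "child_nodes l ys = []" "child_nodes l' ss' = []" and \<nu>': "\<nu> = (l', ?w')"
    using \<nu> by (auto simp: ss l' nodes_Disc append_eq_Cons_conv)
  have w': "(l', ?w') \<in> set (nodes Out None D)"
    by (simp add: N \<nu> \<nu>')
  have "l' \<noteq> l"
  proof -
    have "nodes Out None D = [(l, ?w), (l', ?w')]"
      by (simp only: N \<nu> \<nu>')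
    then show ?thesis
      using D by (cases l) auto
  qed
  have leaves': "set (leaf_pols D') \<subseteq> {In}"
    using leaf_pols_slotD(2)[OF leaves[unfolded l] qD'] .
  \<comment> \<open>If the root were \<open>Inner\<close>, its neighbour would be entered through an
    incoming letter. Its required outgoing letter could then be neither free nor joined to a third
    disc.\<close>
  have "l = Outer"
  proof (rule ccontr)
    assume "l \<noteq> Outer"
    then have "l = Inner"
      by (cases l) simp_all
    moreover have "(q, Some l') \<in> set ?w"
      using qD' by (force simp: l')
    ultimately have "q = Out"
      using cond(2)[of l ?w "(q, Some l')"] N by auto
    then obtain D'' where "(Out, Some D'') \<in> set ss'"
      using no_free_output[OF leaves'[unfolded l'] cond(1)[OF w']] by auto
    then show False
      using empty(3) nodes_slot_subset[of Out D'' ss' l'] root_node_mem[of D''] by fastforce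
  qed
  then have "l' = Inner"
    using \<open>l' \<noteq> l\<close> by (cases l') simp_all
  have "(q, Some l') \<in> set ?w"
    using qD' by (force simp: l')
  then have "q = In"
    using cond(2)[of l ?w "(q, Some l')"] N \<open>l = Outer\<close> by auto
  have "D' = corolla l' (length ss')"
    by (rule corolla_if_no_child[OF leaves' l' empty(3)])
  moreover have "xs = replicate (length xs) (In, None)" "ys = replicate (length ys) (In, None)"
  proof -
    have "set (leaf_pols (Disc l xs)) \<subseteq> {In}" "set (leaf_pols (Disc l ys)) \<subseteq> {In}"
      using leaves by (auto simp: l ss)
    then show "xs = replicate (length xs) (In, None)" "ys = replicate (length ys) (In, None)"
      using corolla_if_no_child[OF _ refl empty(1)] corolla_if_no_child[OF _ refl empty(2)]
      by (simp_all add: corolla_def)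
  qed
  ultimately have "D = grafted Outer Inner (length xs) (length ss') (length ys)"
    using \<open>q = In\<close> \<open>l = Outer\<close> \<open>l' = Inner\<close> by (simp add: l ss grafted_def)
  moreover from this have "length xs + length ss' + length ys = length b - 1"
    using D by (metis leaf_pols_grafted length_replicate)
  ultimately show "D \<in> (\<lambda>(i, j, k). grafted Outer Inner i j k) ` {(i, j, k). i + j + k = length b - 1}"
    by force
next
  fix D assume "D \<in> (\<lambda>(i, j, k). grafted Outer Inner i j k) ` {(i, j, k). i + j + k = length b - 1}"
  then show "D \<in> nec_diagrams [b]"
    by (auto simp: nec_diagrams_single_block[OF assms] nodes_grafted)
qed

text \<open>All outgoing letters of the structure disc are joined, so it is not the root; the root
  is then a neighbour of the only structure disc. Any further neighbour of the latter would need an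
  external output of its own, so the structure disc is a corolla. The number \<open>h\<close>
  decides how the root is filled.\<close>

lemma star_diagrams_Out_eq:
  assumes "b \<noteq> []" and "h = (if l0 = Htp then 1 else 0)" and "l0 \<noteq> Str"
  shows "star_diagrams Out h [b] = (\<lambda>(i, j, k). grafted l0 Str i j k) ` {(i, j, k). i + j + k = length b - 1}"
proof (intro set_eqI iffI)
  fix D assume "D \<in> star_diagrams Out h [b]"
  note D = this[unfolded star_diagrams_single_block[OF assms(1)]]
  then have leaves: "set (leaf_pols D) \<subseteq> {In}"
    by auto
  obtain l ss where l: "D = Disc l ss"
    by (cases D)
  let ?w = "map (\<lambda>(q, y). (q, map_option filling y)) ss @ [(Out, None)]"
  have N: "nodes Out None D = (l, ?w) # child_nodes l ss"
    by (simp add: l nodes_Disc)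
  have cond: "(\<exists>a\<in>set w. fst a = Out)" "l' = Str \<Longrightarrow> a \<in> set w \<Longrightarrow> snd a \<noteq> None \<longleftrightarrow> fst a = Out"
      "l' \<noteq> Str \<Longrightarrow> a \<in> set w \<Longrightarrow> snd a = None \<or> snd a = Some Str"
    if "(l', w) \<in> set (nodes Out None D)" for l' w a
    using D[THEN conjunct2, THEN conjunct2, THEN conjunct2, THEN bspec, OF that] by auto
  have "l \<noteq> Str"
    using cond(2)[of l ?w "(Out, None)"] by (auto simp: N)
  then have Str1: "length (filter (\<lambda>\<nu>. fst \<nu> = Str) (child_nodes l ss)) = 1"
    using D N by simp
  then obtain \<nu> where \<nu>: "\<nu> \<in> set (child_nodes l ss)"
    by (cases "child_nodes l ss") auto
  then obtain q D' where qD': "(q, Some D') \<in> set ss"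
    using child_nodes_nonempty[of \<nu> l ss] by auto
  obtain xs ys where ss: "ss = xs @ (q, Some D') # ys"
    using qD' by (meson split_list)
  have child_Str: "filling D'' = Str" if "(q', Some D'') \<in> set ss" for q' D''
  proof -
    have "(q', Some (filling D'')) \<in> set ?w"
      using that by force
    then show ?thesis
      using cond(3)[of l ?w "(q', Some (filling D''))"] N \<open>l \<noteq> Str\<close> by auto
  qed
  then obtain ss' where l': "D' = Disc Str ss'"
    using qD' by (metis diagram.exhaust_sel)
  let ?w' = "map (\<lambda>(q, y). (q, map_option filling y)) ss' @ [(opp q, Some l)]"
  have C: "child_nodes l ss = child_nodes l xs @ ((Str, ?w') # child_nodes Str ss') @ child_nodes l ys"
    by (simp add: ss l' nodes_Disc)
  have no_Str: "fst \<nu> \<noteq> Str" if "\<nu> \<in> set (child_nodes l xs) \<union> set (child_nodes Str ss') \<union> set (child_nodes l ys)" for \<nu>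
    using Str1 that by (auto simp: C filter_empty_conv)
  \<comment> \<open>All children of the root are filled with \<open>Str\<close>, and the only such
    disc has already been found.\<close>
  have empty: "child_nodes l zs = []" if "set zs \<subseteq> set ss" "\<And>\<nu>. \<nu> \<in> set (child_nodes l zs) \<Longrightarrow> fst \<nu> \<noteq> Str" for zs
  proof (rule ccontr)
    assume "child_nodes l zs \<noteq> []"
    then obtain q' D'' where D'': "(q', Some D'') \<in> set zs"
      using child_nodes_nonempty by (metis list.set_intros(1) neq_Nil_conv)
    obtain w where "(filling D'', w) \<in> set (child_nodes l zs)"
      using root_node_mem[of D'' "opp q'" "Some l"] nodes_slot_subset[OF D'', of l] by blast
    moreover have "filling D'' = Str"
      using D'' that(1) child_Str by blast
    ultimately show False
      using that(2)[of "(Str, w)"] by simp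
  qed
  have leaves': "set (leaf_pols D') \<subseteq> {In}"
    using leaf_pols_slotD(2)[OF leaves[unfolded l] qD'] .
  have w': "(Str, ?w') \<in> set (nodes Out None D)"
    by (simp add: N C)
  have "opp q = Out"
    using cond(2)[OF w', of "(opp q, Some l)"] by simp
  then have "q = In"
    by (cases q) simp_all
  \<comment> \<open>Such a child would be entered through an incoming letter; its outgoing letter,
    which cannot be free, would lead to a second structure disc.\<close>
  have "child_nodes Str ss' = []"
  proof (rule ccontr)
    assume "child_nodes Str ss' \<noteq> []"
    then obtain q' D'' where D'': "(q', Some D'') \<in> set ss'"
      using child_nodes_nonempty by (metis list.set_intros(1) neq_Nil_conv)
    obtain l'' ss'' where l'': "D'' = Disc l'' ss''"
      by (cases D'')
    let ?w'' = "map (\<lambda>(q, y). (q, map_option filling y)) ss'' @ [(opp q', Some Str)]"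
    have sub: "set (nodes (opp q') (Some Str) D'') \<subseteq> set (child_nodes Str ss')"
      by (rule nodes_slot_subset[OF D''])
    then have w'': "(l'', ?w'') \<in> set (nodes Out None D)" "l'' \<noteq> Str"
      using no_Str[of "(l'', ?w'')"] by (auto simp: N C l'' nodes_Disc)
    have "(q', Some (filling D'')) \<in> set ?w'"
      using D'' by force
    then have "q' = Out"
      using cond(2)[OF w', of "(q', Some (filling D''))"] by simp
    then obtain D3 where D3: "(Out, Some D3) \<in> set ss''" "(Out, Some (filling D3)) \<in> set ?w''"
      using no_free_output[OF leaf_pols_slotD(2)[OF leaves'[unfolded l'] D'', unfolded l''] cond(1)[OF w''(1)]] by auto
    then have "filling D3 = Str"
      using cond(3)[OF w''(1,2) D3(2)] by simp
    moreover obtain w3 where "(filling D3, w3) \<in> set (child_nodes l'' ss'')"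
      using root_node_mem[of D3] nodes_slot_subset[OF D3(1), of l''] by blast
    then have "(filling D3, w3) \<in> set (child_nodes Str ss')"
      using sub by (auto simp: l'' nodes_Disc)
    ultimately show False
      using no_Str[of "(Str, w3)"] by simp
  qed
  from corolla_if_no_child[OF leaves' l' this] have "D' = corolla Str (length ss')" .
  moreover have "xs = replicate (length xs) (In, None)" "ys = replicate (length ys) (In, None)"
  proof -
    have "set (leaf_pols (Disc l xs)) \<subseteq> {In}" "set (leaf_pols (Disc l ys)) \<subseteq> {In}"
      using leaves by (auto simp: l ss)
    moreover have "child_nodes l xs = []"
      by (rule empty) (simp add: ss subset_iff, rule no_Str, simp)
    moreover have "child_nodes l ys = []"
      by (rule empty) (simp add: ss subset_iff, rule no_Str, simp)
    ultimately show "xs = replicate (length xs) (In, None)" "ys = replicate (length ys) (In, None)"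
      using corolla_if_no_child[OF _ refl, of l xs] corolla_if_no_child[OF _ refl, of l ys]
      by (simp_all add: corolla_def)
  qed
  ultimately have D_eq: "D = grafted l Str (length xs) (length ss') (length ys)"
    using \<open>q = In\<close> by (simp add: l ss grafted_def)
  \<comment> \<open>The root is the only disc that can carry the homotopy, so the prescribed count
    determines its filling.\<close>
  have cnt: "length (filter (\<lambda>\<nu>. fst \<nu> = Htp) (nodes Out None D)) = (if l = Htp then 1 else 0)"
    unfolding D_eq by (simp add: nodes_grafted)
  have "h = (if l = Htp then 1 else 0)"
    using D[THEN conjunct2, THEN conjunct2, THEN conjunct1] unfolding cnt by (rule sym)
  then have "l = Htp \<longleftrightarrow> l0 = Htp"
    unfolding assms(2) by (cases "l = Htp"; cases "l0 = Htp") simp_all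
  then have "l = l0"
    using \<open>l \<noteq> Str\<close> assms(3) role.exhaust[of l] role.exhaust[of l0] by metis
  moreover have "length xs + length ss' + length ys = length b - 1"
    using D D_eq by (metis leaf_pols_grafted length_replicate)
  ultimately show "D \<in> (\<lambda>(i, j, k). grafted l0 Str i j k) ` {(i, j, k). i + j + k = length b - 1}"
    using D_eq by force
next
  fix D assume "D \<in> (\<lambda>(i, j, k). grafted l0 Str i j k) ` {(i, j, k). i + j + k = length b - 1}"
  then show "D \<in> star_diagrams Out h [b]"
    using assms(2,3) unfolding star_diagrams_single_block[OF assms(1)]
    by (auto simp: nodes_grafted)
qed

text \<open>The outgoing letters of the structure disc are free, so it is the root, and its
  neighbours are corollas because they may be joined to \<open>Str\<close> only. A morphism disc
  must have an input, a homotopy disc need not.\<close>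

lemma star_diagrams_In_eq:
  assumes "b \<noteq> []"
  shows "star_diagrams In h [b] = bush Str ` {ks. sum_list (map snd ks) = length b - 1 \<and>
    length (filter (\<lambda>x. fst x = Htp) ks) = h \<and> (\<forall>x\<in>set ks. fst x = Htp \<or> fst x = Mor \<and> 0 < snd x)}"
proof (intro set_eqI iffI)
  fix D assume "D \<in> star_diagrams In h [b]"
  note D = this[unfolded star_diagrams_single_block[OF assms(1)]]
  then have leaves: "set (leaf_pols D) \<subseteq> {In}"
    by auto
  obtain l ss where l: "D = Disc l ss"
    by (cases D)
  let ?w = "map (\<lambda>(q, y). (q, map_option filling y)) ss @ [(Out, None)]"
  have N: "nodes Out None D = (l, ?w) # child_nodes l ss"
    by (simp add: l nodes_Disc)
  have cond: "(\<exists>a\<in>set w. fst a = Out)" "l' = Str \<Longrightarrow> a \<in> set w \<Longrightarrow> snd a \<noteq> None \<longleftrightarrow> fst a = In"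
      "l' \<noteq> Str \<Longrightarrow> a \<in> set w \<Longrightarrow> snd a = None \<or> snd a = Some Str" "l' = Mor \<Longrightarrow> length w \<noteq> 1"
    if "(l', w) \<in> set (nodes Out None D)" for l' w a
    using D[THEN conjunct2, THEN conjunct2, THEN conjunct2, THEN bspec, OF that] by auto
  \<comment> \<open>Otherwise the structure disc would be joined to its parent by an incoming
    letter, while its own outgoing letter would be external and not the root.\<close>
  have "l = Str"
  proof (rule ccontr)
    assume "l \<noteq> Str"
    then have "length (filter (\<lambda>\<nu>. fst \<nu> = Str) (child_nodes l ss)) = 1"
      using D N by simp
    then obtain \<nu> where \<nu>: "\<nu> \<in> set (child_nodes l ss)"
      by (cases "child_nodes l ss") auto
    then obtain q D' where qD': "(q, Some D') \<in> set ss"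
      using child_nodes_nonempty[of \<nu> l ss] by auto
    then have "(q, Some (filling D')) \<in> set ?w"
      by force
    then have "filling D' = Str"
      using cond(3)[of l ?w "(q, Some (filling D'))"] N \<open>l \<noteq> Str\<close> by auto
    then obtain ss' where l': "D' = Disc Str ss'"
      by (metis diagram.exhaust_sel)
    let ?w' = "map (\<lambda>(q, y). (q, map_option filling y)) ss' @ [(opp q, Some l)]"
    have w': "(Str, ?w') \<in> set (nodes Out None D)"
      using nodes_slot_subset[OF qD', of l] by (simp add: N l' nodes_Disc)
    have "opp q = In"
      using cond(2)[OF w', of "(opp q, Some l)"] by simp
    then obtain D'' where "(Out, Some (filling D'')) \<in> set ?w'"
      using no_free_output[OF leaf_pols_slotD(2)[OF leaves[unfolded l] qD', unfolded l'] cond(1)[OF w']] by blast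
    then show False
      using cond(2)[OF w', of "(Out, Some (filling D''))"] by simp
  qed
  have no_Str: "fst \<nu> \<noteq> Str" if "\<nu> \<in> set (child_nodes l ss)" for \<nu>
    using D N \<open>l = Str\<close> that by (auto simp: filter_empty_conv)
  have "\<exists>l' k. s = (In, Some (corolla l' k)) \<and> (l' = Htp \<or> l' = Mor \<and> 0 < k)" if s: "s \<in> set ss" for s
  proof -
    obtain q y where qy: "s = (q, y)"
      by (cases s)
    have "(q, map_option filling y) \<in> set ?w"
      using s qy by force
    then have iff: "y \<noteq> None \<longleftrightarrow> q = In"
      using cond(2)[of l ?w "(q, map_option filling y)"] N \<open>l = Str\<close> by auto
    have "q = In"
      using iff leaf_pols_slotD(1)[OF leaves[unfolded l], of q] s qy by auto
    then obtain D' where D': "y = Some D'"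
      using iff by auto
    obtain l' ss' where l': "D' = Disc l' ss'"
      by (cases D')
    let ?w' = "map (\<lambda>(q, y). (q, map_option filling y)) ss' @ [(opp q, Some l)]"
    have sub: "set (nodes (opp q) (Some l) D') \<subseteq> set (child_nodes l ss)"
      using nodes_slot_subset[of q D' ss l] s qy D' by simp
    then have w': "(l', ?w') \<in> set (nodes Out None D)" "l' \<noteq> Str"
      using no_Str[of "(l', ?w')"] by (auto simp: N l' nodes_Disc)
    have leaves': "set (leaf_pols D') \<subseteq> {In}"
      using leaf_pols_slotD(2)[OF leaves[unfolded l]] s qy D' by blast
    \<comment> \<open>A grandchild would have to be a second structure disc.\<close>
    have "child_nodes l' ss' = []"
    proof (rule ccontr)
      assume "child_nodes l' ss' \<noteq> []"
      then obtain q' D'' where D'': "(q', Some D'') \<in> set ss'"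
        using child_nodes_nonempty by (metis list.set_intros(1) neq_Nil_conv)
      then have "(q', Some (filling D'')) \<in> set ?w'"
        by force
      then have "filling D'' = Str"
        using cond(3)[OF w', of "(q', Some (filling D''))"] by simp
      moreover obtain w'' where "(filling D'', w'') \<in> set (child_nodes l' ss')"
        using root_node_mem[of D''] nodes_slot_subset[OF D'', of l'] by blast
      then have "(filling D'', w'') \<in> set (child_nodes l ss)"
        using sub by (auto simp: l' nodes_Disc)
      ultimately show False
        using no_Str[of "(Str, w'')"] by simp
    qed
    from corolla_if_no_child[OF leaves' l' this] have "D' = corolla l' (length ss')" .
    moreover have "l' = Htp \<or> l' = Mor \<and> 0 < length ss'"
      using w'(2) cond(4)[OF w'(1)] by (cases l') auto
    ultimately show ?thesis
      using \<open>q = In\<close> qy D' by blast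
  qed
  then have "\<forall>s\<in>set ss. \<exists>x. (\<lambda>(l', k). (In, Some (corolla l' k))) x = s \<and> (fst x = Htp \<or> fst x = Mor \<and> 0 < snd x)"
    by fastforce
  then obtain f where f: "\<And>s. s \<in> set ss \<Longrightarrow> (\<lambda>(l', k). (In, Some (corolla l' k))) (f s) = s \<and> (fst (f s) = Htp \<or> fst (f s) = Mor \<and> 0 < snd (f s))"
    by metis
  define ks where "ks = map f ss"
  have "map (\<lambda>(l', k). (In, Some (corolla l' k))) ks = ss"
    unfolding ks_def map_map using f by (intro map_idI) simp
  then have D_eq: "D = bush Str ks"
    using \<open>l = Str\<close> by (simp add: bush_def l)
  have "sum_list (map snd ks) = length b - 1"
    using D D_eq by (metis leaf_pols_bush length_replicate)
  moreover have "length (filter (\<lambda>x. fst x = Htp) ks) = h"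
    using D by (auto simp: D_eq nodes_bush filter_map comp_def case_prod_unfold)
  moreover have "\<forall>x\<in>set ks. fst x = Htp \<or> fst x = Mor \<and> 0 < snd x"
    using f by (auto simp: ks_def)
  ultimately show "D \<in> bush Str ` {ks. sum_list (map snd ks) = length b - 1 \<and>
    length (filter (\<lambda>x. fst x = Htp) ks) = h \<and> (\<forall>x\<in>set ks. fst x = Htp \<or> fst x = Mor \<and> 0 < snd x)}"
    using D_eq by blast
next
  fix D assume "D \<in> bush Str ` {ks. sum_list (map snd ks) = length b - 1 \<and>
    length (filter (\<lambda>x. fst x = Htp) ks) = h \<and> (\<forall>x\<in>set ks. fst x = Htp \<or> fst x = Mor \<and> 0 < snd x)}"
  then obtain ks where ks: "D = bush Str ks" "sum_list (map snd ks) = length b - 1"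
    "length (filter (\<lambda>x. fst x = Htp) ks) = h" "\<forall>x\<in>set ks. fst x = Htp \<or> fst x = Mor \<and> 0 < snd x"
    by auto
  have K: "l' = Htp \<or> l' = Mor \<and> 0 < k" if "(l', k) \<in> set ks" for l' k
    using ks(4) that by force
  have e: "filter (\<lambda>x. fst x = Str) ks = []"
    using ks(4) by (force simp: filter_empty_conv)
  have leaves: "leaf_pols D = replicate (length b - 1) In"
    using ks(1,2) by simp
  let ?node = "\<lambda>(l', k). (l', replicate k (In, None) @ [(Out, Some Str)])"
  have N: "nodes Out None D = (Str, map (\<lambda>(l', k). (In, Some l')) ks @ [(Out, None)]) # map ?node ks"
    by (simp add: ks nodes_bush)
  have cnt: "length (filter (\<lambda>\<nu>. fst \<nu> = r) (map ?node ks)) = length (filter (\<lambda>x. fst x = r) ks)" for r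
    by (simp add: filter_map comp_def case_prod_unfold)
  have "\<forall>(l, w)\<in>set (nodes Out None D). (\<exists>a\<in>set w. fst a = Out) \<and>
      (l = Str \<longrightarrow> (\<forall>a\<in>set w. snd a \<noteq> None \<longleftrightarrow> fst a = In)) \<and>
      (l \<noteq> Str \<longrightarrow> (\<forall>a\<in>set w. snd a \<in> {None, Some Str})) \<and> (l = Mor \<longrightarrow> length w \<noteq> 1)"
    unfolding N by (auto dest!: K)
  then show "D \<in> star_diagrams In h [b]"
    unfolding star_diagrams_single_block[OF assms] using leaves ks(3) cnt[of Str] cnt[of Htp] e by (simp add: N)
qed

text \<open>The external output belongs to an outer disc, which is therefore the root. An inner disc
  with a second output would lead to another outer disc and hence to a second external
  output.\<close>

lemma comp_diagrams_eq:
  assumes "b \<noteq> []"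
  shows "comp_diagrams [b] = bush Outer ` {ks. sum_list (map snd ks) = length b - 1 \<and>
    (\<forall>x\<in>set ks. fst x = Inner \<and> 0 < snd x)}"
proof (intro set_eqI iffI)
  fix D assume "D \<in> comp_diagrams [b]"
  note D = this[unfolded comp_diagrams_single_block[OF assms(1)]]
  then have leaves: "set (leaf_pols D) \<subseteq> {In}"
    by auto
  obtain l ss where l: "D = Disc l ss"
    by (cases D)
  let ?w = "map (\<lambda>(q, y). (q, map_option filling y)) ss @ [(Out, None)]"
  have N: "nodes Out None D = (l, ?w) # child_nodes l ss"
    by (simp add: l nodes_Disc)
  have cond: "(\<exists>a\<in>set w. fst a = Out)" "l' = Inner \<Longrightarrow> length w \<noteq> 1"
      "l' = Inner \<Longrightarrow> a \<in> set w \<Longrightarrow> snd a = (if fst a = Out then Some Outer else None)"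
      "l' = Outer \<Longrightarrow> a \<in> set w \<Longrightarrow> snd a = (if fst a = In then Some Inner else None)"
    if "(l', w) \<in> set (nodes Out None D)" for l' w a
    using D that by blast+
  have "l = Outer"
    using cond(3)[of l ?w "(Out, None)"] N by (cases l) auto
  have "\<exists>k. s = (In, Some (corolla Inner k)) \<and> 0 < k" if s: "s \<in> set ss" for s
  proof -
    obtain q y where qy: "s = (q, y)"
      by (cases s)
    have "(q, map_option filling y) \<in> set ?w"
      using s qy by force
    then have y: "map_option filling y = (if q = In then Some Inner else None)"
      using cond(4)[of l ?w "(q, map_option filling y)"] N \<open>l = Outer\<close> by auto
    have "q = In"
      using y leaf_pols_slotD(1)[OF leaves[unfolded l], of q] s qy by (auto split: if_splits)
    then obtain D' where D': "y = Some D'" "filling D' = Inner"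
      using y by auto
    obtain ss' where l': "D' = Disc Inner ss'"
      using D'(2) by (metis diagram.exhaust_sel)
    let ?w' = "map (\<lambda>(q, y). (q, map_option filling y)) ss' @ [(opp q, Some l)]"
    have sub: "set (nodes (opp q) (Some l) D') \<subseteq> set (nodes Out None D)"
      using nodes_slot_subset[of q D' ss l] s qy D' N by auto
    then have w': "(Inner, ?w') \<in> set (nodes Out None D)"
      by (auto simp: l' nodes_Disc)
    have leaves': "set (leaf_pols D') \<subseteq> {In}"
      using leaf_pols_slotD(2)[OF leaves[unfolded l]] s qy D' by blast
    have "child_nodes Inner ss' = []"
    proof (rule ccontr)
      assume "child_nodes Inner ss' \<noteq> []"
      then obtain q' D'' where D'': "(q', Some D'') \<in> set ss'"
        using child_nodes_nonempty by (metis list.set_intros(1) neq_Nil_conv)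
      then have "(q', Some (filling D'')) \<in> set ?w'"
        by force
      from cond(3)[OF w' refl this] have "q' = Out" "filling D'' = Outer"
        by (simp_all split: if_splits)
      then obtain ss'' where l'': "D'' = Disc Outer ss''"
        by (metis diagram.exhaust_sel)
      let ?w'' = "map (\<lambda>(q, y). (q, map_option filling y)) ss'' @ [(opp q', Some Inner)]"
      have w'': "(Outer, ?w'') \<in> set (nodes Out None D)"
        using sub nodes_slot_subset[OF D'', of Inner] by (auto simp: l' l'' nodes_Disc)
      obtain D3 where "(Out, Some (filling D3)) \<in> set ?w''"
        using no_free_output[OF leaf_pols_slotD(2)[OF leaves'[unfolded l'] D'', unfolded l''] cond(1)[OF w'']]
          \<open>q' = Out\<close> opp.simps(2) by blast
      from cond(4)[OF w'' refl this] show False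
        by simp
    qed
    from corolla_if_no_child[OF leaves' l' this] have "D' = corolla Inner (length ss')" .
    moreover have "0 < length ss'"
      using cond(2)[OF w'] by auto
    ultimately show ?thesis
      using \<open>q = In\<close> qy D' by blast
  qed
  then obtain f where f: "\<And>s. s \<in> set ss \<Longrightarrow> s = (In, Some (corolla Inner (f s))) \<and> 0 < f s"
    by metis
  define ks where "ks = map (\<lambda>s. (Inner, f s)) ss"
  have "map (\<lambda>(l', k). (In, Some (corolla l' k))) ks = ss"
    unfolding ks_def map_map using f by (intro map_idI) force
  then have D_eq: "D = bush Outer ks"
    using \<open>l = Outer\<close> by (simp add: bush_def l)
  have "sum_list (map snd ks) = length b - 1"
    using D D_eq by (metis leaf_pols_bush length_replicate)
  moreover have "\<forall>x\<in>set ks. fst x = Inner \<and> 0 < snd x"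
    using f by (auto simp: ks_def)
  ultimately show "D \<in> bush Outer ` {ks. sum_list (map snd ks) = length b - 1 \<and> (\<forall>x\<in>set ks. fst x = Inner \<and> 0 < snd x)}"
    using D_eq by blast
next
  fix D assume "D \<in> bush Outer ` {ks. sum_list (map snd ks) = length b - 1 \<and> (\<forall>x\<in>set ks. fst x = Inner \<and> 0 < snd x)}"
  then obtain ks where ks: "D = bush Outer ks" "sum_list (map snd ks) = length b - 1"
    "\<forall>x\<in>set ks. fst x = Inner \<and> 0 < snd x"
    by auto
  have K: "l' = Inner \<and> 0 < k" if "(l', k) \<in> set ks" for l' k
    using ks(3) that by force
  have "\<forall>(l, w)\<in>set (nodes Out None D). (\<exists>a\<in>set w. fst a = Out) \<and>
      (l = Inner \<longrightarrow> length w \<noteq> 1 \<and> (\<forall>a\<in>set w. snd a = (if fst a = Out then Some Outer else None))) \<and>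
      (l = Outer \<longrightarrow> (\<forall>a\<in>set w. snd a = (if fst a = In then Some Inner else None)))"
    unfolding ks(1) nodes_bush by (auto dest!: K)
  then show "D \<in> comp_diagrams [b]"
    unfolding comp_diagrams_single_block[OF assms] using ks(1,2) by simp
qed

section \<open>Values of diagrams with one output\<close>

text \<open>The effect of \<open>pull\<close> on a word, separated from its sign in
  \<open>bring_sign\<close>, so that words can be computed without knowing the degrees.\<close>

fun pull_word :: "nat list \<Rightarrow> (nat list \<times> 'v hvec) list \<Rightarrow> (nat list \<times> 'v hvec) list" where
  "pull_word n w = hd (dropWhile (\<lambda>z. fst z \<noteq> n) w) # takeWhile (\<lambda>z. fst z \<noteq> n) w @ tl (dropWhile (\<lambda>z. fst z \<noteq> n) w)"

fun bring_sign :: "nat list list \<Rightarrow> (nat list \<times> 'v hvec) list \<Rightarrow> 'k::field" where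
  "bring_sign [] w = 1"
| "bring_sign (n # ns) w = bring_sign ns w * (let w' = foldr pull_word ns w in
     ksign (fst (snd (hd (dropWhile (\<lambda>z. fst z \<noteq> n) w')))) (tdeg (map snd (takeWhile (\<lambda>z. fst z \<noteq> n) w'))))"

lemma bring_single: "bring ns (Poly_Mapping.single w 1) = Poly_Mapping.single (foldr pull_word ns w) (bring_sign ns w)"
proof (induction ns)
  case (Cons n ns)
  have "pull n (Poly_Mapping.single w c) = Poly_Mapping.single (pull_word n w)
      (c * ksign (fst (snd (hd (dropWhile (\<lambda>z. fst z \<noteq> n) w)))) (tdeg (map snd (takeWhile (\<lambda>z. fst z \<noteq> n) w))))"
    for w :: "(nat list \<times> 'v hvec) list" and c :: "'k::field"
    by (simp add: pull_single Let_def)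
  with Cons show ?case
    by (simp add: bring_def Let_def del: pull_word.simps)
qed (simp add: bring_def)

lemma ksign_cancel [simp]: "ksign i j * ksign j i = 1" "ksign i j * (ksign j i * c) = c"
  by (simp_all add: ksign_def mult.commute)

text \<open>The triples are those with sum at most 2, listed explicitly so that the paths can be
  computed.\<close>

lemma joint_grafted:
  assumes "(i, j, k) \<in> {(0, 0, 0), (0, 1, 0), (1, 0, 0), (0, 0, 1), (0, 2, 0), (1, 1, 0), (0, 1, 1), (2, 0, 0), (1, 0, 1), (0, 0, 2)}"
  shows "joint (discs_of x (grafted l l' i j k) ! 0) = [i]" "joint (discs_of x (grafted l l' i j k) ! 1) = [i]"
    "root_edge (discs_of x (grafted l l' i j k) ! 1) = [i]"
  using assms
  by (auto simp: grafted_def corolla_def discs_of_def joint_def root_edge_def numeral_2_eq_2)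

lemma discs_of_grafted:
  obtains w w' where "discs_of x (grafted l l' i j k) = [(l, w), (l', w')]"
proof -
  have "map node_of (discs_of x (grafted l l' i j k)) = nodes Out None (grafted l l' i j k)"
    unfolding discs_of_def by (rule map_node_of_discs)
  then obtain \<delta> \<delta>' where "discs_of x (grafted l l' i j k) = [\<delta>, \<delta>']" "fst \<delta> = l" "fst \<delta>' = l'"
    by (auto simp: nodes_grafted map_eq_Cons_conv node_of_def)
  then show thesis
    using that by (cases \<delta>; cases \<delta>') auto
qed

text \<open>Inner disc, edge, root disc: for trees with two discs the orders of factors prescribed
  by \<open>circ_nec\<close>, \<open>multinec_sum\<close>, \<open>pre_sum\<close> and
  \<open>fam_comp\<close> coincide.\<close>

definition grafted_value :: "('l \<Rightarrow> ('o, 'v, 'k) family) \<Rightarrow> int \<Rightarrow> 'o list \<Rightarrow> 'l \<Rightarrow> 'l \<Rightarrow> nat \<Rightarrow> nat \<Rightarrow> nat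
    \<Rightarrow> 'v hvec list \<Rightarrow> ('v hvec list \<Rightarrow>\<^sub>0 'k::field)" where
  "grafted_value fill d b l l' i j k vs = (let D = grafted l l' i j k in eval_diagram [b] D
     [act_disc fill (discs_of [b] D ! 1), act_edge d [i], act_disc fill (discs_of [b] D ! 0)] vs)"

context vector_space
begin

lemma graded_subspaces_component:
  assumes "graded_subspaces scale X W" "x \<in> X" "y \<in> X"
  shows "subspace (W x y i)"
  using assms unfolding graded_subspaces_def by blast

lemma linear_on_scale:
  assumes "linear_on scale V h"
  shows "linear_on scale V (\<lambda>u. scale s (h u))"
  using assms unfolding linear_on_def by (simp add: scale_right_distrib mult.commute)

lemma component_zero_slot:
  assumes "block_family scale d X V W n F" "b \<noteq> []" "set b \<subseteq> X" and "block_inputs V b (us @ (i, 0) # ws)"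
  shows "component scale F b (us @ (i, 0) # ws) = 0"
proof -
  have "linear_on scale {0} (\<lambda>u. component scale F b (us @ (i, u) # ws))"
    using assms by (intro block_family_linear_on[OF assms(1-3)]) simp
  from linear_onD[OF this, of 0 0 1] show ?thesis
    by simp
qed

text \<open>Whatever depends on the shape of the tree is a hypothesis that simplification can
  discharge: the words \<open>z\<close>, \<open>z1\<close>, \<open>z0\<close> before and after
  rearranging wires, and the signs \<open>s1\<close>, \<open>s0\<close>. The vector on the edge
  stays a variable \<open>u\<close> of degree \<open>e\<close>, and linearity in \<open>u\<close>
  inserts the value of the inner disc.\<close>

lemma value_two_discs:
  assumes D: "discs_of [b] (grafted l0 l1 i j k) = [(l0, w0), (l1, w1)]"
    and bd: "word_outs (boundary [b] (grafted l0 l1 i j k)) = [[]]" "zip (word_ins (boundary [b] (grafted l0 l1 i j k))) vs = z"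
    and w1: "word_ins (normalize w1) = ns1" "foldr pull_word ns1 z = z1"
      "word_outs (normalize w1) = [[i]]" "word_type (normalize w1) = [b1]"
    and F: "block_family scale d X V W n (fill l1)" and b1: "b1 \<noteq> []" "set b1 \<subseteq> X"
    and vs1: "map snd (take (length ns1) z1) = vs1" "block_inputs V b1 vs1"
    and w0: "word_ins (normalize w0) = ns0"
      "\<And>u. foldr pull_word ns0 (([i], (e, u)) # drop (length ns1) z1) = z0 u"
      "\<And>u. bring_sign ns0 (([i], (e, u)) # drop (length ns1) z1) = s0" "bring_sign ns1 z = s1"
      "\<And>u. length ns0 = length (z0 u)" "\<And>u. map snd (z0 u) = us @ (e, u) # ws"
      "word_outs (normalize w0) = [[]]" "word_type (normalize w0) = [b0]"
    and G: "block_family scale d X V' U m (fill l0)" and b0: "b0 \<noteq> []" "set b0 \<subseteq> X"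
    and ins0: "\<And>u. u \<in> W (hd b1) (last b1) (e + 1) \<Longrightarrow> block_inputs V' b0 (us @ (e, u) # ws)"
    and W: "graded_subspaces scale X W" and U: "graded_subspaces scale X U"
    and e: "e = tdeg vs1 + n"
  shows "tensor1 scale (grafted_value fill d b l0 l1 i j k vs)
    = scale (s1 * s0) (component scale (fill l0) b0 (us @ (e, component scale (fill l1) b1 vs1) # ws))"
proof -
  let ?h = "\<lambda>u. scale s0 (component scale (fill l0) b0 (us @ (e, u) # ws))"
  let ?\<phi> = "\<lambda>p. root_value scale (act_disc fill (l0, w0) p)"
  have h: "linear_on scale (W (hd b1) (last b1) (e + 1)) ?h"
    by (rule linear_on_scale[OF block_family_linear_on[OF G b0 ins0]])
  have root: "?\<phi> (Poly_Mapping.single (([i], (e, u)) # drop (length ns1) z1) 1) = ?h u"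
    if "u \<in> W (hd b1) (last b1) (e + 1)" for u
  proof -
    have "bring ns0 (Poly_Mapping.single (([i], (e, u)) # drop (length ns1) z1) 1) = Poly_Mapping.single (z0 u) s0"
      unfolding bring_single w0(2,3) ..
    from act_root_step[where \<delta> = "(l0, w0)" and fill = fill, unfolded snd_conv fst_conv,
        OF w0(1) this w0(5,7,8) refl G b0 w0(6) ins0[OF that] U] show ?thesis .
  qed
  have brg: "bring ns1 (Poly_Mapping.single z 1) = Poly_Mapping.single z1 s1"
    unfolding bring_single w1(2) w0(4) ..
  have h': "linear_on scale (W (hd b1) (last b1) (tdeg vs1 + n + 1)) ?h"
    using h by (simp only: e)
  have root': "?\<phi> (Poly_Mapping.single (([i], (tdeg vs1 + n, u)) # drop (length ns1) z1) 1) = ?h u"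
    if "u \<in> W (hd b1) (last b1) (tdeg vs1 + n + 1)" for u
    using root[of u] that by (simp only: e)
  from act_disc_edge_step[where \<phi> = ?\<phi> and \<delta> = "(l1, w1)" and fill = fill and h = ?h, unfolded snd_conv fst_conv,
        OF linear_compose_smul[OF linear_root_value linear_act_disc[of fill "(l0, w0)"]] w1(1) brg refl w1(3,4) refl F b1 vs1 W h' root']
  have "?\<phi> (act_edge d [i] (act_disc fill (l1, w1) (Poly_Mapping.single z 1)))
      = scale s1 (?h (component scale (fill l1) b1 vs1))" .
  then show ?thesis
    by (simp add: grafted_value_def D tensor1_eval_diagram[OF bd(1)] bd(2))
qed

section \<open>Values of the two-disc trees with at most two inputs\<close>

lemma value_grafted_000:
  assumes F: "block_family scale d X V W n (fill l')" and G: "block_family scale d X W U m (fill l)"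
    and W: "graded_subspaces scale X W" and U: "graded_subspaces scale X U"
    and X: "x \<in> X"
  shows "tensor1 scale (grafted_value fill d [x] l l' 0 0 0 [])
    = component scale (fill l) [x, x] [(n, component scale (fill l') [x] [])]"
proof -
  have D: "discs_of [[x]] (grafted l l' 0 0 0) = [(l, [Letter In [0] (Some l') x, Letter Out [] None x]),
      (l', [Letter Out [0] (Some l) x])]"
    by (simp add: discs_of_def grafted_def corolla_def numeral_2_eq_2)
  have "tensor1 scale (grafted_value fill d [x] l l' 0 0 0 [])
    = scale ((1) * (1)) (component scale (fill l) [x, x] ([] @ (n, component scale (fill l') [x] []) # []))"
    by (rule value_two_discs[OF D _ _ _ _ _ _ F _ _ _ _ _ _ _ _ _ _ _ _ G _ _ _ W U, where z = "[]" and ?ns1.0 = "[]" and ?z1.0 = "[]"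
          and ?ns0.0 = "[[0]]" and ?z0.0 = "\<lambda>u. [([0], (n, u))]" and ?s1.0 = "1" and ?s0.0 = "1"])
       (simp_all add: X grafted_def corolla_def boundary_def normalize_def word_type_def word_ins_def
          word_outs_def block_inputs_def numeral_2_eq_2)
  then show ?thesis
    by simp
qed

lemma value_grafted_010:
  assumes F: "block_family scale d X V W n (fill l')" and G: "block_family scale d X W U m (fill l)"
    and W: "graded_subspaces scale X W" and U: "graded_subspaces scale X U"
    and X: "x \<in> X" "y \<in> X" and v: "v \<in> V x y (p + 1)"
  shows "tensor1 scale (grafted_value fill d [x, y] l l' 0 1 0 [(p, v)])
    = component scale (fill l) [x, y] [(p + n, component scale (fill l') [x, y] [(p, v)])]"
proof -
  have D: "discs_of [[x, y]] (grafted l l' 0 1 0) = [(l, [Letter In [0] (Some l') x, Letter Out [] None y]),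
      (l', [Letter In [0, 0] None x, Letter Out [0] (Some l) y])]"
    by (simp add: discs_of_def grafted_def corolla_def numeral_2_eq_2)
  have "tensor1 scale (grafted_value fill d [x, y] l l' 0 1 0 [(p, v)])
    = scale ((1) * (1)) (component scale (fill l) [x, y] ([] @ (p + n, component scale (fill l') [x, y] [(p, v)]) # []))"
    by (rule value_two_discs[OF D _ _ _ _ _ _ F _ _ _ _ _ _ _ _ _ _ _ _ G _ _ _ W U, where z = "[([0, 0], (p, v))]" and ?ns1.0 = "[[0, 0]]" and ?z1.0 = "[([0, 0], (p, v))]"
          and ?ns0.0 = "[[0]]" and ?z0.0 = "\<lambda>u. [([0], (p + n, u))]" and ?s1.0 = "1" and ?s0.0 = "1"])
       (simp_all add: X v grafted_def corolla_def boundary_def normalize_def word_type_def word_ins_def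
          word_outs_def block_inputs_def numeral_2_eq_2)
  then show ?thesis
    by simp
qed

text \<open>The root disc reads an external input next to the output of the inner disc, so both come
  from the same family \<open>V\<close>. For i = k = 0 it reads only the inner output, and the
  intermediate family may differ.\<close>

lemma value_grafted_100:
  assumes F: "block_family scale d X V V n (fill l')" and G: "block_family scale d X V U m (fill l)"
    and W: "graded_subspaces scale X V" and U: "graded_subspaces scale X U"
    and X: "x \<in> X" "y \<in> X" and v: "v \<in> V x y (p + 1)"
  shows "tensor1 scale (grafted_value fill d [x, y] l l' 1 0 0 [(p, v)])
    = scale (1 * (ksign (p) (n))) (component scale (fill l) [x, y, y] [(p, v), (n, component scale (fill l') [y] [])])"
proof -
  have D: "discs_of [[x, y]] (grafted l l' 1 0 0) = [(l, [Letter In [0] None x, Letter In [1] (Some l') y, Letter Out [] None y]),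
      (l', [Letter Out [1] (Some l) y])]"
    by (simp add: discs_of_def grafted_def corolla_def numeral_2_eq_2)
  have "tensor1 scale (grafted_value fill d [x, y] l l' 1 0 0 [(p, v)])
    = scale ((1) * (ksign (p) (n))) (component scale (fill l) [x, y, y] ([(p, v)] @ (n, component scale (fill l') [y] []) # []))"
    by (rule value_two_discs[OF D _ _ _ _ _ _ F _ _ _ _ _ _ _ _ _ _ _ _ G _ _ _ W U, where z = "[([0], (p, v))]" and ?ns1.0 = "[]" and ?z1.0 = "[([0], (p, v))]"
          and ?ns0.0 = "[[0], [1]]" and ?z0.0 = "\<lambda>u. [([0], (p, v)), ([1], (n, u))]" and ?s1.0 = "1" and ?s0.0 = "ksign (p) (n)"])
       (simp_all add: X v grafted_def corolla_def boundary_def normalize_def word_type_def word_ins_def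
          word_outs_def block_inputs_def numeral_2_eq_2)
  then show ?thesis
    by simp
qed

text \<open>\<open>bring\<close> pulls the wires to the front one after the other, starting with the
  last name. Wires already in order are therefore exchanged twice, which produces the cancelling
  pair of signs.\<close>

lemma value_grafted_001:
  assumes F: "block_family scale d X V V n (fill l')" and G: "block_family scale d X V U m (fill l)"
    and W: "graded_subspaces scale X V" and U: "graded_subspaces scale X U"
    and X: "x \<in> X" "y \<in> X" and v: "v \<in> V x y (p + 1)"
  shows "tensor1 scale (grafted_value fill d [x, y] l l' 0 0 1 [(p, v)])
    = scale (1 * (ksign (p) (n) * ksign (n) (p))) (component scale (fill l) [x, x, y] [(n, component scale (fill l') [x] []), (p, v)])"
proof -
  have D: "discs_of [[x, y]] (grafted l l' 0 0 1) = [(l, [Letter In [0] (Some l') x, Letter In [1] None x, Letter Out [] None y]),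
      (l', [Letter Out [0] (Some l) x])]"
    by (simp add: discs_of_def grafted_def corolla_def numeral_2_eq_2)
  have "tensor1 scale (grafted_value fill d [x, y] l l' 0 0 1 [(p, v)])
    = scale ((1) * (ksign (p) (n) * ksign (n) (p))) (component scale (fill l) [x, x, y] ([] @ (n, component scale (fill l') [x] []) # [(p, v)]))"
    by (rule value_two_discs[OF D _ _ _ _ _ _ F _ _ _ _ _ _ _ _ _ _ _ _ G _ _ _ W U, where z = "[([1], (p, v))]" and ?ns1.0 = "[]" and ?z1.0 = "[([1], (p, v))]"
          and ?ns0.0 = "[[0], [1]]" and ?z0.0 = "\<lambda>u. [([0], (n, u)), ([1], (p, v))]" and ?s1.0 = "1" and ?s0.0 = "ksign (p) (n) * ksign (n) (p)"])
       (simp_all add: X v grafted_def corolla_def boundary_def normalize_def word_type_def word_ins_def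
          word_outs_def block_inputs_def numeral_2_eq_2)
  then show ?thesis
    by simp
qed

lemma value_grafted_020:
  assumes F: "block_family scale d X V W n (fill l')" and G: "block_family scale d X W U m (fill l)"
    and W: "graded_subspaces scale X W" and U: "graded_subspaces scale X U"
    and X: "x \<in> X" "y \<in> X" "z \<in> X" and v: "v \<in> V x y (p + 1)" "w \<in> V y z (q + 1)"
  shows "tensor1 scale (grafted_value fill d [x, y, z] l l' 0 2 0 [(p, v), (q, w)])
    = scale (ksign (q) (p) * ksign (p) (q) * (1)) (component scale (fill l) [x, z] [(p + q + n, component scale (fill l') [x, y, z] [(p, v), (q, w)])])"
proof -
  have D: "discs_of [[x, y, z]] (grafted l l' 0 2 0) = [(l, [Letter In [0] (Some l') x, Letter Out [] None z]),
      (l', [Letter In [0, 0] None x, Letter In [0, 1] None y, Letter Out [0] (Some l) z])]"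
    by (simp add: discs_of_def grafted_def corolla_def numeral_2_eq_2)
  have "tensor1 scale (grafted_value fill d [x, y, z] l l' 0 2 0 [(p, v), (q, w)])
    = scale ((ksign (q) (p) * ksign (p) (q)) * (1)) (component scale (fill l) [x, z] ([] @ (p + q + n, component scale (fill l') [x, y, z] [(p, v), (q, w)]) # []))"
    by (rule value_two_discs[OF D _ _ _ _ _ _ F _ _ _ _ _ _ _ _ _ _ _ _ G _ _ _ W U, where z = "[([0, 0], (p, v)), ([0, 1], (q, w))]" and ?ns1.0 = "[[0, 0], [0, 1]]" and ?z1.0 = "[([0, 0], (p, v)), ([0, 1], (q, w))]"
          and ?ns0.0 = "[[0]]" and ?z0.0 = "\<lambda>u. [([0], (p + q + n, u))]" and ?s1.0 = "ksign (q) (p) * ksign (p) (q)" and ?s0.0 = "1"])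
       (simp_all add: X v grafted_def corolla_def boundary_def normalize_def word_type_def word_ins_def
          word_outs_def block_inputs_def numeral_2_eq_2)
  then show ?thesis
    by simp
qed

lemma value_grafted_110:
  assumes F: "block_family scale d X V V n (fill l')" and G: "block_family scale d X V U m (fill l)"
    and W: "graded_subspaces scale X V" and U: "graded_subspaces scale X U"
    and X: "x \<in> X" "y \<in> X" "z \<in> X" and v: "v \<in> V x y (p + 1)" "w \<in> V y z (q + 1)"
  shows "tensor1 scale (grafted_value fill d [x, y, z] l l' 1 1 0 [(p, v), (q, w)])
    = scale (ksign (q) (p) * (ksign (p) (q + n))) (component scale (fill l) [x, y, z] [(p, v), (q + n, component scale (fill l') [y, z] [(q, w)])])"
proof -
  have D: "discs_of [[x, y, z]] (grafted l l' 1 1 0) = [(l, [Letter In [0] None x, Letter In [1] (Some l') y, Letter Out [] None z]),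
      (l', [Letter In [1, 0] None y, Letter Out [1] (Some l) z])]"
    by (simp add: discs_of_def grafted_def corolla_def numeral_2_eq_2)
  have "tensor1 scale (grafted_value fill d [x, y, z] l l' 1 1 0 [(p, v), (q, w)])
    = scale ((ksign (q) (p)) * (ksign (p) (q + n))) (component scale (fill l) [x, y, z] ([(p, v)] @ (q + n, component scale (fill l') [y, z] [(q, w)]) # []))"
    by (rule value_two_discs[OF D _ _ _ _ _ _ F _ _ _ _ _ _ _ _ _ _ _ _ G _ _ _ W U, where z = "[([0], (p, v)), ([1, 0], (q, w))]" and ?ns1.0 = "[[1, 0]]" and ?z1.0 = "[([1, 0], (q, w)), ([0], (p, v))]"
          and ?ns0.0 = "[[0], [1]]" and ?z0.0 = "\<lambda>u. [([0], (p, v)), ([1], (q + n, u))]" and ?s1.0 = "ksign (q) (p)" and ?s0.0 = "ksign (p) (q + n)"])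
       (simp_all add: X v grafted_def corolla_def boundary_def normalize_def word_type_def word_ins_def
          word_outs_def block_inputs_def numeral_2_eq_2)
  then show ?thesis
    by simp
qed

lemma value_grafted_011:
  assumes F: "block_family scale d X V V n (fill l')" and G: "block_family scale d X V U m (fill l)"
    and W: "graded_subspaces scale X V" and U: "graded_subspaces scale X U"
    and X: "x \<in> X" "y \<in> X" "z \<in> X" and v: "v \<in> V x y (p + 1)" "w \<in> V y z (q + 1)"
  shows "tensor1 scale (grafted_value fill d [x, y, z] l l' 0 1 1 [(p, v), (q, w)])
    = scale (1 * (ksign (q) (p + n) * ksign (p + n) (q))) (component scale (fill l) [x, y, z] [(p + n, component scale (fill l') [x, y] [(p, v)]), (q, w)])"
proof -
  have D: "discs_of [[x, y, z]] (grafted l l' 0 1 1) = [(l, [Letter In [0] (Some l') x, Letter In [1] None y, Letter Out [] None z]),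
      (l', [Letter In [0, 0] None x, Letter Out [0] (Some l) y])]"
    by (simp add: discs_of_def grafted_def corolla_def numeral_2_eq_2)
  have "tensor1 scale (grafted_value fill d [x, y, z] l l' 0 1 1 [(p, v), (q, w)])
    = scale ((1) * (ksign (q) (p + n) * ksign (p + n) (q))) (component scale (fill l) [x, y, z] ([] @ (p + n, component scale (fill l') [x, y] [(p, v)]) # [(q, w)]))"
    by (rule value_two_discs[OF D _ _ _ _ _ _ F _ _ _ _ _ _ _ _ _ _ _ _ G _ _ _ W U, where z = "[([0, 0], (p, v)), ([1], (q, w))]" and ?ns1.0 = "[[0, 0]]" and ?z1.0 = "[([0, 0], (p, v)), ([1], (q, w))]"
          and ?ns0.0 = "[[0], [1]]" and ?z0.0 = "\<lambda>u. [([0], (p + n, u)), ([1], (q, w))]" and ?s1.0 = "1" and ?s0.0 = "ksign (q) (p + n) * ksign (p + n) (q)"])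
       (simp_all add: X v grafted_def corolla_def boundary_def normalize_def word_type_def word_ins_def
          word_outs_def block_inputs_def numeral_2_eq_2)
  then show ?thesis
    by simp
qed

lemma value_grafted_200:
  assumes F: "block_family scale d X V V n (fill l')" and G: "block_family scale d X V U m (fill l)"
    and W: "graded_subspaces scale X V" and U: "graded_subspaces scale X U"
    and X: "x \<in> X" "y \<in> X" "z \<in> X" and v: "v \<in> V x y (p + 1)" "w \<in> V y z (q + 1)"
  shows "tensor1 scale (grafted_value fill d [x, y, z] l l' 2 0 0 [(p, v), (q, w)])
    = scale (1 * (ksign (q) (n + p) * ksign (p) (q + n))) (component scale (fill l) [x, y, z, z] [(p, v), (q, w), (n, component scale (fill l') [z] [])])"
proof -
  have D: "discs_of [[x, y, z]] (grafted l l' 2 0 0) = [(l, [Letter In [0] None x, Letter In [1] None y, Letter In [2] (Some l') z, Letter Out [] None z]),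
      (l', [Letter Out [2] (Some l) z])]"
    by (simp add: discs_of_def grafted_def corolla_def numeral_2_eq_2)
  have "tensor1 scale (grafted_value fill d [x, y, z] l l' 2 0 0 [(p, v), (q, w)])
    = scale ((1) * (ksign (q) (n + p) * ksign (p) (q + n))) (component scale (fill l) [x, y, z, z] ([(p, v), (q, w)] @ (n, component scale (fill l') [z] []) # []))"
    by (rule value_two_discs[OF D _ _ _ _ _ _ F _ _ _ _ _ _ _ _ _ _ _ _ G _ _ _ W U, where z = "[([0], (p, v)), ([1], (q, w))]" and ?ns1.0 = "[]" and ?z1.0 = "[([0], (p, v)), ([1], (q, w))]"
          and ?ns0.0 = "[[0], [1], [2]]" and ?z0.0 = "\<lambda>u. [([0], (p, v)), ([1], (q, w)), ([2], (n, u))]" and ?s1.0 = "1" and ?s0.0 = "ksign (q) (n + p) * ksign (p) (q + n)"])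
       (simp_all add: X v grafted_def corolla_def boundary_def normalize_def word_type_def word_ins_def
          word_outs_def block_inputs_def numeral_2_eq_2)
  then show ?thesis
    by simp
qed

lemma value_grafted_101:
  assumes F: "block_family scale d X V V n (fill l')" and G: "block_family scale d X V U m (fill l)"
    and W: "graded_subspaces scale X V" and U: "graded_subspaces scale X U"
    and X: "x \<in> X" "y \<in> X" "z \<in> X" and v: "v \<in> V x y (p + 1)" "w \<in> V y z (q + 1)"
  shows "tensor1 scale (grafted_value fill d [x, y, z] l l' 1 0 1 [(p, v), (q, w)])
    = scale (1 * (ksign (q) (n + p) * ksign (n) (q) * ksign (p) (n + q))) (component scale (fill l) [x, y, y, z] [(p, v), (n, component scale (fill l') [y] []), (q, w)])"
proof -
  have D: "discs_of [[x, y, z]] (grafted l l' 1 0 1) = [(l, [Letter In [0] None x, Letter In [1] (Some l') y, Letter In [2] None y, Letter Out [] None z]),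
      (l', [Letter Out [1] (Some l) y])]"
    by (simp add: discs_of_def grafted_def corolla_def numeral_2_eq_2)
  have "tensor1 scale (grafted_value fill d [x, y, z] l l' 1 0 1 [(p, v), (q, w)])
    = scale ((1) * (ksign (q) (n + p) * ksign (n) (q) * ksign (p) (n + q))) (component scale (fill l) [x, y, y, z] ([(p, v)] @ (n, component scale (fill l') [y] []) # [(q, w)]))"
    by (rule value_two_discs[OF D _ _ _ _ _ _ F _ _ _ _ _ _ _ _ _ _ _ _ G _ _ _ W U, where z = "[([0], (p, v)), ([2], (q, w))]" and ?ns1.0 = "[]" and ?z1.0 = "[([0], (p, v)), ([2], (q, w))]"
          and ?ns0.0 = "[[0], [1], [2]]" and ?z0.0 = "\<lambda>u. [([0], (p, v)), ([1], (n, u)), ([2], (q, w))]" and ?s1.0 = "1" and ?s0.0 = "ksign (q) (n + p) * ksign (n) (q) * ksign (p) (n + q)"])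
       (simp_all add: X v grafted_def corolla_def boundary_def normalize_def word_type_def word_ins_def
          word_outs_def block_inputs_def numeral_2_eq_2)
  then show ?thesis
    by simp
qed

lemma value_grafted_002:
  assumes F: "block_family scale d X V V n (fill l')" and G: "block_family scale d X V U m (fill l)"
    and W: "graded_subspaces scale X V" and U: "graded_subspaces scale X U"
    and X: "x \<in> X" "y \<in> X" "z \<in> X" and v: "v \<in> V x y (p + 1)" "w \<in> V y z (q + 1)"
  shows "tensor1 scale (grafted_value fill d [x, y, z] l l' 0 0 2 [(p, v), (q, w)])
    = scale (1 * (ksign (q) (n + p) * ksign (p) (q + n) * ksign (n) (p + q))) (component scale (fill l) [x, x, y, z] [(n, component scale (fill l') [x] []), (p, v), (q, w)])"
proof -
  have D: "discs_of [[x, y, z]] (grafted l l' 0 0 2) = [(l, [Letter In [0] (Some l') x, Letter In [1] None x, Letter In [2] None y, Letter Out [] None z]),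
      (l', [Letter Out [0] (Some l) x])]"
    by (simp add: discs_of_def grafted_def corolla_def numeral_2_eq_2)
  have "tensor1 scale (grafted_value fill d [x, y, z] l l' 0 0 2 [(p, v), (q, w)])
    = scale ((1) * (ksign (q) (n + p) * ksign (p) (q + n) * ksign (n) (p + q))) (component scale (fill l) [x, x, y, z] ([] @ (n, component scale (fill l') [x] []) # [(p, v), (q, w)]))"
    by (rule value_two_discs[OF D _ _ _ _ _ _ F _ _ _ _ _ _ _ _ _ _ _ _ G _ _ _ W U, where z = "[([1], (p, v)), ([2], (q, w))]" and ?ns1.0 = "[]" and ?z1.0 = "[([1], (p, v)), ([2], (q, w))]"
          and ?ns0.0 = "[[0], [1], [2]]" and ?z0.0 = "\<lambda>u. [([0], (n, u)), ([1], (p, v)), ([2], (q, w))]" and ?s1.0 = "1" and ?s0.0 = "ksign (q) (n + p) * ksign (p) (q + n) * ksign (n) (p + q)"])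
       (simp_all add: X v grafted_def corolla_def boundary_def normalize_def word_type_def word_ins_def
          word_outs_def block_inputs_def numeral_2_eq_2)
  then show ?thesis
    by simp
qed

end

section \<open>Sums over diagrams with at most two inputs\<close>

lemma discs_with_grafted:
  assumes "l \<noteq> l'"
  shows "discs_with l x (grafted l l' i j k) = [discs_of x (grafted l l' i j k) ! 0]"
    and "discs_with l' x (grafted l l' i j k) = [discs_of x (grafted l l' i j k) ! 1]"
    and "r \<noteq> l \<Longrightarrow> r \<noteq> l' \<Longrightarrow> discs_with r x (grafted l l' i j k) = []"
proof -
  obtain w w' where "discs_of x (grafted l l' i j k) = [(l, w), (l', w')]"
    by (rule discs_of_grafted)
  then show "discs_with l x (grafted l l' i j k) = [discs_of x (grafted l l' i j k) ! 0]"
    "discs_with l' x (grafted l l' i j k) = [discs_of x (grafted l l' i j k) ! 1]"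
    "r \<noteq> l \<Longrightarrow> r \<noteq> l' \<Longrightarrow> discs_with r x (grafted l l' i j k) = []"
    using assms by (simp_all add: discs_with_def)
qed

lemma bush_single: "bush l [(l', k)] = grafted l l' 0 k 0"
  by (simp add: bush_def grafted_def)

text \<open>Needed to reindex sums over trees by triples: \<open>i\<close> and \<open>k\<close> are
  the lengths of the runs of free slots on either side of the child.\<close>

lemma grafted_inject:
  "grafted l l' i j k = grafted l l' i' j' k' \<longleftrightarrow> i = i' \<and> j = j' \<and> k = k'"
proof
  assume eq: "grafted l l' i j k = grafted l l' i' j' k'"
  let ?P = "\<lambda>s. s = (In, None)"
  have tw: "takeWhile ?P (slots (grafted l l' i j k)) = replicate i (In, None)"
    and dw: "dropWhile ?P (slots (grafted l l' i j k)) = (In, Some (corolla l' j)) # replicate k (In, None)"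
    for l l' :: 'a and i j k
    by (simp_all add: grafted_def takeWhile_append dropWhile_append)
  from tw[of l l' i j k] dw[of l l' i j k] tw[of l l' i' j' k'] dw[of l l' i' j' k'] eq
  have "replicate i (In, None :: 'a diagram option) = replicate i' (In, None)"
    "corolla l' j = corolla l' j'" "replicate k (In, None :: 'a diagram option) = replicate k' (In, None)"
    by simp_all
  then show "i = i' \<and> j = j' \<and> k = k'"
    by (simp add: corolla_def)
qed simp

lemma sum_grafted:
  "sum f ((\<lambda>(i, j, k). grafted l l' i j k) ` S) = (\<Sum>(i, j, k)\<in>S. f (grafted l l' i j k))"
  by (subst sum.reindex) (auto simp: inj_on_def grafted_inject intro!: sum.cong)

lemma triples_upto_2:
  "{(i, j, k). i + j + k = (0 :: nat)} = {(0, 0, 0 :: nat)}"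
  "{(i, j, k). i + j + k = Suc 0} = {(0, 1, 0), (1, 0, 0), (0, 0, 1)}"
  "{(i, j, k). i + j + k = Suc (Suc 0)} = {(0, 2, 0), (1, 1, 0), (0, 1, 1), (2, 0, 0), (1, 0, 1), (0, 0, 2)}"
proof -
  have "i + j + k = Suc 0 \<longleftrightarrow> (i, j, k) \<in> {(0, 1, 0), (1, 0, 0), (0, 0, 1)}"
    "i + j + k = Suc (Suc 0) \<longleftrightarrow> (i, j, k) \<in> {(0, 2, 0), (1, 1, 0), (0, 1, 1), (2, 0, 0), (1, 0, 1), (0, 0, 2)}" for i j k
    by (cases i; cases j; cases k; auto simp: numeral_2_eq_2)+
  then show "{(i, j, k). i + j + k = Suc 0} = {(0, 1, 0), (1, 0, 0), (0, 0, 1)}"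
    "{(i, j, k). i + j + k = Suc (Suc 0)} = {(0, 2, 0), (1, 1, 0), (0, 1, 1), (2, 0, 0), (1, 0, 1), (0, 0, 2)}"
    by (simp_all only:) auto
qed auto

lemma circ_nec_single_block:
  assumes "b \<noteq> []" and "length b \<le> 3"
  shows "circ_nec d f g [b] vs = (\<Sum>(i, j, k)\<in>{(i, j, k). i + j + k = length b - 1}.
    grafted_value (\<lambda>l. case l of Inner \<Rightarrow> g | Outer \<Rightarrow> f) d b Outer Inner i j k vs)"
  unfolding circ_nec_def nec_diagrams_eq[OF assms(1)] sum_grafted
proof (intro sum.cong refl, clarify)
  fix i j k assume "i + j + k = length b - 1"
  then have "i + j + k = 0 \<or> i + j + k = Suc 0 \<or> i + j + k = Suc (Suc 0)"
    using assms(2) by linarith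
  then have "(i, j, k) \<in> {(i, j, k). i + j + k = 0} \<union> {(i, j, k). i + j + k = Suc 0} \<union> {(i, j, k). i + j + k = Suc (Suc 0)}"
    by simp
  then have "(i, j, k) \<in> {(0, 0, 0), (0, 1, 0), (1, 0, 0), (0, 0, 1), (0, 2, 0), (1, 1, 0), (0, 1, 1), (2, 0, 0), (1, 0, 1), (0, 0, 2)}"
    unfolding triples_upto_2 Un_iff insert_iff empty_iff by argo
  note joint = joint_grafted[OF this]
  show "(let fill = case_layer g f; \<gamma> = hd (discs_with Inner [b] (grafted Outer Inner i j k));
          \<phi> = hd (discs_with Outer [b] (grafted Outer Inner i j k))
      in eval_diagram [b] (grafted Outer Inner i j k)
          [act_disc fill \<gamma>, act_edge d (joint \<gamma>), act_disc fill \<phi>] vs)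
      = grafted_value (case_layer g f) d b Outer Inner i j k vs"
    by (simp add: discs_with_grafted joint[unfolded One_nat_def] grafted_value_def Let_def)
qed

lemma multinec_sum_single_block:
  assumes "b \<noteq> []" and "length b \<le> 3" and "h = (if l0 = Htp then 1 else 0)" and "l0 \<noteq> Str"
  shows "multinec_sum d h q a M [b] vs = (\<Sum>(i, j, k)\<in>{(i, j, k). i + j + k = length b - 1}.
    grafted_value (\<lambda>l. case l of Str \<Rightarrow> M | Mor \<Rightarrow> a | Htp \<Rightarrow> q) d b l0 Str i j k vs)"
  unfolding multinec_sum_def star_diagrams_Out_eq[OF assms(1,3,4)] sum_grafted
proof (intro sum.cong refl, clarify)
  fix i j k assume "i + j + k = length b - 1"
  then have "i + j + k = 0 \<or> i + j + k = Suc 0 \<or> i + j + k = Suc (Suc 0)"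
    using assms(2) by linarith
  then have "(i, j, k) \<in> {(i, j, k). i + j + k = 0} \<union> {(i, j, k). i + j + k = Suc 0} \<union> {(i, j, k). i + j + k = Suc (Suc 0)}"
    by simp
  then have "(i, j, k) \<in> {(0, 0, 0), (0, 1, 0), (1, 0, 0), (0, 0, 1), (0, 2, 0), (1, 1, 0), (0, 1, 1), (2, 0, 0), (1, 0, 1), (0, 0, 2)}"
    unfolding triples_upto_2 Un_iff insert_iff empty_iff by argo
  note joint = joint_grafted[OF this]
  show "(let fill = case_role M a q
      in eval_diagram [b] (grafted l0 Str i j k)
          (map (act_disc fill) (discs_with Str [b] (grafted l0 Str i j k)) @
           concat (map (\<lambda>\<delta>. [act_edge d (joint \<delta>), act_disc fill \<delta>])
             (discs_with Mor [b] (grafted l0 Str i j k) @ discs_with Htp [b] (grafted l0 Str i j k)))) vs)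
      = grafted_value (case_role M a q) d b l0 Str i j k vs"
    using assms(4) by (cases l0) (simp_all add: discs_with_grafted joint[unfolded One_nat_def] grafted_value_def Let_def)
qed

text \<open>Each morphism disc consumes at least one of the \<open>m\<close> inputs and each
  homotopy disc is one of the \<open>h\<close> allowed, so the number of children is bounded and the
  diagrams can be enumerated.\<close>

lemma sum_list_Suc_cases:
  assumes "sum_list (map snd ks) = m" "length (filter (\<lambda>x. fst x = Htp) ks) = h"
    "\<forall>x\<in>set ks. fst x = Htp \<or> fst x = Mor \<and> 0 < snd x"
  shows "length ks \<le> m + h"
  using assms
proof (induction ks arbitrary: m h)
  case (Cons x ks)
  from Cons.IH[OF refl refl] Cons.prems show ?case
    by (auto split: if_splits)
qed simp

lemma short_list_cases:
  assumes "length ks \<le> Suc (Suc 0)"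
  obtains "ks = []" | x where "ks = [x]" | x y where "ks = [x, y]"
  using assms by (cases ks; cases "tl ks") auto

text \<open>The two bushes in the last set put an input-free homotopy disc to the left or to the
  right of the morphism. They make the linear part of a homotopy vary even on cohomology.\<close>

lemma star_diagrams_In_small:
  "star_diagrams In 0 [[x, y]] = {grafted Str Mor 0 1 0}"
  "star_diagrams In 1 [[x]] = {grafted Str Htp 0 0 0}"
  "star_diagrams In 1 [[x, y]] = {grafted Str Htp 0 1 0, bush Str [(Htp, 0), (Mor, 1)], bush Str [(Mor, 1), (Htp, 0)]}"
proof -
  have len: "length ks \<le> Suc (Suc 0)" if "sum_list (map snd ks) = m" "length (filter (\<lambda>x. fst x = Htp) ks) = h"
    "\<forall>x\<in>set ks. fst x = Htp \<or> fst x = Mor \<and> 0 < snd x" "m + h \<le> 2" for ks :: "(role \<times> nat) list" and m h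
    using sum_list_Suc_cases[OF that(1-3)] that(4) by simp
  have "{ks :: (role \<times> nat) list. sum_list (map snd ks) = 1 \<and> length (filter (\<lambda>x. fst x = Htp) ks) = 0 \<and>
      (\<forall>x\<in>set ks. fst x = Htp \<or> fst x = Mor \<and> 0 < snd x)} = {[(Mor, 1)]}" (is "?K = _")
  proof (intro equalityI subsetI)
    fix ks assume "ks \<in> ?K"
    then have ks: "sum_list (map snd ks) = 1" "length (filter (\<lambda>x. fst x = Htp) ks) = 0"
      "\<forall>x\<in>set ks. fst x = Htp \<or> fst x = Mor \<and> 0 < snd x"
      unfolding mem_Collect_eq by blast+
    show "ks \<in> {[(Mor, 1)]}"
      by (rule short_list_cases[OF len[OF ks]]) (use ks in \<open>auto split: if_splits\<close>)
  qed auto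
  then show "star_diagrams In 0 [[x, y]] = {grafted Str Mor 0 1 0}"
    by (simp add: star_diagrams_In_eq bush_single)
  have "{ks :: (role \<times> nat) list. sum_list (map snd ks) = 0 \<and> length (filter (\<lambda>x. fst x = Htp) ks) = 1 \<and>
      (\<forall>x\<in>set ks. fst x = Htp \<or> fst x = Mor \<and> 0 < snd x)} = {[(Htp, 0)]}" (is "?K = _")
  proof (intro equalityI subsetI)
    fix ks assume "ks \<in> ?K"
    then have ks: "sum_list (map snd ks) = 0" "length (filter (\<lambda>x. fst x = Htp) ks) = 1"
      "\<forall>x\<in>set ks. fst x = Htp \<or> fst x = Mor \<and> 0 < snd x"
      unfolding mem_Collect_eq by blast+
    show "ks \<in> {[(Htp, 0)]}"
      by (rule short_list_cases[OF len[OF ks]]) (use ks in \<open>auto split: if_splits\<close>)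
  qed auto
  then show "star_diagrams In 1 [[x]] = {grafted Str Htp 0 0 0}"
    by (simp add: star_diagrams_In_eq bush_single)
  have "{ks :: (role \<times> nat) list. sum_list (map snd ks) = 1 \<and> length (filter (\<lambda>x. fst x = Htp) ks) = 1 \<and>
      (\<forall>x\<in>set ks. fst x = Htp \<or> fst x = Mor \<and> 0 < snd x)}
      = {[(Htp, 1)], [(Htp, 0), (Mor, 1)], [(Mor, 1), (Htp, 0)]}" (is "?K = _")
  proof (intro equalityI subsetI)
    fix ks assume "ks \<in> ?K"
    then have ks: "sum_list (map snd ks) = 1" "length (filter (\<lambda>x. fst x = Htp) ks) = 1"
      "\<forall>x\<in>set ks. fst x = Htp \<or> fst x = Mor \<and> 0 < snd x"
      unfolding mem_Collect_eq by blast+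
    show "ks \<in> {[(Htp, 1)], [(Htp, 0), (Mor, 1)], [(Mor, 1), (Htp, 0)]}"
      by (rule short_list_cases[OF len[OF ks]]) (use ks in \<open>auto split: if_splits\<close>)
  qed auto
  then show "star_diagrams In 1 [[x, y]] = {grafted Str Htp 0 1 0, bush Str [(Htp, 0), (Mor, 1)], bush Str [(Mor, 1), (Htp, 0)]}"
    by (simp add: star_diagrams_In_eq bush_single)
qed

text \<open>A single input cannot serve two inner discs, and each needs one. Hence the linear part
  of a composite is the composite of the linear parts.\<close>

lemma comp_diagrams_small: "comp_diagrams [[x, y]] = {grafted Outer Inner 0 1 0}"
proof -
  have "ks = [(Inner, 1)]" if "sum_list (map snd ks) = Suc 0" "\<forall>x\<in>set ks. fst x = Inner \<and> 0 < snd x" for ks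
  proof (cases ks)
    case (Cons a list)
    then show ?thesis
      using that by (cases list) (auto simp: prod_eq_iff)
  qed (use that in simp)
  then have "{ks. sum_list (map snd ks) = Suc 0 \<and> (\<forall>x\<in>set ks. fst x = Inner \<and> 0 < snd x)} = {[(Inner, 1)]}"
    by force
  then show ?thesis
    by (simp add: comp_diagrams_eq bush_single)
qed

lemma pre_sum_0_single_block:
  "pre_sum d 0 \<Phi> M q a [[x, y]] vs
    = grafted_value (\<lambda>l. case l of Str \<Rightarrow> (\<lambda>y. M (map (map \<Phi>) y)) | Mor \<Rightarrow> a | Htp \<Rightarrow> q) d [x, y] Str Mor 0 1 0 vs"
  unfolding pre_sum_def star_diagrams_In_small
  by (simp add: discs_with_grafted joint_grafted[unfolded One_nat_def] grafted_value_def Let_def)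

lemma pre_sum_1_object:
  "pre_sum d 1 \<Phi> M q a [[x]] vs
    = grafted_value (\<lambda>l. case l of Str \<Rightarrow> (\<lambda>y. M (map (map \<Phi>) y)) | Mor \<Rightarrow> a | Htp \<Rightarrow> q) d [x] Str Htp 0 0 0 vs"
  unfolding pre_sum_def star_diagrams_In_small
  by (simp add: discs_with_grafted joint_grafted[unfolded One_nat_def] grafted_value_def Let_def)

lemma fam_comp_single_block:
  "fam_comp d \<Phi> G F [[x, y]] vs
    = grafted_value (\<lambda>l. case l of Inner \<Rightarrow> F | Outer \<Rightarrow> (\<lambda>y. G (map (map \<Phi>) y))) d [x, y] Outer Inner 0 1 0 vs"
  unfolding fam_comp_def comp_diagrams_small
  by (simp add: discs_with_grafted joint_grafted[unfolded One_nat_def] grafted_value_def Let_def)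

context vector_space
begin

text \<open>The factors are ordered as in \<open>pre_sum\<close>: first the disc with the input,
  then the input-free one, irrespective of their positions. The second value gets a sign because the
  positions are opposite to those in the first.\<close>

lemma value_bush:
  fixes fill :: "'l \<Rightarrow> ('o, 'b, 'a) family"
  assumes F: "block_family scale d X V W n (fill l1)" and B: "block_family scale d X V W n' (fill l2)"
    and G: "block_family scale d X W U m (fill l0)"
    and W: "graded_subspaces scale X W" and U: "graded_subspaces scale X U"
    and X: "x \<in> X" "y \<in> X" and v: "v \<in> V x y (p + 1)"
  shows "tensor1 scale (eval_diagram [[x, y]] (bush l0 [(l2, 0), (l1, 1)])
      [act_disc fill (discs_of [[x, y]] (bush l0 [(l2, 0), (l1, 1)]) ! 2), act_edge d [1],
       act_disc fill (discs_of [[x, y]] (bush l0 [(l2, 0), (l1, 1)]) ! 1), act_edge d [0],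
       act_disc fill (discs_of [[x, y]] (bush l0 [(l2, 0), (l1, 1)]) ! 0)] [(p, v)])
    = component scale (fill l0) [x, x, y] [(n', component scale (fill l2) [x] []), (p + n, component scale (fill l1) [x, y] [(p, v)])]"
    (is ?A)
    and "tensor1 scale (eval_diagram [[x, y]] (bush l0 [(l1, 1), (l2, 0)])
      [act_disc fill (discs_of [[x, y]] (bush l0 [(l1, 1), (l2, 0)]) ! 1), act_edge d [0],
       act_disc fill (discs_of [[x, y]] (bush l0 [(l1, 1), (l2, 0)]) ! 2), act_edge d [1],
       act_disc fill (discs_of [[x, y]] (bush l0 [(l1, 1), (l2, 0)]) ! 0)] [(p, v)])
    = scale (ksign (p + n) n') (component scale (fill l0) [x, y, y]
        [(p + n, component scale (fill l1) [x, y] [(p, v)]), (n', component scale (fill l2) [y] [])])"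
    (is ?B)
proof -
  note defs = boundary_def normalize_def word_type_def word_ins_def word_outs_def numeral_2_eq_2
  note linear = linear_compose_smul[OF linear_root_value linear_act_disc]
    linear_compose_smul[OF linear_compose_smul[OF linear_compose_smul[OF linear_root_value linear_act_disc] linear_act_edge] linear_act_disc]
  have ins: "block_inputs V [x, y] [(p, v)]" "block_inputs V [z] []" for z
    by (simp_all add: block_inputs_def v)
  have mem: "component scale (fill l2) [z] [] \<in> W z z (n' + 1)" if "z \<in> X" for z
    using component_mem[OF B _ _ ins(2) W, of z] that by simp
  show ?A
  proof -
    let ?D = "bush l0 [(l2, 0), (l1, 1)]"
    let ?w0 = "[Letter In [0] (Some l2) x, Letter In [1] (Some l1) x, Letter Out [] None y]"
    let ?w1 = "[Letter In [1, 0] None x, Letter Out [1] (Some l0) y]"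
    let ?w2 = "[Letter Out [0] (Some l0) x]"
    \<comment> \<open>\<open>?\<phi>\<close> is the root disc, \<open>?\<psi>\<close> the input-free
      disc and its edge followed by the root. The facts \<open>1\<close> and \<open>2\<close>
      evaluate these two continuations, after which only the disc with the input is left.\<close>
    let ?\<phi> = "\<lambda>q. root_value scale (act_disc fill (l0, ?w0) q)"
    let ?\<psi> = "\<lambda>q. ?\<phi> (act_edge d [0] (act_disc fill (l2, ?w2) q))"
    let ?h = "\<lambda>u. component scale (fill l0) [x, x, y] [(n', component scale (fill l2) [x] []), (p + n, u)]"
    have D: "discs_of [[x, y]] ?D = [(l0, ?w0), (l2, ?w2), (l1, ?w1)]"
      by (simp add: discs_of_def bush_def corolla_def)
    have in0: "block_inputs W [x, x, y] [(n', w), (p + n, u)]" if "w \<in> W x x (n' + 1)" "u \<in> W x y (p + n + 1)" for w u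
      using that by (simp add: block_inputs_def)
    have 1: "?\<phi> (Poly_Mapping.single [([0], (n', w)), ([1], (p + n, u))] 1)
        = component scale (fill l0) [x, x, y] [(n', w), (p + n, u)]"
      if "w \<in> W x x (n' + 1)" "u \<in> W x y (p + n + 1)" for w u
    proof -
      have br: "bring [[0], [1]] (Poly_Mapping.single [([0], (n', w)), ([1], (p + n, u))] 1)
          = Poly_Mapping.single [([0], (n', w)), ([1], (p + n, u))] 1"
        by (simp add: bring_single Let_def)
      have "?\<phi> (Poly_Mapping.single [([0], (n', w)), ([1], (p + n, u))] 1)
          = scale 1 (component scale (fill l0) [x, x, y] [(n', w), (p + n, u)])"
        by (rule act_root_step[OF _ br _ _ _ _ G _ _ _ in0[OF that] U]) (simp_all add: defs X)
      then show ?thesis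
        by simp
    qed
    have 2: "?\<psi> (Poly_Mapping.single [([1], (p + n, u))] 1) = ?h u" if u: "u \<in> W x y (p + n + 1)" for u
    proof -
      have "?\<psi> (Poly_Mapping.single [([1], (p + n, u))] 1)
          = scale 1 ((\<lambda>w. component scale (fill l0) [x, x, y] [(n', w), (p + n, u)]) (component scale (fill l2) [x] []))"
      proof (rule act_disc_edge_step[where z' = "[([1], (p + n, u))]" and ns = "[]" and m = 0 and b = "[x]" and vs = "[]",
            OF linear(1) _ _ _ _ _ _ B _ _ _ ins(2) W])
        have "linear_on scale (W x x (n' + 1)) (\<lambda>w. component scale (fill l0) [x, x, y] ([] @ (n', w) # [(p + n, u)]))"
          by (rule block_family_linear_on[OF G]) (use in0 u X in simp_all)
        then show "linear_on scale (W (hd [x]) (last [x]) (tdeg [] + n' + 1))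
            (\<lambda>w. component scale (fill l0) [x, x, y] [(n', w), (p + n, u)])"
          by simp
      qed (use u 1 in \<open>simp_all add: defs X bring_def\<close>)
      then show ?thesis
        by simp
    qed
    have "?\<psi> (act_edge d [1] (act_disc fill (l1, ?w1) (Poly_Mapping.single [([1, 0], (p, v))] 1)))
        = scale 1 (?h (component scale (fill l1) [x, y] [(p, v)]))"
    proof (rule act_disc_edge_step[where z' = "[([1, 0], (p, v))]" and ns = "[[1, 0]]" and m = 1 and b = "[x, y]" and vs = "[(p, v)]" and h = ?h,
          OF linear_compose_smul[OF linear_compose_smul[OF linear(1) linear_act_edge] linear_act_disc] _ _ _ _ _ _ F _ _ _ ins(1) W])
      have "linear_on scale (W x y (p + n + 1))
          (\<lambda>u. component scale (fill l0) [x, x, y] ([(n', component scale (fill l2) [x] [])] @ (p + n, u) # []))"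
        by (rule block_family_linear_on[OF G]) (use in0 mem X in simp_all)
      then show "linear_on scale (W (hd [x, y]) (last [x, y]) (tdeg [(p, v)] + n + 1)) ?h"
        by simp
    qed (use 2 in \<open>simp_all add: defs X bring_single Let_def\<close>)
    moreover have "word_outs (boundary [[x, y]] ?D) = [[]]" "zip (word_ins (boundary [[x, y]] ?D)) [(p, v)] = [([1, 0], (p, v))]"
      by (simp_all add: defs bush_def corolla_def)
    ultimately show ?A
      by (simp add: D[unfolded One_nat_def] tensor1_eval_diagram numeral_2_eq_2)
  qed
  show ?B
  proof -
    let ?D = "bush l0 [(l1, 1), (l2, 0)]"
    let ?w0 = "[Letter In [0] (Some l1) x, Letter In [1] (Some l2) y, Letter Out [] None y]"
    let ?w1 = "[Letter In [0, 0] None x, Letter Out [0] (Some l0) y]"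
    let ?w2 = "[Letter Out [1] (Some l0) y]"
    let ?\<phi> = "\<lambda>q. root_value scale (act_disc fill (l0, ?w0) q)"
    let ?\<psi> = "\<lambda>q. ?\<phi> (act_edge d [1] (act_disc fill (l2, ?w2) q))"
    let ?h = "\<lambda>u. scale (ksign (p + n) n') (component scale (fill l0) [x, y, y] [(p + n, u), (n', component scale (fill l2) [y] [])])"
    have D: "discs_of [[x, y]] ?D = [(l0, ?w0), (l1, ?w1), (l2, ?w2)]"
      by (simp add: discs_of_def bush_def corolla_def)
    have in0: "block_inputs W [x, y, y] [(p + n, u), (n', w)]" if "w \<in> W y y (n' + 1)" "u \<in> W x y (p + n + 1)" for w u
      using that by (simp add: block_inputs_def)
    have 1: "?\<phi> (Poly_Mapping.single [([1], (n', w)), ([0], (p + n, u))] 1)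
        = scale (ksign (p + n) n') (component scale (fill l0) [x, y, y] [(p + n, u), (n', w)])"
      if "w \<in> W y y (n' + 1)" "u \<in> W x y (p + n + 1)" for w u
    proof -
      \<comment> \<open>The input-free disc acted later, so its output stands in front although it
        belongs to the second slot; one transposition gives the sign.\<close>
      have br: "bring [[0], [1]] (Poly_Mapping.single [([1], (n', w)), ([0], (p + n, u))] 1)
          = Poly_Mapping.single [([0], (p + n, u)), ([1], (n', w))] (ksign (p + n) n')"
        by (simp add: bring_single Let_def)
      show ?thesis
        by (rule act_root_step[OF _ br _ _ _ _ G _ _ _ in0[OF that] U]) (simp_all add: defs X)
    qed
    have 2: "?\<psi> (Poly_Mapping.single [([0], (p + n, u))] 1) = ?h u" if u: "u \<in> W x y (p + n + 1)" for u
    proof -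
      have "?\<psi> (Poly_Mapping.single [([0], (p + n, u))] 1)
          = scale 1 ((\<lambda>w. scale (ksign (p + n) n') (component scale (fill l0) [x, y, y] [(p + n, u), (n', w)])) (component scale (fill l2) [y] []))"
      proof (rule act_disc_edge_step[where z' = "[([0], (p + n, u))]" and ns = "[]" and m = 0 and b = "[y]" and vs = "[]",
            OF linear(1) _ _ _ _ _ _ B _ _ _ ins(2) W])
        have "linear_on scale (W y y (n' + 1)) (\<lambda>w. component scale (fill l0) [x, y, y] ([(p + n, u)] @ (n', w) # []))"
          by (rule block_family_linear_on[OF G]) (use in0 u X in simp_all)
        from linear_on_scale[OF this] show "linear_on scale (W (hd [y]) (last [y]) (tdeg [] + n' + 1))
            (\<lambda>w. scale (ksign (p + n) n') (component scale (fill l0) [x, y, y] [(p + n, u), (n', w)]))"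
          by simp
      qed (use u 1 in \<open>simp_all add: defs X bring_def\<close>)
      then show ?thesis
        by simp
    qed
    have "?\<psi> (act_edge d [0] (act_disc fill (l1, ?w1) (Poly_Mapping.single [([0, 0], (p, v))] 1)))
        = scale 1 (?h (component scale (fill l1) [x, y] [(p, v)]))"
    proof (rule act_disc_edge_step[where z' = "[([0, 0], (p, v))]" and ns = "[[0, 0]]" and m = 1 and b = "[x, y]" and vs = "[(p, v)]" and h = ?h,
          OF linear_compose_smul[OF linear_compose_smul[OF linear(1) linear_act_edge] linear_act_disc] _ _ _ _ _ _ F _ _ _ ins(1) W])
      have "linear_on scale (W x y (p + n + 1))
          (\<lambda>u. component scale (fill l0) [x, y, y] ([] @ (p + n, u) # [(n', component scale (fill l2) [y] [])]))"
        by (rule block_family_linear_on[OF G]) (use in0 mem X in simp_all)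
      from linear_on_scale[OF this] show "linear_on scale (W (hd [x, y]) (last [x, y]) (tdeg [(p, v)] + n + 1)) ?h"
        by simp
    qed (use 2 in \<open>simp_all add: defs X bring_single Let_def\<close>)
    moreover have "word_outs (boundary [[x, y]] ?D) = [[]]" "zip (word_ins (boundary [[x, y]] ?D)) [(p, v)] = [([0, 0], (p, v))]"
      by (simp_all add: defs bush_def corolla_def)
    ultimately show ?B
      by (simp add: D[unfolded One_nat_def] tensor1_eval_diagram numeral_2_eq_2)
  qed
qed

end

lemma discs_with_bush:
  "discs_with Str [[x, y]] (bush Str [(Htp, 0), (Mor, 1)]) = [discs_of [[x, y]] (bush Str [(Htp, 0), (Mor, 1)]) ! 0]"
  "discs_with Htp [[x, y]] (bush Str [(Htp, 0), (Mor, 1)]) = [discs_of [[x, y]] (bush Str [(Htp, 0), (Mor, 1)]) ! 1]"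
  "discs_with Mor [[x, y]] (bush Str [(Htp, 0), (Mor, 1)]) = [discs_of [[x, y]] (bush Str [(Htp, 0), (Mor, 1)]) ! 2]"
  "discs_with Str [[x, y]] (bush Str [(Mor, 1), (Htp, 0)]) = [discs_of [[x, y]] (bush Str [(Mor, 1), (Htp, 0)]) ! 0]"
  "discs_with Mor [[x, y]] (bush Str [(Mor, 1), (Htp, 0)]) = [discs_of [[x, y]] (bush Str [(Mor, 1), (Htp, 0)]) ! 1]"
  "discs_with Htp [[x, y]] (bush Str [(Mor, 1), (Htp, 0)]) = [discs_of [[x, y]] (bush Str [(Mor, 1), (Htp, 0)]) ! 2]"
  "joint (discs_of [[x, y]] (bush Str [(Htp, 0), (Mor, 1)]) ! 1) = [0]"
  "joint (discs_of [[x, y]] (bush Str [(Htp, 0), (Mor, 1)]) ! 2) = [1]"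
  "joint (discs_of [[x, y]] (bush Str [(Mor, 1), (Htp, 0)]) ! 1) = [0]"
  "joint (discs_of [[x, y]] (bush Str [(Mor, 1), (Htp, 0)]) ! 2) = [1]"
  by (simp_all add: discs_with_def discs_of_def bush_def corolla_def joint_def numeral_2_eq_2)

lemma pre_sum_1_single_block:
  defines "D \<equiv> bush Str [(Htp, 0), (Mor, 1)]" and "D' \<equiv> bush Str [(Mor, 1), (Htp, 0)]"
    and "fill \<equiv> (\<lambda>\<Phi> M q a l. case l of Str \<Rightarrow> (\<lambda>y. M (map (map \<Phi>) y)) | Mor \<Rightarrow> a | Htp \<Rightarrow> q)"
  shows "pre_sum d 1 \<Phi> M q a [[x, y]] vs
    = grafted_value (fill \<Phi> M q a) d [x, y] Str Htp 0 1 0 vs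
    + (eval_diagram [[x, y]] D [act_disc (fill \<Phi> M q a) (discs_of [[x, y]] D ! 2), act_edge d [1],
         act_disc (fill \<Phi> M q a) (discs_of [[x, y]] D ! 1), act_edge d [0],
         act_disc (fill \<Phi> M q a) (discs_of [[x, y]] D ! 0)] vs
    + eval_diagram [[x, y]] D' [act_disc (fill \<Phi> M q a) (discs_of [[x, y]] D' ! 1), act_edge d [0],
         act_disc (fill \<Phi> M q a) (discs_of [[x, y]] D' ! 2), act_edge d [1],
         act_disc (fill \<Phi> M q a) (discs_of [[x, y]] D' ! 0)] vs)"
proof -
  have ne: "grafted Str Htp 0 1 0 \<notin> {D, D'}" "D \<noteq> D'"
    by (simp_all add: D_def D'_def bush_def grafted_def corolla_def)
  show ?thesis
    unfolding pre_sum_def star_diagrams_In_small D_def[symmetric] D'_def[symmetric]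
    using ne discs_with_bush[of x y, folded D_def D'_def]
    by (simp add: discs_with_grafted joint_grafted[unfolded One_nat_def] grafted_value_def Let_def fill_def)
qed

section \<open>Low components of the structure equations\<close>

context vector_space
begin

text \<open>In an uncurved structure an input-free inner disc feeds 0 into the root. These facts and
  the following ones remove all such trees.\<close>

lemma component_zero_slot2:
  assumes M: "block_family scale d X V W n M" and V: "graded_subspaces scale X V" and X: "x \<in> X" "y \<in> X" "z \<in> X"
  shows "v \<in> V x y (p + 1) \<Longrightarrow> component scale M [x, y, z] [(p, v), (q, 0)] = 0"
    and "v \<in> V y z (q + 1) \<Longrightarrow> component scale M [x, y, z] [(p, 0), (q, v)] = 0"
    and "component scale M [x, y] [(p, 0)] = 0"
  using component_zero_slot[OF M, of "[x, y, z]" "[(p, v)]" q "[]"] component_zero_slot[OF M, of "[x, y, z]" "[]" p "[(q, v)]"]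
    component_zero_slot[OF M, of "[x, y]" "[]" p "[]"] X subspace_0[OF graded_subspaces_component[OF V]]
  by (simp_all add: block_inputs_def)

lemma component_zero_slot3:
  assumes M: "block_family scale d X V W n M" and V: "graded_subspaces scale X V"
    and X: "x \<in> X" "y \<in> X" "z \<in> X" and v: "v \<in> V x y (p + 1)" "w \<in> V y z (q + 1)"
  shows "component scale M [x, x, y, z] [(r, 0), (p, v), (q, w)] = 0"
    and "component scale M [x, y, y, z] [(p, v), (r, 0), (q, w)] = 0"
    and "component scale M [x, y, z, z] [(p, v), (q, w), (r, 0)] = 0"
  using component_zero_slot[OF M, of "[x, x, y, z]" "[]" r "[(p, v), (q, w)]"]
    component_zero_slot[OF M, of "[x, y, y, z]" "[(p, v)]" r "[(q, w)]"]
    component_zero_slot[OF M, of "[x, y, z, z]" "[(p, v), (q, w)]" r "[]"]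
    X v subspace_0[OF graded_subspaces_component[OF V]]
  by (simp_all add: block_inputs_def)

text \<open>The first two A-infinity expressions, the square of the differential and the Leibniz
  rule; trees with an input-free disc contribute nothing.\<close>

lemma circ_nec_components:
  assumes M: "block_family scale d X V V 1 M" and V: "graded_subspaces scale X V"
    and unc: "\<And>c. c \<in> X \<Longrightarrow> component scale M [c] [] = 0"
    and X: "x \<in> X" "y \<in> X" and v: "v \<in> V x y (p + 1)"
  shows "tensor1 scale (circ_nec d M M [[x, y]] [(p, v)]) = component scale M [x, y] [(p + 1, component scale M [x, y] [(p, v)])]"
    and "z \<in> X \<Longrightarrow> w \<in> V y z (q + 1) \<Longrightarrow> tensor1 scale (circ_nec d M M [[x, y, z]] [(p, v), (q, w)])
      = component scale M [x, z] [(p + q + 1, component scale M [x, y, z] [(p, v), (q, w)])]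
      + component scale M [x, y, z] [(p + 1, component scale M [x, y] [(p, v)]), (q, w)]
      + scale (ksign q p * ksign p (q + 1)) (component scale M [x, y, z] [(p, v), (q + 1, component scale M [y, z] [(q, w)])])"
proof -
  let ?f = "\<lambda>l. case l of Inner \<Rightarrow> M | Outer \<Rightarrow> M"
  have f: "block_family scale d X V V 1 (?f Inner)" "block_family scale d X V V 1 (?f Outer)"
    using M by simp_all
  show "tensor1 scale (circ_nec d M M [[x, y]] [(p, v)]) = component scale M [x, y] [(p + 1, component scale M [x, y] [(p, v)])]"
    using value_grafted_010[OF f V V X v] value_grafted_100[OF f V V X v] value_grafted_001[OF f V V X v]
      component_zero_slot2[OF M V] X v
    by (simp add: circ_nec_single_block triples_upto_2 tensor1_simps unc)
  assume z: "z \<in> X" and w: "w \<in> V y z (q + 1)"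
  show "tensor1 scale (circ_nec d M M [[x, y, z]] [(p, v), (q, w)])
      = component scale M [x, z] [(p + q + 1, component scale M [x, y, z] [(p, v), (q, w)])]
      + component scale M [x, y, z] [(p + 1, component scale M [x, y] [(p, v)]), (q, w)]
      + scale (ksign q p * ksign p (q + 1)) (component scale M [x, y, z] [(p, v), (q + 1, component scale M [y, z] [(q, w)])])"
    using value_grafted_020[OF f V V X z v w] value_grafted_110[OF f V V X z v w] value_grafted_011[OF f V V X z v w]
      value_grafted_200[OF f V V X z v w] value_grafted_101[OF f V V X z v w] value_grafted_002[OF f V V X z v w]
      component_zero_slot3[OF M V X z v w]
    by (simp add: circ_nec_single_block triples_upto_2 tensor1_simps unc X z)
qed

lemma multinec_sum_0_component:
  assumes M: "block_family scale d X V V 1 M" and V: "graded_subspaces scale X V"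
    and unc: "\<And>c. c \<in> X \<Longrightarrow> component scale M [c] [] = 0"
    and a: "block_family scale d X V W n a" and W: "graded_subspaces scale X W"
    and X: "x \<in> X" "y \<in> X" and v: "v \<in> V x y (p + 1)"
  shows "tensor1 scale (multinec_sum d 0 q a M [[x, y]] [(p, v)])
    = component scale a [x, y] [(p + 1, component scale M [x, y] [(p, v)])]"
proof -
  let ?f = "\<lambda>l. case l of Str \<Rightarrow> M | Mor \<Rightarrow> a | Htp \<Rightarrow> q"
  have f: "block_family scale d X V V 1 (?f Str)" "block_family scale d X V W n (?f Mor)"
    using M a by simp_all
  show ?thesis
    using value_grafted_010[OF f V W X v] value_grafted_100[OF f V W X v] value_grafted_001[OF f V W X v]
      component_zero_slot2[OF a V] X v
    by (simp add: multinec_sum_single_block[where ?l0.0 = Mor] triples_upto_2 tensor1_simps unc)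
qed

text \<open>The homotopy disc is the root and reads the output of the structure, which is zero
  without inputs and the differential on one input.\<close>

lemma multinec_sum_1_component:
  assumes M: "block_family scale d X V V 1 M" and V: "graded_subspaces scale X V"
    and unc: "\<And>c. c \<in> X \<Longrightarrow> component scale M [c] [] = 0"
    and q: "block_family scale d X V W n q" and W: "graded_subspaces scale X W"
    and X: "x \<in> X"
  shows "tensor1 scale (multinec_sum d 1 q a M [[x]] []) = 0"
    and "y \<in> X \<Longrightarrow> v \<in> V x y (p + 1) \<Longrightarrow> tensor1 scale (multinec_sum d 1 q a M [[x, y]] [(p, v)])
      = component scale q [x, y] [(p + 1, component scale M [x, y] [(p, v)])]"
proof -
  let ?f = "\<lambda>l. case l of Str \<Rightarrow> M | Mor \<Rightarrow> a | Htp \<Rightarrow> q"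
  have f: "block_family scale d X V V 1 (?f Str)" "block_family scale d X V W n (?f Htp)"
    using M q by simp_all
  show "tensor1 scale (multinec_sum d 1 q a M [[x]] []) = 0"
    using value_grafted_000[OF f V W X] component_zero_slot2[OF q V] X
    by (simp add: multinec_sum_single_block[where ?l0.0 = Htp, unfolded One_nat_def] triples_upto_2 tensor1_simps unc)
  assume y: "y \<in> X" and v: "v \<in> V x y (p + 1)"
  show "tensor1 scale (multinec_sum d 1 q a M [[x, y]] [(p, v)])
      = component scale q [x, y] [(p + 1, component scale M [x, y] [(p, v)])]"
    using value_grafted_010[OF f V W X y v] value_grafted_100[OF f V W X y v] value_grafted_001[OF f V W X y v]
      component_zero_slot2[OF q V] X y v
    by (simp add: multinec_sum_single_block[where ?l0.0 = Htp, unfolded One_nat_def] triples_upto_2 tensor1_simps unc)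
qed

text \<open>The last formula is the origin of the flow equation: besides the boundary of the
  homotopy it contains the products of \<open>a\<close> with the input-free components of
  \<open>q\<close>.\<close>

lemma pre_sum_components:
  assumes M: "block_family scale d X W W 1 (\<lambda>y. M (map (map \<Phi>) y))"
    and W: "graded_subspaces scale X W" and X: "x \<in> X"
  shows "block_family scale d X V W n a \<Longrightarrow> y \<in> X \<Longrightarrow> v \<in> V x y (p + 1) \<Longrightarrow>
      tensor1 scale (pre_sum d 0 \<Phi> M q a [[x, y]] [(p, v)])
      = component scale M [\<Phi> x, \<Phi> y] [(p + n, component scale a [x, y] [(p, v)])]"
    and "block_family scale d X V W n q \<Longrightarrow> tensor1 scale (pre_sum d 1 \<Phi> M q a [[x]] [])
      = component scale M [\<Phi> x, \<Phi> x] [(n, component scale q [x] [])]"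
    and "block_family scale d X V W n a \<Longrightarrow> block_family scale d X V W n' q \<Longrightarrow> y \<in> X \<Longrightarrow> v \<in> V x y (p + 1) \<Longrightarrow>
      tensor1 scale (pre_sum d 1 \<Phi> M q a [[x, y]] [(p, v)])
      = component scale M [\<Phi> x, \<Phi> y] [(p + n', component scale q [x, y] [(p, v)])]
      + (component scale M [\<Phi> x, \<Phi> x, \<Phi> y] [(n', component scale q [x] []), (p + n, component scale a [x, y] [(p, v)])]
      + scale (ksign (p + n) n') (component scale M [\<Phi> x, \<Phi> y, \<Phi> y]
          [(p + n, component scale a [x, y] [(p, v)]), (n', component scale q [y] [])]))"
proof -
  let ?f = "\<lambda>l. case l of Str \<Rightarrow> (\<lambda>y. M (map (map \<Phi>) y)) | Mor \<Rightarrow> a | Htp \<Rightarrow> q"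
  have S: "block_family scale d X W W 1 (?f Str)"
    using M by simp
  show "tensor1 scale (pre_sum d 0 \<Phi> M q a [[x, y]] [(p, v)])
      = component scale M [\<Phi> x, \<Phi> y] [(p + n, component scale a [x, y] [(p, v)])]"
    if a: "block_family scale d X V W n a" and y: "y \<in> X" "v \<in> V x y (p + 1)"
  proof -
    have "block_family scale d X V W n (?f Mor)"
      using a by simp
    from value_grafted_010[OF this S W W X y] show ?thesis
      by (simp add: pre_sum_0_single_block component_def)
  qed
  show "tensor1 scale (pre_sum d 1 \<Phi> M q a [[x]] []) = component scale M [\<Phi> x, \<Phi> x] [(n, component scale q [x] [])]"
    if q: "block_family scale d X V W n q"
  proof -
    have "block_family scale d X V W n (?f Htp)"
      using q by simp
    from value_grafted_000[OF this S W W X] show ?thesis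
      by (simp add: pre_sum_1_object[unfolded One_nat_def] component_def)
  qed
  show "tensor1 scale (pre_sum d 1 \<Phi> M q a [[x, y]] [(p, v)])
      = component scale M [\<Phi> x, \<Phi> y] [(p + n', component scale q [x, y] [(p, v)])]
      + (component scale M [\<Phi> x, \<Phi> x, \<Phi> y] [(n', component scale q [x] []), (p + n, component scale a [x, y] [(p, v)])]
      + scale (ksign (p + n) n') (component scale M [\<Phi> x, \<Phi> y, \<Phi> y]
          [(p + n, component scale a [x, y] [(p, v)]), (n', component scale q [y] [])]))"
    if a: "block_family scale d X V W n a" and q: "block_family scale d X V W n' q" and y: "y \<in> X" "v \<in> V x y (p + 1)"
  proof -
    have f: "block_family scale d X V W n (?f Mor)" "block_family scale d X V W n' (?f Htp)"
      using a q by simp_all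
    show ?thesis
      unfolding pre_sum_1_single_block tensor1_simps value_bush[OF f S W W X y] value_grafted_010[OF f(2) S W W X y]
      by (simp add: component_def)
  qed
qed

lemma fam_comp_component:
  assumes F: "block_family scale d X V W 0 F" and G: "block_family scale d X W U 0 (\<lambda>y. G (map (map \<Phi>) y))"
    and W: "graded_subspaces scale X W" and U: "graded_subspaces scale X U"
    and X: "x \<in> X" "y \<in> X" and v: "v \<in> V x y (p + 1)"
  shows "tensor1 scale (fam_comp d \<Phi> G F [[x, y]] [(p, v)])
    = component scale G [\<Phi> x, \<Phi> y] [(p, component scale F [x, y] [(p, v)])]"
proof -
  let ?f = "\<lambda>l. case l of Inner \<Rightarrow> F | Outer \<Rightarrow> (\<lambda>y. G (map (map \<Phi>) y))"
  have "block_family scale d X V W 0 (?f Inner)" "block_family scale d X W U 0 (?f Outer)"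
    using F G by simp_all
  from value_grafted_010[OF this W U X v] show ?thesis
    by (simp add: fam_comp_single_block component_def)
qed

end

section \<open>Cohomology\<close>

definition cocycles ::
  "('k::field \<Rightarrow> 'v::ab_group_add \<Rightarrow> 'v) \<Rightarrow> ('o, 'v) quiver \<Rightarrow> ('o, 'v, 'k) family \<Rightarrow> 'o \<Rightarrow> 'o \<Rightarrow> int \<Rightarrow> 'v set" where
  "cocycles scale A M x y i = {v \<in> Sp A x y (i + 1). component scale M [x, y] [(i, v)] = 0}"

text \<open>Degrees are those in A[1], so a primitive of degree i - 1 lies in
  \<open>Sp A x y i\<close>.\<close>

definition coboundaries ::
  "('k::field \<Rightarrow> 'v::ab_group_add \<Rightarrow> 'v) \<Rightarrow> ('o, 'v) quiver \<Rightarrow> ('o, 'v, 'k) family \<Rightarrow> 'o \<Rightarrow> 'o \<Rightarrow> int \<Rightarrow> 'v set" where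
  "coboundaries scale A M x y i = (\<lambda>v. component scale M [x, y] [(i - 1, v)]) ` Sp A x y i"

context vector_space
begin

lemma linear_on_zero:
  assumes "subspace V" "linear_on scale V h"
  shows "h 0 = 0"
  using linear_onD[OF assms(2) subspace_0[OF assms(1)] subspace_0[OF assms(1)], of 1] by simp

lemma linear_on_sum:
  assumes V: "subspace V" and h: "linear_on scale V h" and f: "\<And>j. j \<in> J \<Longrightarrow> f j \<in> V"
  shows "h (\<Sum>j\<in>J. scale (c j) (f j)) = (\<Sum>j\<in>J. scale (c j) (h (f j)))"
proof -
  note h0 = linear_on_zero[OF V h]
  show ?thesis
    using f
  proof (induction J rule: infinite_finite_induct)
    case (insert j J)
    have "(\<Sum>j\<in>J. scale (c j) (f j)) \<in> V"
      using insert.prems by (intro subspace_sum[OF V] subspace_scale[OF V]) auto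
    then show ?case
      using insert linear_onD[OF h, of "\<Sum>j\<in>J. scale (c j) (f j)" "f j" "c j"] by (simp add: add.commute)
  qed (simp_all add: h0)
qed

lemma linear_on_simps:
  assumes V: "subspace V" and h: "linear_on scale V h" and v: "v \<in> V" "w \<in> V"
  shows "h (v + w) = h v + h w" "h (v - w) = h v - h w" "h (scale c v) = scale c (h v)"
proof -
  show "h (v + w) = h v + h w" "h (v - w) = h v - h w"
    using linear_onD[OF h v, of 1] linear_onD[OF h v, of "- 1"] by simp_all
  show "h (scale c v) = scale c (h v)"
    using linear_onD[OF h subspace_0[OF V] v(1), of c] by (simp add: linear_on_zero[OF V h])
qed

lemma subspace_kernel_on:
  assumes V: "subspace V" and h: "linear_on scale V h"
  shows "subspace {v \<in> V. h v = 0}"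
  by (rule subspaceI) (auto simp: linear_on_simps[OF V h] linear_on_zero[OF V h] subspace_0[OF V] subspace_add[OF V] subspace_scale[OF V])

lemma subspace_image_on:
  assumes V: "subspace V" and h: "linear_on scale V h"
  shows "subspace (h ` V)"
proof (rule subspaceI)
  show "0 \<in> h ` V"
    using linear_on_zero[OF V h] subspace_0[OF V] by force
  show "u + w \<in> h ` V" if "u \<in> h ` V" "w \<in> h ` V" for u w
    using that linear_on_simps(1)[OF V h] subspace_add[OF V] by (metis (no_types, lifting) imageE imageI)
  show "scale c u \<in> h ` V" if "u \<in> h ` V" for c u
    using that linear_on_simps(3)[OF V h] subspace_scale[OF V] by (metis (no_types, lifting) imageE imageI)
qed

lemma bij_betw_cohomology:
  assumes V: "\<And>i. subspace (V i)" and W: "\<And>i. subspace (W i)"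
    and \<delta>: "cochain_complex scale V \<delta>" and \<epsilon>: "cochain_complex scale W \<epsilon>" and f: "chain_map scale V \<delta> W \<epsilon> f"
    and inj: "\<And>v. v \<in> V i \<Longrightarrow> \<delta> i v = 0 \<Longrightarrow> f i v \<in> \<epsilon> (i - 1) ` W (i - 1) \<Longrightarrow> v \<in> \<delta> (i - 1) ` V (i - 1)"
    and surj: "\<And>w. w \<in> W i \<Longrightarrow> \<epsilon> i w = 0 \<Longrightarrow> \<exists>v\<in>V i. \<delta> i v = 0 \<and> f i v - w \<in> \<epsilon> (i - 1) ` W (i - 1)"
  shows "bij_betw (\<lambda>C. cohomologous W \<epsilon> i `` (f i ` C)) (cohomology V \<delta> i) (cohomology W \<epsilon> i)"
proof -
  let ?ZV = "{v \<in> V i. \<delta> i v = 0}" and ?ZW = "{w \<in> W i. \<epsilon> i w = 0}"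
  have lin: "linear_on scale (V j) (\<delta> j)" "linear_on scale (W j) (\<epsilon> j)" "linear_on scale (V j) (f j)" for j
    using \<delta> \<epsilon> f unfolding cochain_complex_def chain_map_def graded_linear_def linear_on_def by blast+
  have comm: "v \<in> V j \<Longrightarrow> f (j + 1) (\<delta> j v) = \<epsilon> j (f j v)" for v j
    using f unfolding chain_map_def by blast
  have f_mem: "v \<in> V j \<Longrightarrow> f j v \<in> W j" for v j
    using f unfolding chain_map_def graded_linear_def by (metis add.right_neutral)
  have BV: "subspace (\<delta> (i - 1) ` V (i - 1))" and BW: "subspace (\<epsilon> (i - 1) ` W (i - 1))"
    by (rule subspace_image_on[OF V lin(1)], rule subspace_image_on[OF W lin(2)])
  have equiv: "equiv {v \<in> U i. \<eta> i v = 0} (cohomologous U \<eta> i)"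
    if B: "subspace (\<eta> (i - 1) ` U (i - 1))" for U :: "int \<Rightarrow> 'b set" and \<eta>
  proof (rule equivI)
    show "cohomologous U \<eta> i \<subseteq> {v \<in> U i. \<eta> i v = 0} \<times> {v \<in> U i. \<eta> i v = 0}"
      by (auto simp: cohomologous_def)
    show "refl_on {v \<in> U i. \<eta> i v = 0} (cohomologous U \<eta> i)"
      using subspace_0[OF B] by (auto simp: refl_on_def cohomologous_def)
    show "sym (cohomologous U \<eta> i)"
    proof (rule symI)
      fix u v assume "(u, v) \<in> cohomologous U \<eta> i"
      then show "(v, u) \<in> cohomologous U \<eta> i"
        using subspace_neg[OF B, of "u - v"] by (simp add: cohomologous_def)
    qed
    show "trans (cohomologous U \<eta> i)"
    proof (rule transI)
      fix u v w assume "(u, v) \<in> cohomologous U \<eta> i" "(v, w) \<in> cohomologous U \<eta> i"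
      then show "(u, w) \<in> cohomologous U \<eta> i"
        using subspace_add[OF B, of "u - v" "v - w"] by (simp add: cohomologous_def)
    qed
  qed
  note eqV = equiv[where U = V and \<eta> = \<delta>, OF BV] and eqW = equiv[where U = W and \<eta> = \<epsilon>, OF BW]
  have fZ: "f i v \<in> ?ZW" if "v \<in> ?ZV" for v
  proof -
    have "\<epsilon> i (f i v) = f (i + 1) (\<delta> i v)"
      using comm[of v i, symmetric] that by simp
    also have "\<dots> = 0"
      using that linear_on_zero[OF V lin(3)] by simp
    finally show ?thesis
      using that f_mem by simp
  qed
  have rel: "(u, v) \<in> cohomologous V \<delta> i \<longleftrightarrow> (f i u, f i v) \<in> cohomologous W \<epsilon> i" if "u \<in> ?ZV" "v \<in> ?ZV" for u v
  proof
    assume "(u, v) \<in> cohomologous V \<delta> i"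
    then obtain w where w: "u - v = \<delta> (i - 1) w" "w \<in> V (i - 1)"
      by (auto simp: cohomologous_def)
    have "f i u - f i v = f i (u - v)"
      using linear_on_simps(2)[OF V lin(3)] that by simp
    also have "\<dots> = \<epsilon> (i - 1) (f (i - 1) w)"
      using comm[OF w(2)] w(1) by simp
    finally show "(f i u, f i v) \<in> cohomologous W \<epsilon> i"
      using fZ[OF that(1)] fZ[OF that(2)] f_mem[OF w(2)] by (auto simp: cohomologous_def)
  next
    assume "(f i u, f i v) \<in> cohomologous W \<epsilon> i"
    then have "f i (u - v) \<in> \<epsilon> (i - 1) ` W (i - 1)"
      using linear_on_simps(2)[OF V lin(3), of u i v] that by (simp add: cohomologous_def)
    moreover have "u - v \<in> V i" "\<delta> i (u - v) = 0"
      using that linear_on_simps(2)[OF V lin(1), of u i v] subspace_diff[OF V] by simp_all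
    ultimately show "(u, v) \<in> cohomologous V \<delta> i"
      using inj[of "u - v"] that by (simp add: cohomologous_def)
  qed
  have cls: "cohomologous W \<epsilon> i `` (f i ` (cohomologous V \<delta> i `` {v})) = cohomologous W \<epsilon> i `` {f i v}" if "v \<in> ?ZV" for v
  proof (intro equalityI subsetI)
    fix w assume "w \<in> cohomologous W \<epsilon> i `` (f i ` (cohomologous V \<delta> i `` {v}))"
    then obtain u where u: "(v, u) \<in> cohomologous V \<delta> i" "(f i u, w) \<in> cohomologous W \<epsilon> i"
      by auto
    then have "u \<in> ?ZV"
      by (simp add: cohomologous_def)
    with u rel[OF that this] have "(f i v, f i u) \<in> cohomologous W \<epsilon> i"
      by simp
    with u(2) eqW show "w \<in> cohomologous W \<epsilon> i `` {f i v}"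
      unfolding equiv_def by (auto dest: transD)
  next
    fix w assume "w \<in> cohomologous W \<epsilon> i `` {f i v}"
    moreover have "(v, v) \<in> cohomologous V \<delta> i"
      using eqV that unfolding equiv_def by (auto dest: refl_onD)
    ultimately show "w \<in> cohomologous W \<epsilon> i `` (f i ` (cohomologous V \<delta> i `` {v}))"
      by blast
  qed
  show ?thesis
    unfolding bij_betw_def
  proof
    show "inj_on (\<lambda>C. cohomologous W \<epsilon> i `` (f i ` C)) (cohomology V \<delta> i)"
    proof (rule inj_onI)
      fix C C' assume "C \<in> cohomology V \<delta> i" "C' \<in> cohomology V \<delta> i"
        and eq: "cohomologous W \<epsilon> i `` (f i ` C) = cohomologous W \<epsilon> i `` (f i ` C')"
      then obtain v v' where v: "v \<in> ?ZV" "C = cohomologous V \<delta> i `` {v}"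
        and v': "v' \<in> ?ZV" "C' = cohomologous V \<delta> i `` {v'}"
        unfolding cohomology_def by (auto elim!: quotientE)
      have "(f i v, f i v') \<in> cohomologous W \<epsilon> i"
        using eq unfolding v(2) v'(2) cls[OF v(1)] cls[OF v'(1)]
        by (rule eq_equiv_class[OF _ eqW fZ[OF v'(1)]])
      then show "C = C'"
        unfolding v(2) v'(2) using rel[OF v(1) v'(1)] equiv_class_eq[OF eqV] by blast
    qed
    show "(\<lambda>C. cohomologous W \<epsilon> i `` (f i ` C)) ` cohomology V \<delta> i = cohomology W \<epsilon> i"
    proof (intro equalityI subsetI)
      fix D assume "D \<in> (\<lambda>C. cohomologous W \<epsilon> i `` (f i ` C)) ` cohomology V \<delta> i"
      then obtain v where "v \<in> ?ZV" "D = cohomologous W \<epsilon> i `` (f i ` (cohomologous V \<delta> i `` {v}))"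
        unfolding cohomology_def by (auto elim!: quotientE)
      then show "D \<in> cohomology W \<epsilon> i"
        unfolding cohomology_def using cls fZ by (auto intro!: quotientI)
    next
      fix D assume "D \<in> cohomology W \<epsilon> i"
      then obtain w where w: "w \<in> ?ZW" "D = cohomologous W \<epsilon> i `` {w}"
        unfolding cohomology_def by (auto elim!: quotientE)
      then obtain v where v: "v \<in> ?ZV" "f i v - w \<in> \<epsilon> (i - 1) ` W (i - 1)"
        using surj[of w] by auto
      then have "(f i v, w) \<in> cohomologous W \<epsilon> i"
        using fZ[OF v(1)] w(1) by (simp add: cohomologous_def)
      then have "D = cohomologous W \<epsilon> i `` (f i ` (cohomologous V \<delta> i `` {v}))"
        using equiv_class_eq[OF eqW] cls[OF v(1)] w(2) by metis
      moreover have "cohomologous V \<delta> i `` {v} \<in> cohomology V \<delta> i"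
        unfolding cohomology_def using v(1) by (rule quotientI)
      ultimately show "D \<in> (\<lambda>C. cohomologous W \<epsilon> i `` (f i ` C)) ` cohomology V \<delta> i"
        by blast
    qed
  qed
qed

lemma pcy_categoryD:
  assumes "pcy_category scale d A M"
  shows "graded_subspaces scale (Obj A) (Sp A)"
    and "block_family scale d (Obj A) (Sp A) (Sp A) 1 M"
    and "x \<in> Obj A \<Longrightarrow> component scale M [x] [] = 0"
proof -
  show "graded_subspaces scale (Obj A) (Sp A)"
    using assms by (simp add: pcy_category_def graded_quiver_def graded_subspaces_def)
  show "block_family scale d (Obj A) (Sp A) (Sp A) 1 M"
    using h_elem_block_family[of d A A id 1 M] assms by (simp add: pcy_category_def pcy_structure_def)
  show "component scale M [x] [] = 0" if "x \<in> Obj A"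
  proof -
    have "tensor_eq scale (M [[x]] []) 0"
      using assms that by (simp add: pcy_category_def pcy_structure_def uncurved_def)
    from tensor1_cong[OF this] show ?thesis
      by (simp add: component_def tensor1_simps)
  qed
qed

lemma fam_eq_tensor1:
  assumes "fam_eq scale A F G" "b \<noteq> []" "set b \<subseteq> Obj A" "block_inputs (Sp A) b vs"
  shows "tensor1 scale (F [b] vs) = tensor1 scale (G [b] vs)"
  using assms by (intro tensor1_cong) (auto simp: fam_eq_def types_single_block inputs_single_block)

text \<open>Since M is odd, the sign in the bracket turns the difference into twice the necklace
  product, and 2 is invertible.\<close>

lemma circ_nec_zero:
  assumes M: "pcy_category scale d A M" and char: "CHAR('a) \<noteq> 2"
    and b: "b \<noteq> []" "set b \<subseteq> Obj A" "block_inputs (Sp A) b vs"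
  shows "tensor1 scale (circ_nec d M M [b] vs) = 0"
proof -
  have "fam_eq scale A (nec_bracket d 1 1 M M) (\<lambda>_ _. 0)"
    using M by (simp add: pcy_category_def pcy_structure_def)
  from fam_eq_tensor1[OF this b] have "tensor1 scale (circ_nec d M M [b] vs) + tensor1 scale (circ_nec d M M [b] vs) = 0"
    by (simp add: nec_bracket_def tensor1_simps ksign_def)
  then have "scale (of_nat 2) (tensor1 scale (circ_nec d M M [b] vs)) = 0"
    using scale_left_distrib[of 1 1 "tensor1 scale (circ_nec d M M [b] vs)"] by simp
  \<comment> \<open>A characteristic dividing 2 is 1 or 2; the value 1 would mean 1 = 0 in the
    field.\<close>
  moreover have "of_nat 2 \<noteq> (0 :: 'a)"
  proof
    assume "of_nat 2 = (0 :: 'a)"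
    then have "CHAR('a) dvd 2"
      using of_nat_eq_0_iff_char_dvd by blast
    then have "CHAR('a) = 1"
      using char two_is_prime_nat prime_nat_iff by blast
    then show False
      using of_nat_CHAR[where 'a = 'a] by simp
  qed
  ultimately show ?thesis
    by (metis scale_eq_0_iff)
qed

context
  fixes d :: int and A :: "('o, 'b) quiver" and M :: "('o, 'b, 'a) family"
  assumes M: "pcy_category scale d A M" and char2: "CHAR('a) \<noteq> 2"
begin

lemma subspace_Sp: "x \<in> Obj A \<Longrightarrow> y \<in> Obj A \<Longrightarrow> subspace (Sp A x y i)"
  using graded_subspaces_component[OF pcy_categoryD(1)[OF M]] by blast

lemma differential_linear:
  assumes "x \<in> Obj A" "y \<in> Obj A"
  shows "linear_on scale (Sp A x y (i + 1)) (\<lambda>v. component scale M [x, y] [(i, v)])"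
  using block_family_linear_on[OF pcy_categoryD(2)[OF M], of "[x, y]" "Sp A x y (i + 1)" "[]" i "[]"] assms
  by (simp add: block_inputs_def)

lemma differential_mem:
  assumes "x \<in> Obj A" "y \<in> Obj A" "v \<in> Sp A x y (i + 1)"
  shows "component scale M [x, y] [(i, v)] \<in> Sp A x y (i + 1 + 1)"
  using component_mem[OF pcy_categoryD(2)[OF M] _ _ _ pcy_categoryD(1)[OF M], of "[x, y]" "[(i, v)]"] assms
  by (simp add: block_inputs_def)

lemma product_mem:
  assumes "x \<in> Obj A" "y \<in> Obj A" "z \<in> Obj A" "v \<in> Sp A x y (p + 1)" "w \<in> Sp A y z (q + 1)"
  shows "component scale M [x, y, z] [(p, v), (q, w)] \<in> Sp A x z (p + q + 1 + 1)"
  using component_mem[OF pcy_categoryD(2)[OF M] _ _ _ pcy_categoryD(1)[OF M], of "[x, y, z]" "[(p, v), (q, w)]"] assms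
  by (simp add: block_inputs_def)

lemma product_linear:
  assumes X: "x \<in> Obj A" "y \<in> Obj A" "z \<in> Obj A"
  shows "v \<in> Sp A x y (p + 1) \<Longrightarrow> linear_on scale (Sp A y z (q + 1)) (\<lambda>w. component scale M [x, y, z] [(p, v), (q, w)])"
    and "w \<in> Sp A y z (q + 1) \<Longrightarrow> linear_on scale (Sp A x y (p + 1)) (\<lambda>v. component scale M [x, y, z] [(p, v), (q, w)])"
  using block_family_linear_on[OF pcy_categoryD(2)[OF M], of "[x, y, z]" "Sp A y z (q + 1)" "[(p, v)]" q "[]"]
    block_family_linear_on[OF pcy_categoryD(2)[OF M], of "[x, y, z]" "Sp A x y (p + 1)" "[]" p "[(q, w)]"] X
  by (simp_all add: block_inputs_def)

lemma differential_square:
  assumes "x \<in> Obj A" "y \<in> Obj A" "v \<in> Sp A x y (i + 1)"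
  shows "component scale M [x, y] [(i + 1, component scale M [x, y] [(i, v)])] = 0"
  using circ_nec_zero[OF M char2, of "[x, y]" "[(i, v)]"]
    circ_nec_components(1)[OF pcy_categoryD(2)[OF M] pcy_categoryD(1)[OF M] pcy_categoryD(3)[OF M] assms] assms
  by (simp add: block_inputs_def)

lemma cocycles_subspace: "x \<in> Obj A \<Longrightarrow> y \<in> Obj A \<Longrightarrow> subspace (cocycles scale A M x y i)"
  unfolding cocycles_def by (rule subspace_kernel_on[OF subspace_Sp differential_linear])

lemma coboundaries_subspace: "x \<in> Obj A \<Longrightarrow> y \<in> Obj A \<Longrightarrow> subspace (coboundaries scale A M x y i)"
  unfolding coboundaries_def using subspace_image_on[OF subspace_Sp differential_linear, of x y "i - 1"] by simp

lemma coboundaries_subset: "x \<in> Obj A \<Longrightarrow> y \<in> Obj A \<Longrightarrow> coboundaries scale A M x y i \<subseteq> cocycles scale A M x y i"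
  unfolding coboundaries_def cocycles_def
  using differential_square[of x y _ "i - 1"] differential_mem[of x y _ "i - 1"] by auto

text \<open>The A-infinity relation with two inputs. The uncancelled sign in the last term amounts
  to (-1)^p.\<close>

lemma leibniz:
  assumes X: "x \<in> Obj A" "y \<in> Obj A" "z \<in> Obj A" and v: "v \<in> Sp A x y (p + 1)" "w \<in> Sp A y z (q + 1)"
  shows "component scale M [x, z] [(p + q + 1, component scale M [x, y, z] [(p, v), (q, w)])]
      + component scale M [x, y, z] [(p + 1, component scale M [x, y] [(p, v)]), (q, w)]
      + scale (ksign q p * ksign p (q + 1)) (component scale M [x, y, z] [(p, v), (q + 1, component scale M [y, z] [(q, w)])]) = 0"
  using circ_nec_zero[OF M char2, of "[x, y, z]" "[(p, v), (q, w)]"]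
    circ_nec_components(2)[OF pcy_categoryD(2)[OF M] pcy_categoryD(1)[OF M] pcy_categoryD(3)[OF M] X(1,2) v(1) X(3) v(2)] X v
  by (simp add: block_inputs_def)

text \<open>
  Multiplication with a cocycle of degree \<open>0\<close> in \<open>A\<close>, i.e. of degree \<open>- 1\<close> in \<open>A[1]\<close>, is up to sign a chain map.
\<close>

lemma multiplication_left:
  assumes X: "x \<in> Obj A" "y \<in> Obj A" and \<beta>: "\<beta> \<in> Sp A x x 0" "component scale M [x, x] [(- 1, \<beta>)] = 0"
  shows "u \<in> cocycles scale A M x y i \<Longrightarrow> component scale M [x, x, y] [(- 1, \<beta>), (i, u)] \<in> cocycles scale A M x y i"
    and "u \<in> coboundaries scale A M x y i \<Longrightarrow> component scale M [x, x, y] [(- 1, \<beta>), (i, u)] \<in> coboundaries scale A M x y i"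
proof -
  have \<beta>': "\<beta> \<in> Sp A x x (- 1 + 1)"
    using \<beta> by simp
  note zero = component_zero_slot2[OF pcy_categoryD(2)[OF M] pcy_categoryD(1)[OF M] X(1,1,2)]
  show "component scale M [x, x, y] [(- 1, \<beta>), (i, u)] \<in> cocycles scale A M x y i" if "u \<in> cocycles scale A M x y i"
    using that leibniz[OF X(1,1,2) \<beta>', of u i] product_mem[OF X(1,1,2) \<beta>', of u i] zero(1)[OF \<beta>'] zero(2)[of u i] \<beta>(2)
    by (simp add: cocycles_def)
  show "component scale M [x, x, y] [(- 1, \<beta>), (i, u)] \<in> coboundaries scale A M x y i" if u: "u \<in> coboundaries scale A M x y i"
  proof -
    obtain w where w: "w \<in> Sp A x y i" "u = component scale M [x, y] [(i - 1, w)]"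
      using u by (auto simp: coboundaries_def)
    \<comment> \<open>If \<open>w\<close> is a primitive of \<open>u\<close>, then up to sign the
      product of \<beta> and \<open>w\<close> is a primitive of the product of \<beta> and
      \<open>u\<close>, because \<beta> is a cocycle.\<close>
    let ?b = "component scale M [x, y] [(i - 1, component scale M [x, x, y] [(- 1, \<beta>), (i - 1, w)])]"
    define s :: 'a where "s = ksign (i - 1) (- 1) * ksign (- 1) i"
    have s: "s \<noteq> 0"
      by (simp add: s_def)
    have "?b \<in> coboundaries scale A M x y i"
      using product_mem[OF X(1,1,2) \<beta>', of w "i - 1"] w(1) by (simp add: coboundaries_def)
    moreover have eq: "?b + scale s (component scale M [x, x, y] [(- 1, \<beta>), (i, u)]) = 0"
      using leibniz[OF X(1,1,2) \<beta>', of w "i - 1"] zero(2)[of w "i - 1"] \<beta>(2) w by (simp add: s_def)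
    moreover have "component scale M [x, x, y] [(- 1, \<beta>), (i, u)] = scale (- inverse s) ?b"
    proof -
      have "?b = - scale s (component scale M [x, x, y] [(- 1, \<beta>), (i, u)])"
        using eq by (simp add: eq_neg_iff_add_eq_0)
      then show ?thesis
        by (simp add: s)
    qed
    ultimately show ?thesis
      using subspace_scale[OF coboundaries_subspace[OF X]] by metis
  qed
qed

lemma multiplication_right:
  assumes X: "x \<in> Obj A" "y \<in> Obj A" and \<beta>: "\<beta> \<in> Sp A y y 0" "component scale M [y, y] [(- 1, \<beta>)] = 0"
  shows "u \<in> cocycles scale A M x y i \<Longrightarrow> component scale M [x, y, y] [(i, u), (- 1, \<beta>)] \<in> cocycles scale A M x y i"
    and "u \<in> coboundaries scale A M x y i \<Longrightarrow> component scale M [x, y, y] [(i, u), (- 1, \<beta>)] \<in> coboundaries scale A M x y i"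
proof -
  have \<beta>': "\<beta> \<in> Sp A y y (- 1 + 1)"
    using \<beta> by simp
  note zero = component_zero_slot2[OF pcy_categoryD(2)[OF M] pcy_categoryD(1)[OF M] X(1,2,2)]
  show "component scale M [x, y, y] [(i, u), (- 1, \<beta>)] \<in> cocycles scale A M x y i" if "u \<in> cocycles scale A M x y i"
    using that leibniz[OF X(1,2,2) _ \<beta>', of u i] product_mem[OF X(1,2,2) _ \<beta>', of u i] zero(1)[of u i] zero(2)[OF \<beta>'] \<beta>(2)
    by (simp add: cocycles_def)
  show "component scale M [x, y, y] [(i, u), (- 1, \<beta>)] \<in> coboundaries scale A M x y i" if u: "u \<in> coboundaries scale A M x y i"
  proof -
    obtain w where w: "w \<in> Sp A x y i" "u = component scale M [x, y] [(i - 1, w)]"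
      using u by (auto simp: coboundaries_def)
    let ?b = "component scale M [x, y] [(i - 1, component scale M [x, y, y] [(i - 1, w), (- 1, \<beta>)])]"
    have "?b \<in> coboundaries scale A M x y i"
      using product_mem[OF X(1,2,2) _ \<beta>', of w "i - 1"] w(1) by (simp add: coboundaries_def)
    \<comment> \<open>On this side the sign of the Leibniz rule stands at the term with the
      differential of \<beta>, which is zero.\<close>
    moreover have "?b + component scale M [x, y, y] [(i, u), (- 1, \<beta>)] = 0"
      using leibniz[OF X(1,2,2) _ \<beta>', of w "i - 1"] zero(1)[of w "i - 1"] \<beta>(2) w by simp
    ultimately show ?thesis
      using subspace_neg[OF coboundaries_subspace[OF X]] by (metis add.commute eq_neg_iff_add_eq_0)
  qed
qed

end

section \<open>Polynomial families and the flow of a homotopy\<close>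

lemma component_fam_poly:
  "component scale (fam_poly a t) b vs = (\<Sum>j<length a. scale (t ^ j) (component scale (a ! j) b vs))"
  by (simp add: component_def fam_poly_def tensor1_simps)

lemma component_fam_poly_deriv:
  "component scale (fam_poly_deriv a t) b vs = (\<Sum>j<length a. scale (of_nat j * t ^ (j - 1)) (component scale (a ! j) b vs))"
  by (simp add: component_def fam_poly_deriv_def tensor1_simps)

lemma block_family_fam_poly:
  assumes a: "\<And>f. f \<in> set a \<Longrightarrow> block_family scale d X V W n f"
  shows "block_family scale d X V W n (fam_poly a t)"
  unfolding block_family_def
proof (intro allI impI conjI ballI)
  fix b assume b: "b \<noteq> [] \<and> set b \<subseteq> X"
  show "\<exists>u\<in>W (hd b) (last b) (tdeg vs + n + 1). ws = [(tdeg vs + n + (d + 1), u)]"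
    if vs: "block_inputs V b vs" and ws: "ws \<in> Poly_Mapping.keys (fam_poly a t [b] vs)" for vs ws
  proof -
    have "(\<Sum>j<length a. Poly_Mapping.lookup (smul (t ^ j) ((a ! j) [b] vs)) ws) \<noteq> 0"
      using ws by (simp add: in_keys_iff fam_poly_def lookup_sum)
    then obtain j where "j < length a" "Poly_Mapping.lookup ((a ! j) [b] vs) ws \<noteq> 0"
      by (metis (no_types, lifting) lessThan_iff lookup_smul mult_zero_right sum.neutral)
    then have "block_family scale d X V W n (a ! j)" "ws \<in> Poly_Mapping.keys ((a ! j) [b] vs)"
      by (simp_all add: a in_keys_iff)
    then show ?thesis
      using block_family_keys[of d X V W n "a ! j" b vs ws] b vs by metis
  qed
  show "tensor1 scale (fam_poly a t [b] (us @ (i, v + scale c v') # ws))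
      = tensor1 scale (fam_poly a t [b] (us @ (i, v) # ws)) + scale c (tensor1 scale (fam_poly a t [b] (us @ (i, v') # ws)))"
    if vs: "block_inputs V b (us @ (i, v) # ws) \<and> block_inputs V b (us @ (i, v') # ws)" for us i v v' ws c
  proof -
    have "component scale (a ! j) b (us @ (i, v + scale c v') # ws)
        = component scale (a ! j) b (us @ (i, v) # ws) + scale c (component scale (a ! j) b (us @ (i, v') # ws))"
      if "j < length a" for j
      using block_family_linear_on[OF a[OF nth_mem[OF that]], of b "{v, v'}" us i ws] b vs
      by (auto simp: linear_on_def)
    then show ?thesis
      unfolding component_def[symmetric] component_fam_poly
      by (simp add: scale_right_distrib sum.distrib scale_sum_right mult.commute)
  qed
qed

text \<open>
  In cohomology the linear part \<open>a(t)\<close> of a homotopy of endomorphisms obeys \<open>a' = D a\<close>, where \<open>D(t)\<close> is,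
  up to signs, the commutator with the curvature components \<open>b(t)\<^sup>(\<^sup>(\<^sup>x\<^sup>)\<^sup>)\<close> of the homotopy.
\<close>

lemma homotopic_id_cohomology:
  fixes d :: int and A :: "('o, 'b) quiver"
  assumes M: "pcy_category scale d A M" and char2: "CHAR('a) \<noteq> 2"
    and hom: "homotopic scale d A M A M \<Lambda> H id (fam_id d)" and X: "x \<in> Obj A" "y \<in> Obj A"
  shows "z \<in> cocycles scale A M x y i \<Longrightarrow> component scale H [x, y] [(i, z)] \<in> coboundaries scale A M x y i
      \<Longrightarrow> z \<in> coboundaries scale A M x y i"
    and "z \<in> cocycles scale A M x y i \<Longrightarrow>
      \<exists>z'\<in>cocycles scale A M x y i. component scale H [x, y] [(i, z')] - z \<in> coboundaries scale A M x y i"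
proof -
  let ?Z = "cocycles scale A M x y i" and ?B = "coboundaries scale A M x y i"
  \<comment> \<open>\<Lambda> is known to be the identity on \<open>Obj A\<close> only, so the
    target spaces are written with \<Lambda> and simplified where objects of A are inserted.\<close>
  let ?V = "Sp A" and ?W = "\<lambda>x y. Sp A (\<Lambda> x) (\<Lambda> y)"
  obtain a b where \<Lambda>: "\<And>x. x \<in> Obj A \<Longrightarrow> \<Lambda> x = x"
    and a: "\<And>f. f \<in> set a \<Longrightarrow> h_elem scale d A A \<Lambda> 0 f" and b: "\<And>f. f \<in> set b \<Longrightarrow> h_elem scale d A A \<Lambda> (- 1) f"
    and a0: "fam_eq scale A (fam_poly a 0) H" and a1: "fam_eq scale A (fam_poly a 1) (fam_id d)"
    and mor: "\<And>t. pcy_morphism scale d A M A M \<Lambda> (fam_poly a t)"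
    and ode: "\<And>t. fam_eq scale A (fam_poly_deriv a t)
           (\<lambda>x vs. pre_sum d 1 \<Lambda> M (fam_poly b t) (fam_poly a t) x vs
                 + multinec_sum d 1 (fam_poly b t) (fam_poly a t) M x vs)"
    and char: "CHAR('a) = 0 \<or> length a \<le> CHAR('a) \<and> length a + length b \<le> CHAR('a) + 1"
    using hom unfolding homotopic_def id_apply by blast
  note V = pcy_categoryD(1)[OF M] and Mf = pcy_categoryD(2)[OF M] and unc = pcy_categoryD(3)[OF M]
  have \<Lambda>_sub: "\<Lambda> ` Obj A \<subseteq> Obj A"
    using \<Lambda> by auto
  have W: "graded_subspaces scale (Obj A) ?W"
    using V \<Lambda> by (simp add: graded_subspaces_def)
  have M\<Lambda>: "block_family scale d (Obj A) ?W ?W 1 (\<lambda>y. M (map (map \<Lambda>) y))"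
    by (rule block_family_pullback[OF Mf \<Lambda>_sub])
  have af: "block_family scale d (Obj A) ?V ?W 0 f" if "f \<in> set a" for f
    by (rule h_elem_block_family[OF a[OF that]])
  have bf: "block_family scale d (Obj A) ?V ?W (- 1) f" if "f \<in> set b" for f
    by (rule h_elem_block_family[OF b[OF that]])
  note at = block_family_fam_poly[of a, OF af] and bt = block_family_fam_poly[of b, OF bf]
  have in2: "block_inputs ?V [x, y] [(j, v)]" if "v \<in> Sp A x y (j + 1)" for j v
    using that by (simp add: block_inputs_def)
  have in1: "block_inputs ?V [c] []" for c
    by (simp add: block_inputs_def)
  have sub: "subspace (Sp A x y j)" for j
    by (rule graded_subspaces_component[OF V X])
  note \<delta>_lin = differential_linear[OF M char2 X]
  let ?\<delta> = "\<lambda>j v. component scale M [x, y] [(j, v)]"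
  let ?\<alpha> = "\<lambda>j k v. component scale (a ! j) [x, y] [(k, v)]"
  have \<alpha>_mem: "?\<alpha> j k v \<in> Sp A x y (k + 1)" if "j < length a" "v \<in> Sp A x y (k + 1)" for j k v
    using component_mem[OF af[OF nth_mem[OF that(1)]] _ _ in2[OF that(2)] W] X \<Lambda> by simp
  have \<alpha>_lin: "linear_on scale (Sp A x y (k + 1)) (?\<alpha> j k)" if "j < length a" for j k
    using block_family_linear_on[OF af[OF nth_mem[OF that]], of "[x, y]" "Sp A x y (k + 1)" "[]" k "[]"] in2 X by simp
  \<comment> \<open>\<open>a(t)\<close> is a morphism for every t, and the chain map equation is
    polynomial in t with \<open>length a\<close> coefficients; root counting gives it for each
    coefficient.\<close>
  have \<alpha>_chain: "?\<alpha> j (k + 1) (?\<delta> k v) = ?\<delta> k (?\<alpha> j k v)" if j: "j < length a" and v: "v \<in> Sp A x y (k + 1)" for j k v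
  proof -
    have "(\<Sum>j<length a. scale (t ^ j) (?\<alpha> j (k + 1) (?\<delta> k v) - ?\<delta> k (?\<alpha> j k v))) = 0" for t
    proof -
      have "fam_eq scale A (multinec_sum d 0 (\<lambda>_ _. 0) (fam_poly a t) M) (pre_sum d 0 \<Lambda> M (\<lambda>_ _. 0) (fam_poly a t))"
        using mor[of t] by (simp add: pcy_morphism_def circ_multinec_def circ_pre_def)
      from fam_eq_tensor1[OF this _ _ in2[OF v]] X
      have "component scale (fam_poly a t) [x, y] [(k + 1, ?\<delta> k v)] = ?\<delta> k (component scale (fam_poly a t) [x, y] [(k, v)])"
        using multinec_sum_0_component[OF Mf V unc at W X v] pre_sum_components(1)[OF M\<Lambda> W X(1) at X(2) v] \<Lambda>
        by simp
      then show ?thesis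
        using linear_on_sum[OF sub \<delta>_lin, of "{..<length a}" "\<lambda>j. ?\<alpha> j k v" k "\<lambda>j. t ^ j"] \<alpha>_mem[OF _ v]
        by (simp add: component_fam_poly scale_right_diff_distrib sum_subtractf)
    qed
    from polynomial_coeffs_zero[OF _ this j] char show ?thesis
      by auto
  qed
  have comp0: "component scale H [x, y] [(i, z)] = (\<Sum>j<length a. scale (0 ^ j) (?\<alpha> j i z))" if "z \<in> Sp A x y (i + 1)" for z
    using fam_eq_tensor1[OF a0 _ _ in2[OF that]] X component_fam_poly[of a 0 "[x, y]" "[(i, z)]"]
    by (simp add: component_def)
  have comp1: "(\<Sum>j<length a. ?\<alpha> j i z) = z" if "z \<in> Sp A x y (i + 1)" for z
    using fam_eq_tensor1[OF a1 _ _ in2[OF that]] X component_fam_poly[of a 1 "[x, y]" "[(i, z)]"]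
    by (simp add: component_def fam_id_def)
  have ZV: "z \<in> ?Z \<Longrightarrow> z \<in> Sp A x y (i + 1)" "z \<in> ?Z \<Longrightarrow> ?\<delta> i z = 0" for z
    by (simp_all add: cocycles_def)
  have "(z \<in> ?Z \<longrightarrow> component scale H [x, y] [(i, z)] \<in> ?B \<longrightarrow> z \<in> ?B) \<and>
      (z \<in> ?Z \<longrightarrow> (\<exists>z'\<in>?Z. component scale H [x, y] [(i, z')] - z \<in> ?B))"
  proof (cases "a = []")
    \<comment> \<open>The empty polynomial is 0 and also the identity at t = 1, so there are no
      nonzero cocycles.\<close>
    case True
    then have "z = 0" if "z \<in> ?Z"
      using comp1[OF ZV(1)[OF that]] by simp
    then show ?thesis
      using comp0[of 0] True subspace_0[OF coboundaries_subspace[OF M char2 X]] subspace_0[OF sub] by force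
  next
    case False
    then have n: "0 < length a"
      by simp
    \<comment> \<open>With a nonempty \<open>a\<close>, the bound on both lengths leaves at most
      \<open>CHAR('a)\<close> coefficients for \<open>b\<close>.\<close>
    have char_b: "CHAR('a) = 0 \<or> length b \<le> CHAR('a)"
      using char n by linarith
    let ?\<beta> = "\<lambda>c j. component scale (b ! j) [c] []"
    have \<beta>_mem: "?\<beta> c j \<in> Sp A c c 0" if "j < length b" "c \<in> Obj A" for c j
      using component_mem[OF bf[OF nth_mem[OF that(1)]] _ _ in1 W, of c] that(2) \<Lambda> by simp
    \<comment> \<open>This is the homotopy equation on the type ((c)). Its left side vanishes
      because \<open>a(t)\<close> is uncurved for all t, so the input-free coefficients of
      \<open>a\<close> and of its derivative are zero; the right side is the differential of the
      input-free part of \<open>b(t)\<close>.\<close>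
    have \<beta>_cocycle: "component scale M [c, c] [(- 1, ?\<beta> c j)] = 0" if j: "j < length b" and c: "c \<in> Obj A" for c j
    proof -
      have "(\<Sum>j<length a. scale (t ^ j) (component scale (a ! j) [c] [])) = 0" for t
      proof -
        have "tensor_eq scale (fam_poly a t [[c]] []) 0"
          using mor[of t] c by (simp add: pcy_morphism_def uncurved_def)
        from tensor1_cong[OF this] show ?thesis
          unfolding component_fam_poly[symmetric] by (simp add: component_def tensor1_simps)
      qed
      from polynomial_coeffs_zero[OF _ this] char have "component scale (a ! k) [c] [] = 0" if "k < length a" for k
        using that by auto
      then have deriv: "component scale (fam_poly_deriv a t) [c] [] = 0" for t
        by (simp add: component_fam_poly_deriv)
      have "(\<Sum>j<length b. scale (t ^ j) (component scale M [c, c] [(- 1, ?\<beta> c j)])) = 0" for t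
      proof -
        have "component scale (fam_poly_deriv a t) [c] [] = tensor1 scale (pre_sum d 1 \<Lambda> M (fam_poly b t) (fam_poly a t) [[c]] [])
            + tensor1 scale (multinec_sum d 1 (fam_poly b t) (fam_poly a t) M [[c]] [])"
          using fam_eq_tensor1[OF ode[of t] _ _ in1[of c]] c by (simp add: component_def tensor1_simps)
        then have "component scale M [c, c] [(- 1, component scale (fam_poly b t) [c] [])] = 0"
          using pre_sum_components(2)[OF M\<Lambda> W c bt] multinec_sum_1_component(1)[OF Mf V unc bt W c] \<Lambda>[OF c] deriv
          by simp
        moreover have "linear_on scale (Sp A c c 0) (\<lambda>u. component scale M [c, c] [(- 1, u)])"
          using differential_linear[OF M char2 c c, of "- 1"] by simp
        from linear_on_sum[OF graded_subspaces_component[OF V c c] this, of "{..<length b}" "?\<beta> c" "\<lambda>j. t ^ j"]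
        have "component scale M [c, c] [(- 1, component scale (fam_poly b t) [c] [])]
            = (\<Sum>j<length b. scale (t ^ j) (component scale M [c, c] [(- 1, ?\<beta> c j)]))"
          unfolding component_fam_poly using \<beta>_mem[OF _ c] by simp
        ultimately show ?thesis
          by simp
      qed
      from polynomial_coeffs_zero[OF char_b this j] show ?thesis .
    qed
    define L where "L j u = component scale M [x, x, y] [(- 1, ?\<beta> x j), (i, u)]" for j u
    define R where "R j u = component scale M [x, y, y] [(i, u), (- 1, ?\<beta> y j)]" for j u
    define D where "D j u = L j u + scale (ksign i (- 1)) (R j u)" for j u
    have \<beta>_mem': "?\<beta> c j \<in> Sp A c c (- 1 + 1)" if "j < length b" "c \<in> Obj A" for c j
      using \<beta>_mem[OF that] by simp
    have LR_lin: "linear_on scale (Sp A x y (i + 1)) (L j)" "linear_on scale (Sp A x y (i + 1)) (R j)" if "j < length b" for j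
      unfolding L_def R_def
      using product_linear(1)[OF M char2 X(1,1,2) \<beta>_mem'[OF that X(1)], of i]
        product_linear(2)[OF M char2 X(1,2,2) \<beta>_mem'[OF that X(2)], of i] by simp_all
    have D_lin: "linear_on scale (Sp A x y (i + 1)) (D j)" if "j < length b" for j
      using LR_lin[OF that] unfolding linear_on_def D_def by (simp add: scale_right_distrib algebra_simps)
    have lin_mono: "linear_on scale ?Z f" if "linear_on scale (Sp A x y (i + 1)) f" for f
      using that ZV(1) unfolding linear_on_def by blast
    note Zs = cocycles_subspace[OF M char2 X, of i] and Bs = coboundaries_subspace[OF M char2 X, of i]
    have D_Z: "D j u \<in> ?Z" if "j < length b" "u \<in> ?Z" for j u
      unfolding D_def L_def R_def
      by (intro subspace_add[OF Zs] subspace_scale[OF Zs] multiplication_left(1)[OF M char2 X] multiplication_right(1)[OF M char2 X]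
          \<beta>_mem \<beta>_cocycle that X)
    have D_B: "D j u \<in> ?B" if "j < length b" "u \<in> ?B" for j u
      unfolding D_def L_def R_def
      by (intro subspace_add[OF Bs] subspace_scale[OF Bs] multiplication_left(2)[OF M char2 X] multiplication_right(2)[OF M char2 X]
          \<beta>_mem \<beta>_cocycle that X)
    have \<alpha>_Z: "?\<alpha> j i u \<in> ?Z" if j: "j < length a" and u: "u \<in> ?Z" for j u
    proof -
      have "?\<delta> i (?\<alpha> j i u) = ?\<alpha> j (i + 1) 0"
        using \<alpha>_chain[OF j ZV(1)[OF u]] ZV(2)[OF u] by simp
      also have "\<dots> = 0"
        by (rule linear_on_zero[OF sub \<alpha>_lin[OF j]])
      finally show ?thesis
        using \<alpha>_mem[OF j ZV(1)[OF u]] by (simp add: cocycles_def)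
    qed
    have \<alpha>_B: "?\<alpha> j i u \<in> ?B" if j: "j < length a" and u: "u \<in> ?B" for j u
    proof -
      obtain w where w: "w \<in> Sp A x y i" "u = ?\<delta> (i - 1) w"
        using u by (auto simp: coboundaries_def)
      then show ?thesis
        using \<alpha>_chain[OF j, of w "i - 1"] \<alpha>_mem[OF j, of w "i - 1"] by (simp add: coboundaries_def)
    qed
    \<comment> \<open>The homotopy equation on the type ((x, y)) at a cocycle \<open>u\<close>: the
      term with the differential of \<open>u\<close> vanishes, the differential of \<open>?q\<close>
      is the coboundary, and the two bushes make up D a.\<close>
    have flow: "(\<Sum>j<length a. scale (of_nat j * t ^ (j - 1)) (?\<alpha> j i u))
        - (\<Sum>k<length b. \<Sum>j<length a. scale (t ^ (k + j)) (D k (?\<alpha> j i u))) \<in> ?B" if u: "u \<in> ?Z" for t u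
    proof -
      note uV = ZV(1)[OF u]
      let ?at = "component scale (fam_poly a t) [x, y] [(i, u)]" and ?bt = "\<lambda>c. component scale (fam_poly b t) [c] []"
      let ?q = "component scale (fam_poly b t) [x, y] [(i, u)]"
      have at_mem: "?at \<in> Sp A x y (i + 1)"
        using component_mem[OF at _ _ in2[OF uV] W, of t] X \<Lambda> by simp
      have "component scale (fam_poly_deriv a t) [x, y] [(i, u)]
          = tensor1 scale (pre_sum d 1 \<Lambda> M (fam_poly b t) (fam_poly a t) [[x, y]] [(i, u)])
          + tensor1 scale (multinec_sum d 1 (fam_poly b t) (fam_poly a t) M [[x, y]] [(i, u)])"
        using fam_eq_tensor1[OF ode[of t] _ _ in2[OF uV]] X by (simp add: component_def tensor1_simps)
      also have "tensor1 scale (multinec_sum d 1 (fam_poly b t) (fam_poly a t) M [[x, y]] [(i, u)]) = 0"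
        using multinec_sum_1_component(2)[OF Mf V unc bt W X uV] ZV(2)[OF u] component_zero_slot2(3)[OF bt V X] X by simp
      also have "tensor1 scale (pre_sum d 1 \<Lambda> M (fam_poly b t) (fam_poly a t) [[x, y]] [(i, u)])
          = ?\<delta> (i - 1) ?q + (component scale M [x, x, y] [(- 1, ?bt x), (i, ?at)]
            + scale (ksign i (- 1)) (component scale M [x, y, y] [(i, ?at), (- 1, ?bt y)]))"
        using pre_sum_components(3)[OF M\<Lambda> W X(1) at bt X(2) uV, of t t] \<Lambda> X by simp
      also have "component scale M [x, x, y] [(- 1, ?bt x), (i, ?at)] = (\<Sum>k<length b. scale (t ^ k) (L k ?at))"
        unfolding component_fam_poly[of b] L_def
        using linear_on_sum[OF graded_subspaces_component[OF V X(1,1)] product_linear(2)[OF M char2 X(1,1,2) at_mem, of "- 1"],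
            of "{..<length b}" "?\<beta> x" "\<lambda>k. t ^ k"] \<beta>_mem X(1) by simp
      also have "component scale M [x, y, y] [(i, ?at), (- 1, ?bt y)] = (\<Sum>k<length b. scale (t ^ k) (R k ?at))"
        unfolding component_fam_poly[of b] R_def
        using linear_on_sum[OF graded_subspaces_component[OF V X(2,2)] product_linear(1)[OF M char2 X(1,2,2) at_mem, of "- 1"],
            of "{..<length b}" "?\<beta> y" "\<lambda>k. t ^ k"] \<beta>_mem X(2) by simp
      finally have "component scale (fam_poly_deriv a t) [x, y] [(i, u)] = ?\<delta> (i - 1) ?q + (\<Sum>k<length b. scale (t ^ k) (D k ?at))"
        by (simp add: D_def scale_right_distrib sum.distrib scale_sum_right mult.commute)
      also have "(\<Sum>k<length b. scale (t ^ k) (D k ?at)) = (\<Sum>k<length b. \<Sum>j<length a. scale (t ^ (k + j)) (D k (?\<alpha> j i u)))"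
      proof (intro sum.cong refl)
        fix k assume k: "k \<in> {..<length b}"
        have "D k ?at = (\<Sum>j<length a. scale (t ^ j) (D k (?\<alpha> j i u)))"
          unfolding component_fam_poly[of a]
          by (rule linear_on_sum[OF sub D_lin]) (use k \<alpha>_mem uV in auto)
        then show "scale (t ^ k) (D k ?at) = (\<Sum>j<length a. scale (t ^ (k + j)) (D k (?\<alpha> j i u)))"
          by (simp add: scale_sum_right power_add)
      qed
      finally have "(\<Sum>j<length a. scale (of_nat j * t ^ (j - 1)) (?\<alpha> j i u))
          - (\<Sum>k<length b. \<Sum>j<length a. scale (t ^ (k + j)) (D k (?\<alpha> j i u))) = ?\<delta> (i - 1) ?q"
        by (simp add: component_fam_poly_deriv)
      moreover have "?q \<in> Sp A x y i"
        using component_mem[OF bt _ _ in2[OF uV] W, of t] X \<Lambda> by simp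
      ultimately show ?thesis
        by (simp add: coboundaries_def)
    qed
    have end_id: "(\<Sum>j<length a. ?\<alpha> j i u) - u \<in> ?B" if "u \<in> ?Z" for u
      using comp1[OF ZV(1)[OF that]] subspace_0[OF Bs] by simp
    note F = flow_on_subquotient[OF vector_space_axioms Bs Zs coboundaries_subset[OF M char2 X],
        of "length a" "\<lambda>j. ?\<alpha> j i" "length b" D, OF lin_mono[OF \<alpha>_lin] \<alpha>_Z \<alpha>_B lin_mono[OF D_lin] D_Z D_B flow end_id n char]
    have "component scale H [x, y] [(i, u)] = ?\<alpha> 0 i u" if "u \<in> ?Z" for u
    proof -
      \<comment> \<open>Evaluation at t = 0 picks the constant coefficient, since
        \<open>0 ^ 0 = 1\<close>.\<close>
      have "(\<Sum>j<length a. scale (0 ^ j) (?\<alpha> j i u)) = (\<Sum>j<length a. if j = 0 then ?\<alpha> 0 i u else 0)"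
        by (intro sum.cong refl) auto
      then show ?thesis
        using comp0[OF ZV(1)[OF that]] n by simp
    qed
    then show ?thesis
      using F by auto
  qed
  then show "z \<in> ?Z \<Longrightarrow> component scale H [x, y] [(i, z)] \<in> ?B \<Longrightarrow> z \<in> ?B"
    and "z \<in> ?Z \<Longrightarrow> \<exists>z'\<in>?Z. component scale H [x, y] [(i, z')] - z \<in> ?B"
    by blast+
qed

section \<open>Linear parts of morphisms and the conclusion\<close>

lemma linear_part_eq:
  assumes "block_family scale d X V W n F" "x \<in> X" "y \<in> X" "v \<in> V x y (i + 1)"
  shows "linear_part scale F x y i v = component scale F [x, y] [(i, v)]"
  unfolding linear_part_def component_def
proof (rule tensor1_val_eq)
  fix w assume w: "w \<in> Poly_Mapping.keys (F [[x, y]] [(i, v)])"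
  show "length w = 1"
    by (rule block_family_keys[OF assms(1) _ _ _ w]) (use assms in \<open>simp_all add: block_inputs_def\<close>)
qed

lemma morphism_components:
  assumes MA: "pcy_category scale d A M\<^sub>A" and MB: "pcy_category scale d B M\<^sub>B"
    and F: "pcy_morphism scale d A M\<^sub>A B M\<^sub>B \<Phi> F" and X: "x \<in> Obj A" "y \<in> Obj A"
  shows "block_family scale d (Obj A) (Sp A) (\<lambda>x y. Sp B (\<Phi> x) (\<Phi> y)) 0 F"
    and "graded_subspaces scale (Obj A) (\<lambda>x y. Sp B (\<Phi> x) (\<Phi> y))"
    and "linear_on scale (Sp A x y (i + 1)) (\<lambda>v. component scale F [x, y] [(i, v)])"
    and "v \<in> Sp A x y (i + 1) \<Longrightarrow> component scale F [x, y] [(i, v)] \<in> Sp B (\<Phi> x) (\<Phi> y) (i + 1)"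
    and "v \<in> Sp A x y (i + 1) \<Longrightarrow> component scale F [x, y] [(i + 1, component scale M\<^sub>A [x, y] [(i, v)])]
      = component scale M\<^sub>B [\<Phi> x, \<Phi> y] [(i, component scale F [x, y] [(i, v)])]"
    and "v \<in> cocycles scale A M\<^sub>A x y i \<Longrightarrow> component scale F [x, y] [(i, v)] \<in> cocycles scale B M\<^sub>B (\<Phi> x) (\<Phi> y) i"
    and "v \<in> coboundaries scale A M\<^sub>A x y i \<Longrightarrow> component scale F [x, y] [(i, v)] \<in> coboundaries scale B M\<^sub>B (\<Phi> x) (\<Phi> y) i"
proof -
  have \<Phi>: "\<Phi> ` Obj A \<subseteq> Obj B" and h: "h_elem scale d A B \<Phi> 0 F"
    and eq: "fam_eq scale A (multinec_sum d 0 (\<lambda>_ _. 0) F M\<^sub>A) (pre_sum d 0 \<Phi> M\<^sub>B (\<lambda>_ _. 0) F)"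
    using F by (simp_all add: pcy_morphism_def circ_multinec_def circ_pre_def)
  show Ff: "block_family scale d (Obj A) (Sp A) (\<lambda>x y. Sp B (\<Phi> x) (\<Phi> y)) 0 F"
    by (rule h_elem_block_family[OF h])
  show W: "graded_subspaces scale (Obj A) (\<lambda>x y. Sp B (\<Phi> x) (\<Phi> y))"
    using pcy_categoryD(1)[OF MB] \<Phi> by (auto simp: graded_subspaces_def)
  have ins: "block_inputs (Sp A) [x, y] [(j, v)]" if "v \<in> Sp A x y (j + 1)" for j v
    using that by (simp add: block_inputs_def)
  show lin: "linear_on scale (Sp A x y (i + 1)) (\<lambda>v. component scale F [x, y] [(i, v)])" for i
    using block_family_linear_on[OF Ff, of "[x, y]" "Sp A x y (i + 1)" "[]" i "[]"] ins X by simp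
  show mem: "component scale F [x, y] [(i, v)] \<in> Sp B (\<Phi> x) (\<Phi> y) (i + 1)" if "v \<in> Sp A x y (i + 1)" for i v
    using component_mem[OF Ff _ _ ins[OF that] W] X by simp
  show chain: "component scale F [x, y] [(i + 1, component scale M\<^sub>A [x, y] [(i, v)])]
      = component scale M\<^sub>B [\<Phi> x, \<Phi> y] [(i, component scale F [x, y] [(i, v)])]" if v: "v \<in> Sp A x y (i + 1)" for i v
    using fam_eq_tensor1[OF eq _ _ ins[OF v]] X
      multinec_sum_0_component[OF pcy_categoryD(2,1,3)[OF MA] Ff W X v]
      pre_sum_components(1)[OF block_family_pullback[OF pcy_categoryD(2)[OF MB] \<Phi>] W X(1) Ff X(2) v]
    by simp
  show "component scale F [x, y] [(i, v)] \<in> cocycles scale B M\<^sub>B (\<Phi> x) (\<Phi> y) i" if "v \<in> cocycles scale A M\<^sub>A x y i"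
    using that chain[of v i] mem[of v i]
      linear_on_zero[OF graded_subspaces_component[OF pcy_categoryD(1)[OF MA] X] lin[of "i + 1"]]
    by (simp add: cocycles_def)
  show "component scale F [x, y] [(i, v)] \<in> coboundaries scale B M\<^sub>B (\<Phi> x) (\<Phi> y) i"
    if v: "v \<in> coboundaries scale A M\<^sub>A x y i"
  proof -
    obtain w where "w \<in> Sp A x y i" "v = component scale M\<^sub>A [x, y] [(i - 1, w)]"
      using v by (auto simp: coboundaries_def)
    then show ?thesis
      using chain[of w "i - 1"] mem[of w "i - 1"] by (simp add: coboundaries_def)
  qed
qed

lemma composition_component:
  assumes MA: "pcy_category scale d A M\<^sub>A" and MB: "pcy_category scale d B M\<^sub>B" and MC: "pcy_category scale d C M\<^sub>C"
    and F: "pcy_morphism scale d A M\<^sub>A B M\<^sub>B \<Phi> F" and G: "pcy_morphism scale d B M\<^sub>B C M\<^sub>C \<Psi> G"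
    and X: "x \<in> Obj A" "y \<in> Obj A" and v: "v \<in> Sp A x y (i + 1)"
  shows "component scale (fam_comp d \<Phi> G F) [x, y] [(i, v)]
    = component scale G [\<Phi> x, \<Phi> y] [(i, component scale F [x, y] [(i, v)])]"
proof -
  have \<Phi>: "\<Phi> ` Obj A \<subseteq> Obj B"
    using F by (simp add: pcy_morphism_def)
  then have Y: "\<Phi> x \<in> Obj B" "\<Phi> y \<in> Obj B"
    using X by auto
  have U: "graded_subspaces scale (Obj A) (\<lambda>x y. Sp C (\<Psi> (\<Phi> x)) (\<Psi> (\<Phi> y)))"
    using morphism_components(2)[OF MB MC G Y] \<Phi> by (auto simp: graded_subspaces_def)
  show ?thesis
    unfolding component_def[of scale "fam_comp d \<Phi> G F"]
    by (rule fam_comp_component[OF morphism_components(1)[OF MA MB F X]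
        block_family_pullback[OF morphism_components(1)[OF MB MC G Y] \<Phi>] morphism_components(2)[OF MA MB F X] U X v])
qed

lemma linear_part_cochain_complex:
  assumes M: "pcy_category scale d A M" and char2: "CHAR('a) \<noteq> 2" and X: "x \<in> Obj A" "y \<in> Obj A"
  shows "cochain_complex scale (\<lambda>i. Sp A x y (i + 1)) (linear_part scale M x y)"
proof -
  note lp = linear_part_eq[OF pcy_categoryD(2)[OF M] X]
  have sub: "subspace (Sp A x y i)" for i
    by (rule graded_subspaces_component[OF pcy_categoryD(1)[OF M] X])
  show ?thesis
    unfolding cochain_complex_def graded_linear_def
    using differential_mem[OF M char2 X] linear_onD[OF differential_linear[OF M char2 X]] differential_square[OF M char2 X]
    by (simp add: lp subspace_add[OF sub] subspace_scale[OF sub])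
qed

end

theorem proposition5p24:
  fixes scale :: "'k::field \<Rightarrow> 'v::ab_group_add \<Rightarrow> 'v"
    and d :: int
    and A :: "('o, 'v) quiver" and M\<^sub>A :: "('o, 'v, 'k) family"
    and B :: "('p, 'v) quiver" and M\<^sub>B :: "('p, 'v, 'k) family"
    and \<Phi> :: "'o \<Rightarrow> 'p" and F :: "('o, 'v, 'k) family"
  assumes "vector_space scale"
    and "CHAR('k) \<noteq> 2" and "CHAR('k) \<noteq> 3"
    and "pcy_category scale d A M\<^sub>A" and "pcy_category scale d B M\<^sub>B"
    and "pcy_morphism scale d A M\<^sub>A B M\<^sub>B \<Phi> F"
    and "homotopy_equivalence scale d A M\<^sub>A B M\<^sub>B \<Phi> F"
  shows "quasi_isomorphism scale A M\<^sub>A B M\<^sub>B \<Phi> F"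
  unfolding quasi_isomorphism_def
proof (intro ballI)
  fix x y assume X: "x \<in> Obj A" "y \<in> Obj A"
  interpret vector_space scale
    by (rule assms(1))
  note char2 = assms(2) and MA = assms(4) and MB = assms(5) and F = assms(6)
  obtain \<Psi> G where G: "pcy_morphism scale d B M\<^sub>B A M\<^sub>A \<Psi> G"
    and GF: "homotopic scale d A M\<^sub>A A M\<^sub>A (\<Psi> \<circ> \<Phi>) (fam_comp d \<Phi> G F) id (fam_id d)"
    and FG: "homotopic scale d B M\<^sub>B B M\<^sub>B (\<Phi> \<circ> \<Psi>) (fam_comp d \<Psi> F G) id (fam_id d)"
    using assms(7) unfolding homotopy_equivalence_def by blast
  \<comment> \<open>Homotopic morphisms agree on objects, so G leads back to exactly the spaces from
    which F started.\<close>
  have \<Psi>\<Phi>: "\<Psi> (\<Phi> x) = x" "\<Psi> (\<Phi> y) = y"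
    using GF X by (simp_all add: homotopic_def)
  have Y: "\<Phi> x \<in> Obj B" "\<Phi> y \<in> Obj B"
    using F X by (auto simp: pcy_morphism_def)
  let ?V = "\<lambda>i. Sp A x y (i + 1)" and ?W = "\<lambda>i. Sp B (\<Phi> x) (\<Phi> y) (i + 1)"
  have V: "subspace (?V i)" and W: "subspace (?W i)" for i
    by (rule graded_subspaces_component[OF pcy_categoryD(1)[OF MA] X],
        rule graded_subspaces_component[OF pcy_categoryD(1)[OF MB] Y])
  note lpA = linear_part_eq[OF pcy_categoryD(2)[OF MA] X] and lpB = linear_part_eq[OF pcy_categoryD(2)[OF MB] Y]
    and lpF = linear_part_eq[OF morphism_components(1)[OF MA MB F X] X]
  note mF = morphism_components[OF MA MB F X] and mG = morphism_components[OF MB MA G Y, unfolded \<Psi>\<Phi>]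
  have VW: "cochain_complex scale ?V (linear_part scale M\<^sub>A x y)"
    "cochain_complex scale ?W (linear_part scale M\<^sub>B (\<Phi> x) (\<Phi> y))"
    by (rule linear_part_cochain_complex[OF MA char2 X], rule linear_part_cochain_complex[OF MB char2 Y])
  have chain: "chain_map scale ?V (linear_part scale M\<^sub>A x y) ?W (linear_part scale M\<^sub>B (\<Phi> x) (\<Phi> y)) (linear_part scale F x y)"
    unfolding chain_map_def graded_linear_def
    using mF(4,5) linear_onD[OF mF(3)] differential_mem[OF MA char2 X]
    by (simp add: lpA lpB lpF subspace_add[OF V] subspace_scale[OF V])
  have imA: "linear_part scale M\<^sub>A x y (i - 1) ` ?V (i - 1) = coboundaries scale A M\<^sub>A x y i" for i
    unfolding coboundaries_def by (intro image_cong) (simp_all add: lpA)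
  have imB: "linear_part scale M\<^sub>B (\<Phi> x) (\<Phi> y) (i - 1) ` ?W (i - 1) = coboundaries scale B M\<^sub>B (\<Phi> x) (\<Phi> y) i" for i
    unfolding coboundaries_def by (intro image_cong) (simp_all add: lpB)
  have bij: "bij_betw (\<lambda>C. cohomologous ?W (linear_part scale M\<^sub>B (\<Phi> x) (\<Phi> y)) i `` (linear_part scale F x y i ` C))
      (cohomology ?V (linear_part scale M\<^sub>A x y) i) (cohomology ?W (linear_part scale M\<^sub>B (\<Phi> x) (\<Phi> y)) i)" for i
  proof (rule bij_betw_cohomology[OF V W VW chain], unfold imA imB)
    \<comment> \<open>Injectivity: G maps the coboundary F v to a coboundary, and G \<circ> F is
      injective on cohomology.\<close>
    fix v assume v: "v \<in> ?V i" "linear_part scale M\<^sub>A x y i v = 0"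
      and Fv: "linear_part scale F x y i v \<in> coboundaries scale B M\<^sub>B (\<Phi> x) (\<Phi> y) i"
    have "component scale (fam_comp d \<Phi> G F) [x, y] [(i, v)] \<in> coboundaries scale A M\<^sub>A x y i"
      using composition_component[OF MA MB MA F G X v(1)] mG(7) Fv v(1) by (simp add: lpF)
    moreover have "v \<in> cocycles scale A M\<^sub>A x y i"
      using v by (simp add: cocycles_def lpA)
    ultimately show "v \<in> coboundaries scale A M\<^sub>A x y i"
      by (rule homotopic_id_cohomology(1)[OF MA char2 GF X, rotated])
  next
    \<comment> \<open>Surjectivity: F \<circ> G is surjective on cohomology, and applying G to a
      preimage under F \<circ> G gives a preimage under F.\<close>
    fix w assume w: "w \<in> ?W i" "linear_part scale M\<^sub>B (\<Phi> x) (\<Phi> y) i w = 0"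
    then have "w \<in> cocycles scale B M\<^sub>B (\<Phi> x) (\<Phi> y) i"
      by (simp add: cocycles_def lpB)
    from homotopic_id_cohomology(2)[OF MB char2 FG Y this] obtain w'
      where w': "w' \<in> cocycles scale B M\<^sub>B (\<Phi> x) (\<Phi> y) i"
        "component scale (fam_comp d \<Psi> F G) [\<Phi> x, \<Phi> y] [(i, w')] - w \<in> coboundaries scale B M\<^sub>B (\<Phi> x) (\<Phi> y) i"
      by blast
    let ?u = "component scale G [\<Phi> x, \<Phi> y] [(i, w')]"
    have u: "?u \<in> cocycles scale A M\<^sub>A x y i"
      by (rule mG(6)[OF w'(1)])
    moreover have "w' \<in> ?W i"
      using w'(1) by (simp add: cocycles_def)
    ultimately have "linear_part scale F x y i ?u - w \<in> coboundaries scale B M\<^sub>B (\<Phi> x) (\<Phi> y) i"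
      using w'(2) composition_component[OF MB MA MB G F Y, of w' i] by (simp add: \<Psi>\<Phi> lpF cocycles_def)
    then show "\<exists>v\<in>?V i. linear_part scale M\<^sub>A x y i v = 0 \<and> linear_part scale F x y i v - w \<in> coboundaries scale B M\<^sub>B (\<Phi> x) (\<Phi> y) i"
      using u by (intro bexI[of _ ?u]) (simp_all add: cocycles_def lpA)
  qed
  show "quasi_iso_complexes scale ?V (linear_part scale M\<^sub>A x y) ?W (linear_part scale M\<^sub>B (\<Phi> x) (\<Phi> y)) (linear_part scale F x y)"
    unfolding quasi_iso_complexes_def using VW chain bij by blast
qed

end
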